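(* For every constant $p\ge 3$, the Connected Odd Cycle Transversal problem is NP-complete when restricted to graphs of girth at least $p$.
   Context: All graphs are finite and simple. The girth of a graph is the length of a shortest cycle in it (a forest has infinite girth). An odd cycle transversal of a graph $G$ is a set $S\subseteq V(G)$ such that $G-S$ is bipartite; it is connected if the induced subgraph $G[S]$ is connected. The Connected Odd Cycle Transversal problem: given a graph $G$ and an integer $k$, decide whether $G$ has a connected odd cycle transversal $S$ with $|S|\le k$. *)

theory Defs
  imports
    Main
    "HOL-Library.Extended_Nat"
    "HOL-Computational_Algebra.Polynomial"
begin

section \<open>Polynomial-time computation by deterministic multitape Turing machines\<close>

text \<open>
  Symbols and states are initial segments of the natural numbers. Symbol 0 is the blank,
  symbols 1 and 2 are the bits. Tapes are infinite in both directions.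
\<close>

datatype dir = Left_Move | Stay | Right_Move

record tm =
  num_tapes :: nat
  num_symbols :: nat
  num_states :: nat
  start_state :: nat
  halt_state :: nat
  delta :: "nat \<Rightarrow> nat list \<Rightarrow> nat \<times> (nat \<times> dir) list"

definition wf_tm :: "tm \<Rightarrow> bool" where
  "wf_tm M \<longleftrightarrow>
     1 \<le> num_tapes M \<and> 3 \<le> num_symbols M \<and>
     start_state M < num_states M \<and> halt_state M < num_states M \<and>
     (\<forall>q rs q' as.
        q < num_states M \<and> length rs = num_tapes M \<and> (\<forall>r\<in>set rs. r < num_symbols M) \<and>
        delta M q rs = (q', as) \<longrightarrow>
          q' < num_states M \<and> length as = num_tapes M \<and> (\<forall>(s, d)\<in>set as. s < num_symbols M))"

type_synonym tape = "(int \<Rightarrow> nat) \<times> int"  \<comment> \<open>contents and head position\<close>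
type_synonym config = "nat \<times> tape list"

fun read_tape :: "tape \<Rightarrow> nat" where
  "read_tape (c, h) = c h"

fun move_head :: "dir \<Rightarrow> int \<Rightarrow> int" where
  "move_head Left_Move h = h - 1"
| "move_head Stay h = h"
| "move_head Right_Move h = h + 1"

fun act_tape :: "nat \<times> dir \<Rightarrow> tape \<Rightarrow> tape" where
  "act_tape (s, d) (c, h) = (c(h := s), move_head d h)"

fun step :: "tm \<Rightarrow> config \<Rightarrow> config" where
  "step M (q, ts) =
     (if q = halt_state M then (q, ts)
      else let (q', as) = delta M q (map read_tape ts) in (q', map2 act_tape as ts))"

definition bit_symbol :: "bool \<Rightarrow> nat" where
  "bit_symbol b = (if b then 2 else 1)"

definition input_tape :: "bool list \<Rightarrow> tape" where
  "input_tape x =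
     (\<lambda>i. if 0 \<le> i \<and> i < int (length x) then bit_symbol (x ! nat i) else 0, 0)"

text \<open>
  A machine with several inputs receives them on its first tapes; the remaining tapes are blank.
\<close>

definition initial_config :: "tm \<Rightarrow> bool list list \<Rightarrow> config" where
  "initial_config M xs =
     (start_state M,
      map input_tape xs @ replicate (num_tapes M - length xs) (input_tape []))"

text \<open>The output is read off the last tape, from cell 0 up to the first blank.\<close>

definition output_on :: "tape \<Rightarrow> bool list \<Rightarrow> bool" where
  "output_on t y \<longleftrightarrow>
     (\<forall>i<length y. fst t (int i) = bit_symbol (y ! i)) \<and> fst t (int (length y)) = 0"

definition computes_within :: "tm \<Rightarrow> bool list list \<Rightarrow> nat \<Rightarrow> bool list \<Rightarrow> bool" where
  "computes_within M xs T y \<longleftrightarrow>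
     (\<exists>t\<le>T. \<exists>ts. (step M ^^ t) (initial_config M xs) = (halt_state M, ts) \<and> output_on (last ts) y)"

text \<open>Here \<open>m\<close> is the number of arguments of \<open>f\<close>, passed as a list.\<close>

definition poly_time_computable :: "nat \<Rightarrow> (bool list list \<Rightarrow> bool list) \<Rightarrow> bool" where
  "poly_time_computable m f \<longleftrightarrow>
     (\<exists>M (T :: nat poly). wf_tm M \<and> m \<le> num_tapes M \<and>
        (\<forall>xs. length xs = m \<longrightarrow>
           computes_within M xs (poly T (sum_list (map length xs))) (f xs)))"


section \<open>NP-completeness\<close>

type_synonym language = "bool list set"

definition in_NP :: "language \<Rightarrow> bool" where
  "in_NP L \<longleftrightarrow>
     (\<exists>(R :: bool list \<Rightarrow> bool list \<Rightarrow> bool) (b :: nat poly).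
        poly_time_computable 2 (\<lambda>xs. [R (xs ! 0) (xs ! 1)]) \<and>
        (\<forall>x. x \<in> L \<longleftrightarrow> (\<exists>w. length w \<le> poly b (length x) \<and> R x w)))"

definition poly_time_reducible :: "language \<Rightarrow> language \<Rightarrow> bool" where
  "poly_time_reducible A B \<longleftrightarrow>
     (\<exists>f. poly_time_computable 1 (\<lambda>xs. f (xs ! 0)) \<and> (\<forall>x. x \<in> A \<longleftrightarrow> f x \<in> B))"

definition NP_hard :: "language \<Rightarrow> bool" where
  "NP_hard L \<longleftrightarrow> (\<forall>A. in_NP A \<longrightarrow> poly_time_reducible A L)"

definition NP_complete :: "language \<Rightarrow> bool" where
  "NP_complete L \<longleftrightarrow> in_NP L \<and> NP_hard L"


section \<open>Graphs\<close>

type_synonym 'a graph = "'a set \<times> 'a set set"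

abbreviation verts :: "'a graph \<Rightarrow> 'a set" where "verts \<equiv> fst"
abbreviation edges :: "'a graph \<Rightarrow> 'a set set" where "edges \<equiv> snd"

definition simple_graph :: "'a graph \<Rightarrow> bool" where
  "simple_graph G \<longleftrightarrow> finite (verts G) \<and> (\<forall>e\<in>edges G. e \<subseteq> verts G \<and> card e = 2)"

definition induced_subgraph :: "'a graph \<Rightarrow> 'a set \<Rightarrow> 'a graph" where
  "induced_subgraph G S = (S, {e \<in> edges G. e \<subseteq> S})"

definition is_cycle :: "'a graph \<Rightarrow> 'a list \<Rightarrow> bool" where
  "is_cycle G c \<longleftrightarrow>
     3 \<le> length c \<and> distinct c \<and> set c \<subseteq> verts G \<and>
     (\<forall>i<length c. {c ! i, c ! (Suc i mod length c)} \<in> edges G)"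

text \<open>The infimum of the empty set is \<open>\<infinity>\<close>, so forests have infinite girth.\<close>

definition girth :: "'a graph \<Rightarrow> enat" where
  "girth G = (INF c\<in>{c. is_cycle G c}. enat (length c))"

definition bipartite :: "'a graph \<Rightarrow> bool" where
  "bipartite G \<longleftrightarrow>
     (\<exists>A B. A \<union> B = verts G \<and> A \<inter> B = {} \<and> (\<forall>e\<in>edges G. \<exists>a\<in>A. \<exists>b\<in>B. e = {a, b}))"

text \<open>The graph without vertices counts as connected.\<close>

definition connected_graph :: "'a graph \<Rightarrow> bool" where
  "connected_graph G \<longleftrightarrow>
     (\<forall>u\<in>verts G. \<forall>v\<in>verts G. (u, v) \<in> {(a, b). {a, b} \<in> edges G}\<^sup>*)"

definition odd_cycle_transversal :: "'a graph \<Rightarrow> 'a set \<Rightarrow> bool" where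
  "odd_cycle_transversal G S \<longleftrightarrow>
     S \<subseteq> verts G \<and> bipartite (induced_subgraph G (verts G - S))"

definition connected_odd_cycle_transversal :: "'a graph \<Rightarrow> 'a set \<Rightarrow> bool" where
  "connected_odd_cycle_transversal G S \<longleftrightarrow>
     odd_cycle_transversal G S \<and> connected_graph (induced_subgraph G S)"


section \<open>The Connected Odd Cycle Transversal problem\<close>

text \<open>
  Problem instances are graphs with vertex set \<open>{0, \<dots>, n - 1}\<close> together with a number \<open>k\<close>.
  They are encoded by the number \<open>n\<close> in unary, terminated by \<open>False\<close>, the adjacency matrix
  row by row, and \<open>k\<close> in binary with the least significant bit first.
\<close>

definition standard_vertices :: "nat graph \<Rightarrow> bool" where
  "standard_vertices G \<longleftrightarrow> verts G = {..<card (verts G)}"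

fun binary :: "nat \<Rightarrow> bool list" where
  "binary k = (if k = 0 then [] else odd k # binary (k div 2))"

declare binary.simps [simp del]

definition encode :: "nat graph \<Rightarrow> nat \<Rightarrow> bool list" where
  "encode G k =
     (let n = card (verts G) in
      replicate n True @ [False] @
      concat (map (\<lambda>i. map (\<lambda>j. {i, j} \<in> edges G) [0..<n]) [0..<n]) @
      binary k)"

definition connected_OCT_problem :: "(nat graph \<times> nat) set" where
  "connected_OCT_problem =
     {(G, k). simple_graph G \<and> standard_vertices G \<and>
              (\<exists>S. connected_odd_cycle_transversal G S \<and> card S \<le> k)}"

definition connected_OCT_girth_language :: "nat \<Rightarrow> language" where
  "connected_OCT_girth_language p =
     {encode G k | G k. (G, k) \<in> connected_OCT_problem \<and> enat p \<le> girth G}"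

lemma binary_0: "binary 0 = []"
  by (subst binary.simps) simp

lemma binary_pos: "0 < k \<Longrightarrow> binary k = odd k # binary (k div 2)"
  by (subst binary.simps) simp

lemma binary_inject: "binary k = binary l \<Longrightarrow> k = l"
proof (induction k arbitrary: l rule: less_induct)
  case (less k)
  show ?case
  proof (cases "k = 0 \<or> l = 0")
    case True
    then show ?thesis
      using less.prems by (metis binary_0 binary_pos list.distinct(1) neq0_conv)
  next
    case False
    then have "odd k = odd l" and *: "binary (k div 2) = binary (l div 2)"
      using less.prems binary_pos[of k] binary_pos[of l] by auto
    have "k div 2 = l div 2"
      using less.IH[of "k div 2" "l div 2"] False * by simp
    with \<open>odd k = odd l\<close> show ?thesis
      by presburger
  qed
qed

lemma replicate_terminated_inject:
  "replicate m True @ False # xs = replicate n True @ False # ys \<Longrightarrow> m = n \<and> xs = ys"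
proof (induction m arbitrary: n)
  case 0
  then show ?case by (cases n) auto
next
  case (Suc m)
  then show ?case by (cases n) auto
qed

theorem encode_inject:
  assumes "simple_graph G" "standard_vertices G" "simple_graph H" "standard_vertices H"
    and "encode G k = encode H l"
  shows "G = H \<and> k = l"
proof -
  define mat where
    "mat n E = concat (map (\<lambda>i. map (\<lambda>j. {i, j} \<in> E) [0..<n]) [0..<n])"
    for n :: nat and E :: "nat set set"
  define n where "n = card (verts G)"
  have len: "length (mat m E) = m * m" for m E
    by (simp add: mat_def length_concat comp_def sum_list_triv)
  have "replicate n True @ False # mat n (edges G) @ binary k =
        replicate (card (verts H)) True @ False # mat (card (verts H)) (edges H) @ binary l"
    using assms(5) by (simp add: encode_def mat_def n_def Let_def)
  from replicate_terminated_inject[OF this]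
  have n: "card (verts H) = n" and "mat n (edges G) @ binary k = mat n (edges H) @ binary l"
    by auto
  then have mat: "mat n (edges G) = mat n (edges H)" and "binary k = binary l"
    by (simp_all add: len)
  then have "k = l"
    using binary_inject by blast
  have V: "verts G = {..<n}" "verts H = {..<n}"
    using assms(2,4) n by (simp_all add: standard_vertices_def n_def)
  have "map (\<lambda>i. map (\<lambda>j. {i, j} \<in> edges G) [0..<n]) [0..<n] =
        map (\<lambda>i. map (\<lambda>j. {i, j} \<in> edges H) [0..<n]) [0..<n]"
    by (rule concat_injective) (use mat in \<open>auto simp: mat_def set_zip\<close>)
  then have adj: "{i, j} \<in> edges G \<longleftrightarrow> {i, j} \<in> edges H" if "i < n" "j < n" for i j
    using that by simp
  have edge: "e \<in> edges G \<longleftrightarrow> e \<in> edges H" if e: "e \<subseteq> {..<n}" "card e = 2" for e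
  proof -
    from e(2) obtain i j where ij: "e = {i, j}"
      by (meson card_2_iff)
    with e(1) have "i < n" "j < n"
      by simp_all
    with adj ij show ?thesis
      by simp
  qed
  have "e \<subseteq> {..<n} \<and> card e = 2" if "e \<in> edges G \<or> e \<in> edges H" for e
    using that assms(1,3) unfolding simple_graph_def V by blast
  with edge have "edges G = edges H"
    by blast
  with V(1) V(2)[symmetric] \<open>k = l\<close> show ?thesis
    by (metis prod_eqI)
qed

end

(* Membership in NP: a transversal is certified by itself, a 2-colouring of the rest and a rank
   function in which every vertex but one has a neighbour of smaller rank.

   Hardness: a computation of a verifier is a solution of binary constraints on one variable per
   time step, since a value may record when the cell under each head was last visited. The
   constraints become a graph with one vertex per pair (variable, value), in which solutions are
   independent transversals of the variables and hence complements of small vertex covers. Finally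
   every edge {a, b} is replaced by a long odd cycle through a and b, and a hub adjacent to all
   other a makes covers connected; it belongs to an extra block of otherwise unconstrained vertices,
   so that it can always be put into the cover. Deleting a cover that contains the hub leaves a
   forest of pendant paths, while a transversal has to hit each odd cycle.

   All machines are obtained from functions on unary numbers that are closed under polynomially
   bounded primitive recursion; these are compiled to Turing machines whose head positions serve
   as counters. *)

theory Submission
  imports Defs
begin

section \<open>Structured programs for Turing machines\<close>

text \<open>An edge can only forbid one pair of values, whence the insistence on binary constraints.
  A tableau with one variable per cell and time would relate several cells at once; with the time of
  the last visit, the symbol read is checked against a single earlier step. The price is a larger
  domain: a value consists of \<open>2 + 2 * K\<close> numbers of polynomial size. As the number
  \<open>K\<close> of tapes is a constant, there are only polynomially many values, each small
  enough to be a unary number.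

  Unary arithmetic would fail for powers with a variable exponent, which are replaced by repeated
  division, and for the binary parameter \<open>k\<close> of an instance, which is cut off at the
  number of vertices.

  The two paths of an edge are private to it and start at its two ends. A transversal vertex inside
  a path can be charged to the start of that path, so a transversal is at least as large as the
  cover obtained from it. With at least \<open>2 * q\<close> inner vertices on every path, a shorter
  cycle cannot contain a whole path.\<close>

datatype com =
    Mv nat dir
  | Wr nat bool
  | Seq com com (infixr ";;" 60)
  | Cond nat "nat \<Rightarrow> bool" com com
  | Loop nat "nat \<Rightarrow> bool" com

text \<open>The times are those of the compiled code: a test is one instruction, and the further 1
  after a then-branch or a loop body is the jump that \<open>compile\<close> puts there.\<close>

inductive exec :: "com \<Rightarrow> (nat \<Rightarrow> tape) \<Rightarrow> nat \<Rightarrow> (nat \<Rightarrow> tape) \<Rightarrow> bool" where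
  exec_Mv: "exec (Mv r d) s 1 (s(r := act_tape (read_tape (s r), d) (s r)))"
| exec_Wr: "exec (Wr r b) s 1 (s(r := act_tape (bit_symbol b, Stay) (s r)))"
| exec_Seq: "exec c s t s' \<Longrightarrow> exec d s' t' s'' \<Longrightarrow> exec (c ;; d) s (t + t') s''"
| exec_CondT: "g (read_tape (s r)) \<Longrightarrow> exec c s t s' \<Longrightarrow> exec (Cond r g c d) s (1 + (t + 1)) s'"
| exec_CondF: "\<not> g (read_tape (s r)) \<Longrightarrow> exec d s t s' \<Longrightarrow> exec (Cond r g c d) s (1 + t) s'"
| exec_LoopT: "g (read_tape (s r)) \<Longrightarrow> exec c s t s' \<Longrightarrow> exec (Loop r g c) s' t' s'' \<Longrightarrow>
    exec (Loop r g c) s (1 + (t + (1 + t'))) s''"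
| exec_LoopF: "\<not> g (read_tape (s r)) \<Longrightarrow> exec (Loop r g c) s 1 s"

type_synonym instr = "nat \<times> (nat \<Rightarrow> nat \<times> dir \<times> nat)"

fun code_size :: "com \<Rightarrow> nat" where
  "code_size (Mv r d) = 1"
| "code_size (Wr r b) = 1"
| "code_size (c ;; d) = code_size c + code_size d"
| "code_size (Cond r g c d) = code_size c + code_size d + 2"
| "code_size (Loop r g c) = code_size c + 2"

text \<open>Jump targets are absolute: \<open>n\<close> is the address of the first instruction, and
  control leaves the block at \<open>n + code_size c\<close>.\<close>

fun compile :: "com \<Rightarrow> nat \<Rightarrow> instr list" where
  "compile (Mv r d) n = [(r, \<lambda>s. (s, d, n + 1))]"
| "compile (Wr r b) n = [(r, \<lambda>s. (bit_symbol b, Stay, n + 1))]"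
| "compile (c ;; d) n = compile c n @ compile d (n + code_size c)"
| "compile (Cond r g c d) n =
     (r, \<lambda>s. (s, Stay, if g s then n + 1 else n + code_size c + 2)) # compile c (n + 1) @
     (r, \<lambda>s. (s, Stay, n + code_size c + code_size d + 2)) # compile d (n + code_size c + 2)"
| "compile (Loop r g c) n =
     (r, \<lambda>s. (s, Stay, if g s then n + 1 else n + code_size c + 2)) # compile c (n + 1) @
     [(r, \<lambda>s. (s, Stay, n))]"

fun max_tape :: "com \<Rightarrow> nat" where
  "max_tape (Mv r d) = r"
| "max_tape (Wr r b) = r"
| "max_tape (c ;; d) = max (max_tape c) (max_tape d)"
| "max_tape (Cond r g c d) = max r (max (max_tape c) (max_tape d))"
| "max_tape (Loop r g c) = max r (max_tape c)"

lemma length_compile [simp]: "length (compile c n) = code_size c"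
  by (induction c arbitrary: n) auto

text \<open>The bound on targets is not strict because of the exit address, which becomes the
  halting state.\<close>

lemma compile_wf:
  "(r, f) \<in> set (compile c n) \<Longrightarrow>
     r \<le> max_tape c \<and> (\<forall>s<3. fst (f s) < 3 \<and> snd (snd (f s)) \<le> n + code_size c)"
proof (induction c arbitrary: n)
  case (Seq c d)
  then consider "(r, f) \<in> set (compile c n)" | "(r, f) \<in> set (compile d (n + code_size c))" by auto
  then show ?case
  proof cases
    case 1
    from Seq.IH(1)[OF this] show ?thesis by fastforce
  next
    case 2
    from Seq.IH(2)[OF this] show ?thesis by fastforce
  qed
next
  case (Cond a g c d)
  then consider "(r, f) \<in> set (compile c (n + 1))"
    | "(r, f) \<in> set (compile d (n + code_size c + 2))"
    | "f = (\<lambda>s. (s, Stay, if g s then n + 1 else n + code_size c + 2)) \<and> r = a"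
    | "f = (\<lambda>s. (s, Stay, n + code_size c + code_size d + 2)) \<and> r = a"
    by auto
  then show ?case
  proof cases
    case 1
    from Cond.IH(1)[OF this] show ?thesis by fastforce
  next
    case 2
    from Cond.IH(2)[OF this] show ?thesis by fastforce
  qed auto
next
  case (Loop a g c)
  then consider "(r, f) \<in> set (compile c (n + 1))"
    | "f = (\<lambda>s. (s, Stay, if g s then n + 1 else n + code_size c + 2)) \<and> r = a"
    | "f = (\<lambda>s. (s, Stay, n)) \<and> r = a"
    by auto
  then show ?case
  proof cases
    case 1
    from Loop.IH[OF this] show ?thesis by fastforce
  qed auto
qed (auto simp: bit_symbol_def)

section \<open>Instruction lists as Turing machines\<close>

definition instr_step :: "instr list \<Rightarrow> nat \<times> (nat \<Rightarrow> tape) \<Rightarrow> nat \<times> (nat \<Rightarrow> tape)" where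
  "instr_step P = (\<lambda>(q, s).
     if q < length P
     then (let (r, f) = P ! q; (w, d, q') = f (read_tape (s r)) in (q', s(r := act_tape (w, d) (s r))))
     else (q, s))"

lemma act_tape_stay [simp]: "act_tape (read_tape u, Stay) u = u"
  by (cases u) auto

lemma funpow_trans:
  "(f ^^ t) x = y \<Longrightarrow> (f ^^ t') y = z \<Longrightarrow> (f ^^ (t + t')) x = z"
  by (metis add.commute comp_apply funpow_add)

lemma funpow_trans1: "f x = y \<Longrightarrow> (f ^^ t) y = z \<Longrightarrow> (f ^^ (1 + t)) x = z"
  using funpow_trans[of 1 f x y t z] by simp

text \<open>The surrounding code \<open>A\<close> and \<open>B\<close> is arbitrary because the
  induction descends to subprograms in the middle of \<open>P\<close>; their entry point is
  \<open>length A\<close>.\<close>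

lemma exec_instr_step:
  assumes "exec c s t s'" "P = A @ compile c (length A) @ B"
  shows "(instr_step P ^^ t) (length A, s) = (length A + code_size c, s')"
  using assms
proof (induction arbitrary: A B rule: exec.induct)
  case (exec_Mv r d s)
  then show ?case by (simp add: instr_step_def nth_append fun_upd_def)
next
  case (exec_Wr r b s)
  then show ?case by (simp add: instr_step_def nth_append fun_upd_def)
next
  case (exec_Seq c s t s' d t' s'')
  have 1: "(instr_step P ^^ t) (length A, s) = (length A + code_size c, s')"
    by (rule exec_Seq.IH(1)) (simp add: exec_Seq.prems)
  have 2: "(instr_step P ^^ t') (length (A @ compile c (length A)), s') =
     (length (A @ compile c (length A)) + code_size d, s'')"
    by (rule exec_Seq.IH(2)) (simp add: exec_Seq.prems)
  show ?case
    using funpow_trans[OF 1] 2 by (simp add: add.assoc)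
next
  case (exec_CondT g s r c t s' d)
  let ?A = "A @ [(r, \<lambda>s. (s, Stay, if g s then length A + 1 else length A + code_size c + 2))]"
  have 1: "instr_step P (length A, s) = (length ?A, s)"
    using exec_CondT.hyps exec_CondT.prems by (simp add: instr_step_def nth_append)
  have 2: "(instr_step P ^^ t) (length ?A, s) = (length ?A + code_size c, s')"
    by (rule exec_CondT.IH) (simp add: exec_CondT.prems)
  have 3: "(instr_step P ^^ 1) (length ?A + code_size c, s') =
     (length A + code_size (Cond r g c d), s')"
    using exec_CondT.prems by (simp add: instr_step_def nth_append)
  show ?case
    by (rule funpow_trans1[of "instr_step P", OF 1 funpow_trans[OF 2 3]])
next
  case (exec_CondF g s r d t s' c)
  let ?A = "A @ (r, \<lambda>s. (s, Stay, if g s then length A + 1 else length A + code_size c + 2)) #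
     compile c (length A + 1) @ [(r, \<lambda>s. (s, Stay, length A + code_size c + code_size d + 2))]"
  have 1: "instr_step P (length A, s) = (length ?A, s)"
    using exec_CondF.hyps exec_CondF.prems by (simp add: instr_step_def nth_append)
  have 2: "(instr_step P ^^ t) (length ?A, s) = (length ?A + code_size d, s')"
    by (rule exec_CondF.IH) (simp add: exec_CondF.prems)
  show ?case
    using funpow_trans1[of "instr_step P", OF 1 2] by (simp add: add_ac)
next
  case (exec_LoopT g s r c t s' t' s'')
  let ?A = "A @ [(r, \<lambda>s. (s, Stay, if g s then length A + 1 else length A + code_size c + 2))]"
  have 1: "instr_step P (length A, s) = (length ?A, s)"
    using exec_LoopT.hyps exec_LoopT.prems by (simp add: instr_step_def nth_append)
  have 2: "(instr_step P ^^ t) (length ?A, s) = (length ?A + code_size c, s')"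
    by (rule exec_LoopT.IH(1)) (simp add: exec_LoopT.prems)
  have 3: "instr_step P (length ?A + code_size c, s') = (length A, s')"
    using exec_LoopT.prems by (simp add: instr_step_def nth_append)
  have 4: "(instr_step P ^^ t') (length A, s') = (length A + code_size (Loop r g c), s'')"
    by (rule exec_LoopT.IH(2)) (simp add: exec_LoopT.prems)
  show ?case
    by (rule funpow_trans1[of "instr_step P",
          OF 1 funpow_trans[OF 2 funpow_trans1[of "instr_step P", OF 3 4]]])
next
  case (exec_LoopF g s r c)
  then show ?case by (simp add: instr_step_def nth_append)
qed

text \<open>Program tape 0 is the last tape of the machine, because the output is read off there.\<close>

definition tape_index :: "nat \<Rightarrow> nat \<Rightarrow> nat" where
  "tape_index K r = (if r = 0 then K - 1 else r - 1)"

definition tape_list :: "nat \<Rightarrow> (nat \<Rightarrow> tape) \<Rightarrow> tape list" where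
  "tape_list K s = map s ([1..<K] @ [0])"

definition tm_of :: "instr list \<Rightarrow> nat \<Rightarrow> tm" where
  "tm_of P K =
     \<lparr>num_tapes = K, num_symbols = 3, num_states = length P + 1, start_state = 0,
      halt_state = length P,
      delta = (\<lambda>q rs.
        if q < length P
        then (let (r, f) = P ! q; (w, d, q') = f (rs ! tape_index K r)
              in (q', (map (\<lambda>s. (s, Stay)) rs)[tape_index K r := (w, d)]))
        else (q, map (\<lambda>s. (s, Stay)) rs))\<rparr>"

lemma length_tape_list [simp]: "0 < K \<Longrightarrow> length (tape_list K s) = K"
  by (simp add: tape_list_def)

lemma nth_tape_list: "i < K \<Longrightarrow> tape_list K s ! i = s (if i = K - 1 then 0 else i + 1)"
  by (auto simp: tape_list_def nth_append simp del: upt_Suc)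

lemma step_tm_of:
  assumes "0 < K" "\<forall>(r, f)\<in>set P. r < K"
  shows "step (tm_of P K) (q, tape_list K s) =
     (fst (instr_step P (q, s)), tape_list K (snd (instr_step P (q, s))))"
proof (cases "q < length P")
  case True
  obtain r f where rf: "P ! q = (r, f)" by fastforce
  have r: "r < K"
    using assms(2) True rf by (metis (mono_tags, lifting) nth_mem case_prodD)
  then have idx: "tape_index K r < K"
    by (auto simp: tape_index_def)
  have rd: "map read_tape (tape_list K s) ! tape_index K r = read_tape (s r)"
    using idx assms(1) r by (simp add: nth_tape_list) (auto simp: tape_index_def)
  obtain w d q' where wd: "f (read_tape (s r)) = (w, d, q')"
    by (cases "f (read_tape (s r))") auto
  have "map2 act_tape ((map (\<lambda>s. (s, Stay)) (map read_tape (tape_list K s)))[tape_index K r := (w, d)])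
      (tape_list K s) = tape_list K (s(r := act_tape (w, d) (s r)))"
    (is "?l = ?r")
  proof (rule nth_equalityI)
    show "length ?l = length ?r" using assms(1) by simp
  next
    fix i assume "i < length ?l"
    then have i: "i < K" using assms(1) by simp
    have eq: "i = tape_index K r \<longleftrightarrow> (if i = K - 1 then 0 else i + 1) = r"
      using i r by (auto simp: tape_index_def)
    show "?l ! i = ?r ! i"
    proof (cases "i = tape_index K r")
      case True
      then show ?thesis using i assms(1) eq by (auto simp: nth_tape_list)
    next
      case False
      then show ?thesis using i assms(1) eq by (auto simp: nth_tape_list)
    qed
  qed
  then show ?thesis
    using True rf rd wd by (simp add: tm_of_def instr_step_def)
next
  case False
  have "map2 act_tape (map (\<lambda>s. (s, Stay)) (map read_tape (tape_list K s))) (tape_list K s) =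
    tape_list K s" (is "?l = ?r")
    by (rule nth_equalityI) auto
  then show ?thesis
    using False by (simp add: tm_of_def instr_step_def)
qed

lemma funpow_step_tm_of:
  assumes "0 < K" "\<forall>(r, f)\<in>set P. r < K"
  shows "(step (tm_of P K) ^^ t) (q, tape_list K s) =
     (fst ((instr_step P ^^ t) (q, s)), tape_list K (snd ((instr_step P ^^ t) (q, s))))"
  by (induction t) (use step_tm_of[OF assms] in auto)

lemma wf_tm_of:
  assumes "0 < K" "\<forall>(r, f)\<in>set P. r < K \<and> (\<forall>s<3. fst (f s) < 3 \<and> snd (snd (f s)) \<le> length P)"
  shows "wf_tm (tm_of P K)"
proof -
  have *: "q' \<le> length P \<and> length as = K \<and> (\<forall>(s, d)\<in>set as. s < 3)"
    if h: "q < length P + 1" "length rs = K" "\<forall>r\<in>set rs. r < 3" "delta (tm_of P K) q rs = (q', as)"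
    for q rs q' as
  proof (cases "q < length P")
    case True
    obtain r f where rf: "P ! q = (r, f)" by fastforce
    have r: "r < K" "\<And>s. s < 3 \<Longrightarrow> fst (f s) < 3 \<and> snd (snd (f s)) \<le> length P"
      using assms(2) True rf by (metis (mono_tags, lifting) nth_mem case_prodD)+
    have idx: "tape_index K r < K"
      using r(1) by (auto simp: tape_index_def)
    then have "rs ! tape_index K r < 3" using h by auto
    from r(2)[OF this] show ?thesis
      using h True rf
      by (auto simp: tm_of_def split: prod.splits dest!: set_update_subset_insert[THEN subsetD])
  next
    case False
    then show ?thesis using h by (auto simp: tm_of_def)
  qed
  show ?thesis
    unfolding wf_tm_def using assms(1) * by (fastforce simp: tm_of_def)
qed

lemma poly_nat_mono: "m \<le> n \<Longrightarrow> poly p m \<le> poly p n" for p :: "nat poly"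
  by (induction p) (auto intro!: add_mono mult_mono)

section \<open>Counter programs\<close>

text \<open>
  A counter is a tape with a marker in cell 0 and blanks elsewhere; its value is the head position.
  The input tapes 1 and 2 are treated like counters with other contents.
\<close>

definition tape_content :: "bool list \<Rightarrow> bool list \<Rightarrow> nat \<Rightarrow> int \<Rightarrow> nat" where
  "tape_content x w r =
     (if r = 1 then fst (input_tape x) else if r = 2 then fst (input_tape w)
      else (\<lambda>i. if i = 0 then bit_symbol False else 0))"

definition conf :: "bool list \<Rightarrow> bool list \<Rightarrow> (nat \<Rightarrow> nat) \<Rightarrow> bool list \<Rightarrow> nat \<Rightarrow> tape" where
  "conf x w h y =
     (\<lambda>r. if r = 0 then (fst (input_tape y), int (length y)) else (tape_content x w r, int (h r)))"

definition run ::
  "bool list \<Rightarrow> bool list \<Rightarrow> com \<Rightarrow> (nat \<Rightarrow> nat) \<Rightarrow> bool list \<Rightarrow> nat \<Rightarrow> (nat \<Rightarrow> nat) \<Rightarrow> bool list \<Rightarrow> bool" where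
  "run x w c h y T h' y' \<longleftrightarrow> (\<exists>t\<le>T. exec c (conf x w h y) t (conf x w h' y'))"

lemma run_mono: "run x w c h y T h' y' \<Longrightarrow> T \<le> T' \<Longrightarrow> run x w c h y T' h' y'"
  unfolding run_def by (meson order_trans)

lemma run_Seq:
  "run x w c h y T h' y' \<Longrightarrow> run x w d h' y' T' h'' y'' \<Longrightarrow> run x w (c ;; d) h y (T + T') h'' y''"
  unfolding run_def by (meson exec_Seq add_mono)

abbreviation inc :: "nat \<Rightarrow> com" where "inc r \<equiv> Mv r Right_Move"
abbreviation dec :: "nat \<Rightarrow> com" where "dec r \<equiv> Mv r Left_Move"
text \<open>A counter shows a blank exactly when its head has left the marker in cell 0, so reading
  symbol 0 means a positive value.\<close>

abbreviation while_pos :: "nat \<Rightarrow> com \<Rightarrow> com" where "while_pos r c \<equiv> Loop r (\<lambda>s. s = 0) c"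

lemma conf_read: "r \<noteq> 0 \<Longrightarrow> read_tape (conf x w h y r) = tape_content x w r (int (h r))"
  by (simp add: conf_def)

lemma run_inc: "r \<noteq> 0 \<Longrightarrow> run x w (inc r) h y 1 (h(r := h r + 1)) y"
proof -
  assume r: "r \<noteq> 0"
  have eq: "(conf x w h y)(r := act_tape (read_tape (conf x w h y r), Right_Move) (conf x w h y r)) =
      conf x w (h(r := h r + 1)) y"
    using r by (auto simp: conf_def fun_eq_iff)
  show ?thesis
    unfolding run_def using exec_Mv[of r Right_Move "conf x w h y"] by (subst (asm) eq) blast
qed

lemma run_dec: "r \<noteq> 0 \<Longrightarrow> 0 < h r \<Longrightarrow> run x w (dec r) h y 1 (h(r := h r - 1)) y"
proof -
  assume r: "r \<noteq> 0" "0 < h r"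
  have eq: "(conf x w h y)(r := act_tape (read_tape (conf x w h y r), Left_Move) (conf x w h y r)) =
      conf x w (h(r := h r - 1)) y"
    using r by (auto simp: conf_def fun_eq_iff)
  show ?thesis
    unfolding run_def using exec_Mv[of r Left_Move "conf x w h y"] by (subst (asm) eq) blast
qed

lemma run_output: "run x w (Wr 0 b ;; inc 0) h y 2 h (y @ [b])"
proof -
  let ?s = "(conf x w h y)(0 := act_tape (bit_symbol b, Stay) (conf x w h y 0))"
  have "exec (Wr 0 b ;; inc 0) (conf x w h y) (1 + 1)
      (?s(0 := act_tape (read_tape (?s 0), Right_Move) (?s 0)))"
    by (rule exec_Seq[OF exec_Wr exec_Mv])
  moreover have "?s(0 := act_tape (read_tape (?s 0), Right_Move) (?s 0)) = conf x w h (y @ [b])"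
    by (auto simp: conf_def fun_eq_iff input_tape_def nth_append)
  ultimately show ?thesis
    unfolding run_def by (intro exI[of _ "1 + 1"]) simp
qed

lemma run_Cond:
  assumes "r \<noteq> 0"
    and "g (tape_content x w r (int (h r))) \<Longrightarrow> run x w c h y T h' y'"
    and "\<not> g (tape_content x w r (int (h r))) \<Longrightarrow> run x w d h y T h' y'"
  shows "run x w (Cond r g c d) h y (T + 2) h' y'"
proof (cases "g (tape_content x w r (int (h r)))")
  case True
  from assms(2)[OF this] obtain t where "t \<le> T" "exec c (conf x w h y) t (conf x w h' y')"
    unfolding run_def by blast
  then show ?thesis
    unfolding run_def using exec_CondT[of g "conf x w h y" r c t "conf x w h' y'" d] True assms(1)
    by (intro exI[of _ "1 + (t + 1)"]) (simp add: conf_read)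
next
  case False
  from assms(3)[OF this] obtain t where "t \<le> T" "exec d (conf x w h y) t (conf x w h' y')"
    unfolding run_def by blast
  then show ?thesis
    unfolding run_def using exec_CondF[of g "conf x w h y" r d t "conf x w h' y'" c] False assms(1)
    by (intro exI[of _ "1 + t"]) (simp add: conf_read)
qed

text \<open>\<open>H i\<close> and \<open>Y i\<close> are the head positions and the output before
  round \<open>i\<close>. The guard is kept general so that a loop can also scan an input tape up to
  its first blank.\<close>

lemma run_Loop:
  assumes "r \<noteq> 0" "\<And>i. i < n \<Longrightarrow> run x w c (H i) (Y i) T (H (Suc i)) (Y (Suc i))"
    and "\<And>i. i \<le> n \<Longrightarrow> g (tape_content x w r (int (H i r))) \<longleftrightarrow> i < n"
  shows "run x w (Loop r g c) (H 0) (Y 0) (n * (T + 2) + 1) (H n) (Y n)"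
  using assms
proof (induction n arbitrary: H Y)
  case 0
  have "\<not> g (read_tape (conf x w (H 0) (Y 0) r))"
    using 0 by (simp add: conf_read)
  then have "exec (Loop r g c) (conf x w (H 0) (Y 0)) 1 (conf x w (H 0) (Y 0))"
    by (rule exec_LoopF)
  then show ?case unfolding run_def by auto
next
  case (Suc n)
  have "run x w (Loop r g c) (H (Suc 0)) (Y (Suc 0)) (n * (T + 2) + 1) (H (Suc n)) (Y (Suc n))"
    by (rule Suc.IH[where H = "\<lambda>i. H (Suc i)" and Y = "\<lambda>i. Y (Suc i)"]) (use Suc.prems in auto)
  then obtain t' where t': "t' \<le> n * (T + 2) + 1"
    "exec (Loop r g c) (conf x w (H (Suc 0)) (Y (Suc 0))) t' (conf x w (H (Suc n)) (Y (Suc n)))"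
    unfolding run_def by blast
  obtain t where t: "t \<le> T" "exec c (conf x w (H 0) (Y 0)) t (conf x w (H (Suc 0)) (Y (Suc 0)))"
    using Suc.prems(2)[of 0] unfolding run_def by auto
  have "g (read_tape (conf x w (H 0) (Y 0) r))"
    using Suc.prems(1,3) by (simp add: conf_read)
  from exec_LoopT[of g, OF this t(2) t'(2)] show ?case
    unfolding run_def using t t' by (intro exI[of _ "1 + (t + (1 + t'))"]) simp
qed

lemma run_while_pos:
  assumes "3 \<le> r" "\<And>i. i < n \<Longrightarrow> run x w c (H i) (Y i) T (H (Suc i)) (Y (Suc i))"
    and "\<And>i. i \<le> n \<Longrightarrow> H i r = n - i"
  shows "run x w (while_pos r c) (H 0) (Y 0) (n * (T + 2) + 1) (H n) (Y n)"
  by (rule run_Loop) (use assms in \<open>auto simp: tape_content_def bit_symbol_def\<close>)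

lemma run_clear: "3 \<le> r \<Longrightarrow> run x w (while_pos r (dec r)) h y (3 * h r + 1) (h(r := 0)) y"
proof -
  assume r: "3 \<le> r"
  have "run x w (dec r) (h(r := h r - i)) y 1 (h(r := h r - Suc i)) y" if "i < h r" for i
    using run_dec[of r "h(r := h r - i)" x w y] r that by simp
  from run_mono[OF run_while_pos[where n = "h r" and H = "\<lambda>i. h(r := h r - i)" and Y = "\<lambda>_. y", OF r this], of "3 * h r + 1"] show ?thesis
    by simp
qed

lemma run_move:
  "3 \<le> r \<Longrightarrow> 3 \<le> s \<Longrightarrow> r \<noteq> s \<Longrightarrow>
     run x w (while_pos r (dec r ;; inc s)) h y (4 * h r + 1) (h(r := 0, s := h s + h r)) y"
proof -
  assume r: "3 \<le> r" "3 \<le> s" "r \<noteq> s"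
  let ?H = "\<lambda>i. h(r := h r - i, s := h s + i)"
  have "run x w (dec r ;; inc s) (?H i) y (1 + 1) (?H (Suc i)) y" if "i < h r" for i
  proof -
    have "run x w (inc s) ((?H i)(r := ?H i r - 1)) y 1 (?H (Suc i)) y"
      using run_inc[of s x w "(?H i)(r := ?H i r - 1)" y] r by (simp add: fun_upd_twist)
    with run_dec[of r "?H i" x w y] show ?thesis using r that by (intro run_Seq) auto
  qed
  from run_mono[OF run_while_pos[where n = "h r" and H = ?H and Y = "\<lambda>_. y", OF r(1) this], of "4 * h r + 1"] show ?thesis
    using r by simp
qed

text \<open>Only the source, which is tested for zero, has to be a counter. The targets may be input
  tapes; this is how an input head is brought to a given cell.\<close>

lemma run_move2:
  "3 \<le> r \<Longrightarrow> s \<noteq> 0 \<Longrightarrow> u \<noteq> 0 \<Longrightarrow> r \<noteq> s \<Longrightarrow> r \<noteq> u \<Longrightarrow> s \<noteq> u \<Longrightarrow>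
     run x w (while_pos r (dec r ;; inc s ;; inc u)) h y (5 * h r + 1)
       (h(r := 0, s := h s + h r, u := h u + h r)) y"
proof -
  assume r: "3 \<le> r" "s \<noteq> 0" "u \<noteq> 0" "r \<noteq> s" "r \<noteq> u" "s \<noteq> u"
  let ?H = "\<lambda>i. h(r := h r - i, s := h s + i, u := h u + i)"
  have "run x w (dec r ;; inc s ;; inc u) (?H i) y (1 + (1 + 1)) (?H (Suc i)) y" if "i < h r" for i
  proof -
    let ?h1 = "(?H i)(r := ?H i r - 1)"
    let ?h2 = "?h1(s := ?h1 s + 1)"
    have eq: "?h2(u := ?h2 u + 1) = ?H (Suc i)"
      using r by (auto simp: fun_eq_iff)
    have "run x w (inc u) ?h2 y 1 (?h2(u := ?h2 u + 1)) y"
      using run_inc r by blast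
    then have "run x w (inc u) ?h2 y 1 (?H (Suc i)) y"
      unfolding eq .
    with run_dec[of r "?H i" x w y] run_inc[of s x w ?h1 y] show ?thesis
      using r that by (intro run_Seq) auto
  qed
  from run_mono[OF run_while_pos[where n = "h r" and H = ?H and Y = "\<lambda>_. y", OF r(1) this], of "5 * h r + 1"] show ?thesis
    using r by simp
qed

lemma run_move_down:
  "3 \<le> r \<Longrightarrow> s \<noteq> 0 \<Longrightarrow> r \<noteq> s \<Longrightarrow> h r \<le> h s \<Longrightarrow>
     run x w (while_pos r (dec r ;; dec s)) h y (4 * h r + 1) (h(r := 0, s := h s - h r)) y"
proof -
  assume r: "3 \<le> r" "s \<noteq> 0" "r \<noteq> s" "h r \<le> h s"
  let ?H = "\<lambda>i. h(r := h r - i, s := h s - i)"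
  have "run x w (dec r ;; dec s) (?H i) y (1 + 1) (?H (Suc i)) y" if "i < h r" for i
  proof -
    have "run x w (dec s) ((?H i)(r := ?H i r - 1)) y 1 (?H (Suc i)) y"
      using run_dec[of s "(?H i)(r := ?H i r - 1)" x w y] r that by (simp add: fun_upd_twist)
    with run_dec[of r "?H i" x w y] show ?thesis using r that by (intro run_Seq) auto
  qed
  from run_mono[OF run_while_pos[where n = "h r" and H = ?H and Y = "\<lambda>_. y", OF r(1) this], of "4 * h r + 1"] show ?thesis
    using r by simp
qed

section \<open>Functions computable in polynomial time with unary counters\<close>

type_synonym 'e ctx = "'e \<Rightarrow> bool list \<times> bool list \<times> nat list"

definition ctx_size :: "bool list \<times> bool list \<times> nat list \<Rightarrow> nat" where
  "ctx_size = (\<lambda>(x, w, ns). length x + length w + sum_list ns)"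

text \<open>The invariant at the borders of subprograms: free counters are zero and input heads are
  parked at cell 0, so programs compose without saving anything.\<close>

definition frame :: "nat \<Rightarrow> (nat \<Rightarrow> nat) \<Rightarrow> bool" where
  "frame b h \<longleftrightarrow> h 1 = 0 \<and> h 2 = 0 \<and> (\<forall>r\<ge>b. h r = 0)"

text \<open>
  A program for \<open>f\<close> finds the numbers of the context in the counters \<open>ls\<close> and leaves the value of
  \<open>f\<close> in the first free counter \<open>b\<close>. The bound does not depend on the placement, which
  makes loops and weakening possible.
\<close>

definition comp_in :: "'e ctx \<Rightarrow> ('e \<Rightarrow> nat) \<Rightarrow> nat poly \<Rightarrow> nat list \<Rightarrow> nat \<Rightarrow> com \<Rightarrow> bool" where
  "comp_in C f P ls b c \<longleftrightarrow>
     (\<forall>e h y x w. C e = (x, w, map h ls) \<longrightarrow> frame b h \<longrightarrow>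
        run x w c h y (poly P (ctx_size (C e))) (h(b := f e)) y)"

text \<open>One polynomial bounds both the value and the running time, so a loop whose number of
  rounds has been computed is polynomial again.\<close>

definition PT :: "'e ctx \<Rightarrow> ('e \<Rightarrow> nat) \<Rightarrow> bool" where
  "PT C f \<longleftrightarrow>
     (\<exists>P. (\<forall>e. f e \<le> poly P (ctx_size (C e))) \<and>
        (\<forall>ls b. 3 \<le> b \<longrightarrow> (\<forall>l\<in>set ls. 3 \<le> l \<and> l < b) \<longrightarrow> (\<exists>c. comp_in C f P ls b c)))"

definition poly_bounded :: "'e ctx \<Rightarrow> ('e \<Rightarrow> nat) \<Rightarrow> bool" where
  "poly_bounded C f \<longleftrightarrow> (\<exists>P. \<forall>e. f e \<le> poly P (ctx_size (C e)))"

text \<open>Variables bound by quantifiers, counting or recursion are pushed in front, as with de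
  Bruijn indices; \<open>snd\<close> is the innermost one.\<close>

definition extend :: "'e ctx \<Rightarrow> ('e \<times> nat) ctx" where
  "extend C = (\<lambda>(e, i). case C e of (x, w, ns) \<Rightarrow> (x, w, i # ns))"

lemma ctx_size_extend [simp]: "ctx_size (extend C (e, i)) = ctx_size (C e) + i"
  by (simp add: extend_def ctx_size_def split: prod.splits)

lemma extend_eq: "extend C e = (x, w, ns) \<longleftrightarrow> (\<exists>ns'. ns = snd e # ns' \<and> C (fst e) = (x, w, ns'))"
  by (cases e) (auto simp: extend_def split: prod.splits)

lemma PT_poly_bounded: "PT C f \<Longrightarrow> poly_bounded C f"
  unfolding PT_def poly_bounded_def by blast

lemma PT_const: "PT C (\<lambda>_. k)"
proof -
  have "\<exists>c. comp_in C (\<lambda>_. k) [:k + 1:] ls b c" if "3 \<le> b" for ls b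
  proof (induction k)
    case 0
    \<comment> \<open>There is no skip command; clearing a counter that is already zero takes its
      place.\<close>
    have "run x w (while_pos b (dec b)) h y 1 (h(b := 0)) y" if "frame b h" for x w h y
      using run_clear[of b x w h y] that \<open>3 \<le> b\<close> by (auto simp: frame_def)
    then show ?case
      unfolding comp_in_def by (intro exI[of _ "while_pos b (dec b)"]) simp
  next
    case (Suc k)
    then obtain c where c: "comp_in C (\<lambda>_. k) [:k + 1:] ls b c" by blast
    have "run x w (c ;; inc b) h y (Suc k + 1) (h(b := Suc k)) y"
      if "C e = (x, w, map h ls)" "frame b h" for e x w h y
    proof -
      have "run x w c h y (k + 1) (h(b := k)) y"
        using c that unfolding comp_in_def by fastforce
      from run_Seq[OF this run_inc[of b]] show ?thesis using \<open>3 \<le> b\<close> by simp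
    qed
    then show ?case
      unfolding comp_in_def by (intro exI[of _ "c ;; inc b"]) auto
  qed
  then show ?thesis
    unfolding PT_def by (intro exI[of _ "[:k + 1:]"]) auto
qed

text \<open>Reading a counter destroys it. The value \<open>v\<close> is therefore moved to the
  scratch counter \<open>b + 1\<close> and from there simultaneously back to \<open>l\<close> and to
  \<open>b\<close>, at cost \<open>4 * v + 1\<close> and \<open>5 * v + 1\<close>.\<close>

lemma PT_snd: "PT (extend C) snd"
proof -
  have "\<exists>c. comp_in (extend C) snd [:2, 9:] ls b c"
    if b: "3 \<le> b" "\<forall>l\<in>set ls. 3 \<le> l \<and> l < b" for ls b
  proof (cases ls)
    case Nil
    then show ?thesis by (auto simp: comp_in_def extend_eq)
  next
    case (Cons l ls')
    let ?c = "while_pos l (dec l ;; inc (b + 1)) ;; while_pos (b + 1) (dec (b + 1) ;; inc l ;; inc b)"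
    have l: "3 \<le> l" "l < b" using b Cons by auto
    have "run x w ?c h y (poly [:2, 9:] (ctx_size (extend C e))) (h(b := snd e)) y"
      if h: "extend C e = (x, w, map h ls)" "frame b h" for e x w h y
    proof -
      have i: "h l = snd e" using h Cons by (auto simp: extend_eq)
      then have i2: "h l \<le> ctx_size (extend C e)" by (cases e) simp
      let ?h1 = "h(l := 0, b + 1 := h (b + 1) + h l)"
      have 1: "run x w (while_pos l (dec l ;; inc (b + 1))) h y (4 * h l + 1) ?h1 y"
        using run_move[of l "b + 1" x w h y] l by simp
      have 2: "run x w (while_pos (b + 1) (dec (b + 1) ;; inc l ;; inc b)) ?h1 y (5 * ?h1 (b + 1) + 1)
        (?h1(b + 1 := 0, l := ?h1 l + ?h1 (b + 1), b := ?h1 b + ?h1 (b + 1))) y"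
        by (rule run_move2) (use l in auto)
      have "?h1(b + 1 := 0, l := ?h1 l + ?h1 (b + 1), b := ?h1 b + ?h1 (b + 1)) = h(b := snd e)"
        using h(2) l i by (auto simp: frame_def fun_eq_iff)
      with run_Seq[OF 1 2] have "run x w ?c h y (4 * h l + 1 + (5 * ?h1 (b + 1) + 1)) (h(b := snd e)) y"
        by simp
      then show ?thesis
        by (rule run_mono) (use h(2) l i2 in \<open>auto simp: frame_def\<close>)
    qed
    then show ?thesis unfolding comp_in_def by blast
  qed
  moreover have "snd e \<le> poly [:2, 9:] (ctx_size (extend C e))" for e
    by (cases e) simp
  ultimately show ?thesis
    unfolding PT_def by (intro exI[of _ "[:2, 9:]"]) blast
qed

text \<open>The program for \<open>f\<close> is reused unchanged: dropping the innermost variable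
  only removes the head of the list of counters.\<close>

lemma PT_weaken: "PT C f \<Longrightarrow> PT (extend C) (\<lambda>e. f (fst e))"
proof -
  assume "PT C f"
  then obtain P where P: "\<And>e. f e \<le> poly P (ctx_size (C e))"
    "\<And>ls b. 3 \<le> b \<Longrightarrow> \<forall>l\<in>set ls. 3 \<le> l \<and> l < b \<Longrightarrow> \<exists>c. comp_in C f P ls b c"
    unfolding PT_def by blast
  have le: "poly P (ctx_size (C (fst e))) \<le> poly P (ctx_size (extend C e))" for e
    by (cases e) (auto intro: poly_nat_mono)
  have "\<exists>c. comp_in (extend C) (\<lambda>e. f (fst e)) P ls b c"
    if b: "3 \<le> b" "\<forall>l\<in>set ls. 3 \<le> l \<and> l < b" for ls b
  proof (cases ls)
    case Nil
    then show ?thesis by (auto simp: comp_in_def extend_eq)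
  next
    case (Cons l ls')
    with b P(2)[of b ls'] obtain c where c: "comp_in C f P ls' b c" by auto
    have "comp_in (extend C) (\<lambda>e. f (fst e)) P ls b c"
      unfolding comp_in_def
    proof (intro allI impI)
      fix e h y x w assume a: "extend C e = (x, w, map h ls)" "frame b h"
      then have "C (fst e) = (x, w, map h ls')" using Cons by (auto simp: extend_eq)
      with c a(2) have "run x w c h y (poly P (ctx_size (C (fst e)))) (h(b := f (fst e))) y"
        unfolding comp_in_def by blast
      then show "run x w c h y (poly P (ctx_size (extend C e))) (h(b := f (fst e))) y"
        by (rule run_mono) (rule le)
    qed
    then show ?thesis ..
  qed
  with P(1) le show ?thesis
    unfolding PT_def by (intro exI[of _ P]) (meson order_trans)
qed

lemma map_upd_fresh: "\<forall>l\<in>set ls. (3::nat) \<le> l \<and> l < b \<Longrightarrow> b \<le> b' \<Longrightarrow> map (h(b' := n)) ls = map h ls"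
  by (auto simp: map_eq_conv)

lemma PT_Suc: "PT C f \<Longrightarrow> PT C (\<lambda>e. Suc (f e))"
proof -
  assume "PT C f"
  then obtain P where P: "\<And>e. f e \<le> poly P (ctx_size (C e))"
    "\<And>ls b. 3 \<le> b \<Longrightarrow> \<forall>l\<in>set ls. 3 \<le> l \<and> l < b \<Longrightarrow> \<exists>c. comp_in C f P ls b c"
    unfolding PT_def by blast
  have "\<exists>c. comp_in C (\<lambda>e. Suc (f e)) (P + 1) ls b c"
    if b: "3 \<le> b" "\<forall>l\<in>set ls. 3 \<le> l \<and> l < b" for ls b
  proof -
    obtain c where c: "comp_in C f P ls b c" using P(2) b by blast
    have "run x w (c ;; inc b) h y (poly (P + 1) (ctx_size (C e))) (h(b := Suc (f e))) y"
      if h: "C e = (x, w, map h ls)" "frame b h" for e x w h y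
    proof -
      have "run x w c h y (poly P (ctx_size (C e))) (h(b := f e)) y"
        using c h unfolding comp_in_def by blast
      from run_Seq[OF this run_inc[of b]] show ?thesis using b by simp
    qed
    then show ?thesis unfolding comp_in_def by blast
  qed
  with P(1) show ?thesis
    unfolding PT_def by (intro exI[of _ "P + 1"]) auto
qed

text \<open>The input head walks to cell \<open>f e\<close> while \<open>b + 1\<close> records the
  distance. This empties \<open>b\<close>, which then receives the symbol 0, 1 or 2, and
  \<open>b + 1\<close> drives the head back.\<close>

lemma PT_symbol:
  assumes "PT C f" "i = 1 \<or> i = 2"
  shows "PT C (\<lambda>e. tape_content (fst (C e)) (fst (snd (C e))) i (int (f e)))"
proof -
  obtain P where P: "\<And>e. f e \<le> poly P (ctx_size (C e))"
    "\<And>ls b. 3 \<le> b \<Longrightarrow> \<forall>l\<in>set ls. 3 \<le> l \<and> l < b \<Longrightarrow> \<exists>c. comp_in C f P ls b c"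
    using assms(1) unfolding PT_def by blast
  let ?g = "\<lambda>e. tape_content (fst (C e)) (fst (snd (C e))) i (int (f e))"
  have g2: "tape_content x w i j \<le> 2" for x w j
    using assms(2) by (auto simp: tape_content_def input_tape_def bit_symbol_def)
  let ?R = "smult 10 P + [:12:]"
  have "\<exists>c. comp_in C ?g ?R ls b c"
    if b: "3 \<le> b" "\<forall>l\<in>set ls. 3 \<le> l \<and> l < b" for ls b
  proof -
    obtain c where c: "comp_in C f P ls b c" using P(2) b by blast
    let ?nop = "while_pos b (dec b)"
    let ?test = "Cond i (\<lambda>s. s = 0) ?nop (Cond i (\<lambda>s. s = 1) (inc b) (inc b ;; inc b))"
    let ?c = "c ;; while_pos b (dec b ;; inc (b + 1) ;; inc i) ;; ?test ;; while_pos (b + 1) (dec (b + 1) ;; dec i)"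
    have "run x w ?c h y (poly ?R (ctx_size (C e))) (h(b := ?g e)) y"
      if h: "C e = (x, w, map h ls)" "frame b h" for e x w h y
    proof -
      have hi: "h i = 0" "h b = 0" "h (b + 1) = 0" using h(2) assms(2) by (auto simp: frame_def)
      have ib: "i \<noteq> b" "i \<noteq> b + 1" "b \<noteq> i" "i \<noteq> 0" using assms(2) b by auto
      let ?h1 = "h(b := f e)"
      let ?h2 = "h(b + 1 := f e, i := f e)"
      let ?h3 = "?h2(b := ?g e)"
      have 1: "run x w c h y (poly P (ctx_size (C e))) ?h1 y"
        using c h unfolding comp_in_def by blast
      have "run x w (while_pos b (dec b ;; inc (b + 1) ;; inc i)) ?h1 y (5 * ?h1 b + 1)
         (?h1(b := 0, b + 1 := ?h1 (b + 1) + ?h1 b, i := ?h1 i + ?h1 b)) y"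
        by (rule run_move2) (use b ib in auto)
      moreover have "?h1(b := 0, b + 1 := ?h1 (b + 1) + ?h1 b, i := ?h1 i + ?h1 b) = ?h2"
        using hi ib by (auto simp: fun_eq_iff)
      ultimately have 2: "run x w (while_pos b (dec b ;; inc (b + 1) ;; inc i)) ?h1 y (5 * f e + 1) ?h2 y"
        by simp
      have sym: "tape_content x w i (int (?h2 i)) = ?g e"
        using h(1) by simp
      have nop: "run x w ?nop ?h2 y 2 ?h3 y" if "?g e = 0"
        using run_clear[of b x w ?h2 y] b hi ib that by (auto intro: run_mono)
      have inc1: "run x w (inc b) ?h2 y 2 ?h3 y" if "?g e = 1"
        using run_inc[of b x w ?h2 y] b hi ib that by (auto intro: run_mono)
      have inc2: "run x w (inc b ;; inc b) ?h2 y 2 ?h3 y" if "?g e = 2"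
        using run_Seq[OF run_inc[of b x w ?h2 y] run_inc[of b x w "?h2(b := ?h2 b + 1)" y]] b hi ib that
        by (auto simp: numeral_2_eq_2)
      have gc: "?g e = 0 \<or> ?g e = 1 \<or> ?g e = 2"
        using g2[of "fst (C e)" "fst (snd (C e))" "int (f e)"] by linarith
      have 3: "run x w ?test ?h2 y (2 + 2 + 2) ?h3 y"
      proof (rule run_Cond[OF ib(4)], unfold sym)
        assume "?g e = 0"
        then show "run x w ?nop ?h2 y (2 + 2) ?h3 y" using nop run_mono by fastforce
      next
        assume "?g e \<noteq> 0"
        with gc inc1 inc2 show "run x w (Cond i (\<lambda>s. s = 1) (inc b) (inc b ;; inc b)) ?h2 y (2 + 2) ?h3 y"
          by (intro run_Cond[OF ib(4)]; unfold sym) auto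
      qed
      have 4: "run x w (while_pos (b + 1) (dec (b + 1) ;; dec i)) ?h3 y (4 * ?h3 (b + 1) + 1)
        (?h3(b + 1 := 0, i := ?h3 i - ?h3 (b + 1))) y"
        by (rule run_move_down) (use b ib in auto)
      have eq: "?h3(b + 1 := 0, i := ?h3 i - ?h3 (b + 1)) = h(b := ?g e)"
        using hi ib by (auto simp: fun_eq_iff)
      from run_Seq[OF 1 run_Seq[OF 2 run_Seq[OF 3 4[unfolded eq]]]] show ?thesis
        by (rule run_mono) (use P(1)[of e] ib in simp)
    qed
    then show ?thesis unfolding comp_in_def by blast
  qed
  moreover have "?g e \<le> poly ?R (ctx_size (C e))" for e
    using g2[of "fst (C e)" "fst (snd (C e))" "int (f e)"] by simp
  ultimately show ?thesis
    unfolding PT_def by (intro exI[of _ ?R]) blast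
qed


text \<open>Bits are nonblank symbols, so the first blank ends the word. Of the two counters filled
  during the scan, \<open>b\<close> keeps the length and \<open>b + 1\<close> is spent on the way
  back.\<close>

lemma PT_length:
  fixes i :: nat
  assumes "i = 1 \<or> i = 2"
  shows "PT C (\<lambda>e. length (if i = 1 then fst (C e) else fst (snd (C e))))"
proof -
  let ?g = "\<lambda>e. length (if i = 1 then fst (C e) else fst (snd (C e)))"
  let ?R = "[:2, 9:]"
  have g: "?g e \<le> ctx_size (C e)" for e
    by (auto simp: ctx_size_def split: prod.splits)
  have "\<exists>c. comp_in C ?g ?R ls b c" if b: "3 \<le> b" for ls b
  proof -
    let ?scan = "Loop i (\<lambda>s. s \<noteq> 0) (inc b ;; inc (b + 1) ;; inc i)"
    let ?c = "?scan ;; while_pos (b + 1) (dec (b + 1) ;; dec i)"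
    have "run x w ?c h y (poly ?R (ctx_size (C e))) (h(b := ?g e)) y"
      if h: "C e = (x, w, map h ls)" "frame b h" for e x w h y
    proof -
      have hi: "h i = 0" "h b = 0" "h (b + 1) = 0" using h(2) assms by (auto simp: frame_def)
      have ib: "i \<noteq> b" "i \<noteq> b + 1" "b \<noteq> i" "i \<noteq> 0" using assms b by auto
      let ?H = "\<lambda>j. h(b := j, b + 1 := j, i := j)"
      have 1: "run x w (inc b ;; inc (b + 1) ;; inc i) (?H j) y (1 + (1 + 1)) (?H (Suc j)) y" for j
      proof -
        let ?h1 = "(?H j)(b := ?H j b + 1)"
        let ?h2 = "?h1(b + 1 := ?h1 (b + 1) + 1)"
        have eq: "?h2(i := ?h2 i + 1) = ?H (Suc j)"
          using ib by (auto simp: fun_eq_iff)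
        have "run x w (inc i) ?h2 y 1 (?h2(i := ?h2 i + 1)) y"
          using run_inc ib by blast
        then have "run x w (inc i) ?h2 y 1 (?H (Suc j)) y"
          unfolding eq .
        with run_inc[of b x w "?H j" y] run_inc[of "b + 1" x w ?h1 y] show ?thesis
          using b by (intro run_Seq) auto
      qed
      have "tape_content x w i (int j) \<noteq> 0 \<longleftrightarrow> j < ?g e" for j
        using h(1) assms by (auto simp: tape_content_def input_tape_def bit_symbol_def)
      then have 2: "run x w ?scan (?H 0) y (?g e * (1 + (1 + 1) + 2) + 1) (?H (?g e)) y"
        by (intro run_Loop[where H = ?H and Y = "\<lambda>_. y"]) (use 1 ib in simp_all)
      have H0: "?H 0 = h"
        using hi by (auto simp: fun_eq_iff)
      let ?h3 = "?H (?g e)"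
      have 3: "run x w (while_pos (b + 1) (dec (b + 1) ;; dec i)) ?h3 y (4 * ?h3 (b + 1) + 1)
        (?h3(b + 1 := 0, i := ?h3 i - ?h3 (b + 1))) y"
        by (rule run_move_down) (use b ib in auto)
      have eq: "?h3(b + 1 := 0, i := ?h3 i - ?h3 (b + 1)) = h(b := ?g e)"
        using hi ib by (auto simp: fun_eq_iff)
      from run_Seq[OF 2[unfolded H0] 3[unfolded eq]] show ?thesis
        by (rule run_mono) (use g[of e] ib in simp)
    qed
    then show ?thesis unfolding comp_in_def by blast
  qed
  moreover have "?g e \<le> poly ?R (ctx_size (C e))" for e
    using g[of e] by simp
  ultimately show ?thesis
    unfolding PT_def by (intro exI[of _ ?R]) blast
qed

text \<open>Counter \<open>b\<close> holds the remaining rounds, \<open>b + 1\<close> the index,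
  \<open>b + 2\<close> the accumulator and \<open>b + 3\<close> its next value. The a priori bound
  \<open>B\<close> keeps all intermediate values polynomial; iterating a polynomial-time step could
  otherwise make them exponential.\<close>

lemma PT_rec:
  assumes "PT C n" "PT C z" "PT (extend (extend C)) (\<lambda>e. s (fst (fst e)) (snd (fst e)) (snd e))"
    and "poly_bounded C B" "\<And>e j. j \<le> n e \<Longrightarrow> rec_nat (z e) (s e) j \<le> B e"
  shows "PT C (\<lambda>e. rec_nat (z e) (s e) (n e))"
proof -
  define rc where "rc e j = rec_nat (z e) (s e) j" for e j
  have rc: "rc e 0 = z e" "rc e (Suc j) = s e j (rc e j)" for e j
    by (simp_all add: rc_def)
  obtain P where P: "\<And>e. n e \<le> poly P (ctx_size (C e))"
    "\<And>ls b. 3 \<le> b \<Longrightarrow> \<forall>l\<in>set ls. 3 \<le> l \<and> l < b \<Longrightarrow> \<exists>c. comp_in C n P ls b c"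
    using assms(1) unfolding PT_def by blast
  obtain Q where Q: "\<And>ls b. 3 \<le> b \<Longrightarrow> \<forall>l\<in>set ls. 3 \<le> l \<and> l < b \<Longrightarrow> \<exists>c. comp_in C z Q ls b c"
    using assms(2) unfolding PT_def by blast
  let ?step = "\<lambda>e. s (fst (fst e)) (snd (fst e)) (snd e)"
  obtain R where R: "\<And>ls b. 3 \<le> b \<Longrightarrow> \<forall>l\<in>set ls. 3 \<le> l \<and> l < b \<Longrightarrow>
      \<exists>c. comp_in (extend (extend C)) ?step R ls b c"
    using assms(3) unfolding PT_def by blast
  obtain A where A: "\<And>e. B e \<le> poly A (ctx_size (C e))"
    using assms(4) unfolding poly_bounded_def by blast
  have rcA: "rc e j \<le> poly A (ctx_size (C e))" if "j \<le> n e" for e j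
    using assms(5)[OF that] A order_trans unfolding rc_def by blast
  \<comment> \<open>The step runs in contexts enlarged by the index and the accumulator, so its
    polynomial is composed with a bound on the enlarged size.\<close>
  define S where "S = pcompose R ([:0, 1:] + P + A)"
  have S: "poly R (ctx_size (extend (extend C) ((e, j), rc e j))) \<le> poly S (ctx_size (C e))"
    if "j \<le> n e" for e j
    unfolding S_def poly_pcompose by (rule poly_nat_mono) (use P(1)[of e] rcA[OF that] that in simp)
  let ?W = "P * (S + smult 7 A + [:6:]) + smult 4 P + Q + smult 5 A + [:3:]"
  have "\<exists>c. comp_in C (\<lambda>e. rc e (n e)) ?W ls b c"
    if b: "3 \<le> b" "\<forall>l\<in>set ls. 3 \<le> l \<and> l < b" for ls b
  proof -
    obtain cn where cn: "comp_in C n P ls b cn" using P(2) b by blast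
    have "\<forall>l\<in>set ls. 3 \<le> l \<and> l < b + 2" using b by auto
    moreover have "3 \<le> b + 2" using b by simp
    ultimately obtain cz where cz: "comp_in C z Q ls (b + 2) cz" using Q by blast
    have "\<forall>l\<in>set ((b + 2) # (b + 1) # ls). 3 \<le> l \<and> l < b + 3" using b by auto
    moreover have "3 \<le> b + 3" by simp
    \<comment> \<open>Innermost variable first: the accumulator stands before the index.\<close>
    ultimately obtain cs where cs: "comp_in (extend (extend C)) ?step R ((b + 2) # (b + 1) # ls) (b + 3) cs"
      using R by blast
    let ?clear = "while_pos (b + 2) (dec (b + 2))"
    let ?mv = "while_pos (b + 3) (dec (b + 3) ;; inc (b + 2))"
    let ?body = "cs ;; ?clear ;; ?mv ;; inc (b + 1) ;; dec b"
    let ?fin = "while_pos (b + 1) (dec (b + 1)) ;; while_pos (b + 2) (dec (b + 2) ;; inc b)"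
    let ?c = "cn ;; cz ;; while_pos b ?body ;; ?fin"
    have "run x w ?c h y (poly ?W (ctx_size (C e))) (h(b := rc e (n e))) y"
      if h: "C e = (x, w, map h ls)" "frame b h" for e x w h y
    proof -
      let ?k = "ctx_size (C e)"
      define H where "H j = h(b := n e - j, b + 1 := j, b + 2 := rc e j)" for j
      have h0: "h b = 0" "h (b + 1) = 0" "h (b + 2) = 0" "h (b + 3) = 0"
        using h(2) by (auto simp: frame_def)
      have 1: "run x w cn h y (poly P ?k) (h(b := n e)) y"
        using cn h unfolding comp_in_def by blast
      have "C e = (x, w, map (h(b := n e)) ls)"
        using h(1) map_upd_fresh[OF b(2) le_refl, of h "n e"] by (simp del: map_eq_conv)
      moreover have "frame (b + 2) (h(b := n e))"
        using h(2) b by (auto simp: frame_def)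
      ultimately have "run x w cz (h(b := n e)) y (poly Q ?k) ((h(b := n e))(b + 2 := z e)) y"
        using cz unfolding comp_in_def by blast
      moreover have "(h(b := n e))(b + 2 := z e) = H 0"
        using h0 by (auto simp: H_def rc fun_eq_iff)
      ultimately have 2: "run x w cz (h(b := n e)) y (poly Q ?k) (H 0) y"
        by simp
      let ?T = "poly S ?k + (3 * poly A ?k + 1 + (4 * poly A ?k + 1 + (1 + 1)))"
      have body: "run x w ?body (H j) y ?T (H (Suc j)) y" if j: "j < n e" for j
      proof -
        let ?v = "rc e (Suc j)"
        let ?h1 = "(H j)(b + 3 := ?v)"
        let ?h2 = "?h1(b + 2 := 0)"
        let ?h3 = "?h2(b + 3 := 0, b + 2 := ?h2 (b + 2) + ?h2 (b + 3))"
        let ?h4 = "?h3(b + 1 := ?h3 (b + 1) + 1)"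
        let ?h5 = "?h4(b := ?h4 b - 1)"
        have "map (H j) ls = map h ls"
          using b(2) by (auto simp: H_def)
        then have "extend (extend C) ((e, j), rc e j) = (x, w, map (H j) ((b + 2) # (b + 1) # ls))"
          using h(1) by (simp add: extend_def H_def del: map_eq_conv)
        moreover have "frame (b + 3) (H j)"
          using h(2) b by (auto simp: frame_def H_def)
        ultimately have "run x w cs (H j) y (poly R (ctx_size (extend (extend C) ((e, j), rc e j)))) ?h1 y"
          using cs unfolding comp_in_def by (simp add: rc)
        then have s1: "run x w cs (H j) y (poly S ?k) ?h1 y"
          by (rule run_mono) (use S j in simp)
        have s2: "run x w ?clear ?h1 y (3 * poly A ?k + 1) ?h2 y"
          by (rule run_mono[OF run_clear]) (use b rcA[of j e] j in \<open>auto simp: H_def\<close>)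
        have s3: "run x w ?mv ?h2 y (4 * poly A ?k + 1) ?h3 y"
          by (rule run_mono[OF run_move]) (use b rcA[of "Suc j" e] j in auto)
        have s4: "run x w (inc (b + 1)) ?h3 y 1 ?h4 y"
          by (rule run_inc) simp
        have s5: "run x w (dec b) ?h4 y 1 ?h5 y"
          by (rule run_dec) (use b j in \<open>auto simp: H_def\<close>)
        have "?h5 = H (Suc j)"
          using h0 by (auto simp: H_def fun_eq_iff)
        with run_Seq[OF s1 run_Seq[OF s2 run_Seq[OF s3 run_Seq[OF s4 s5]]]] show ?thesis
          by simp
      qed
      have 3: "run x w (while_pos b ?body) (H 0) y (n e * (?T + 2) + 1) (H (n e)) y"
        by (rule run_while_pos[where H = H and Y = "\<lambda>_. y"]) (use b body in \<open>auto simp: H_def\<close>)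
      let ?g1 = "(H (n e))(b + 1 := 0)"
      let ?g2 = "?g1(b + 2 := 0, b := ?g1 b + ?g1 (b + 2))"
      have 4: "run x w (while_pos (b + 1) (dec (b + 1))) (H (n e)) y (3 * poly P ?k + 1) ?g1 y"
        by (rule run_mono[OF run_clear]) (use b P(1)[of e] in \<open>auto simp: H_def\<close>)
      have 5: "run x w (while_pos (b + 2) (dec (b + 2) ;; inc b)) ?g1 y (4 * poly A ?k + 1) ?g2 y"
        by (rule run_mono[OF run_move]) (use b rcA[of "n e" e] in \<open>auto simp: H_def\<close>)
      have eq: "?g2 = h(b := rc e (n e))"
        using h0 by (auto simp: H_def fun_eq_iff)
      have "n e * (?T + 2) \<le> poly P ?k * (?T + 2)"
        by (rule mult_right_mono) (use P(1) in auto)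
      with run_Seq[OF 1 run_Seq[OF 2 run_Seq[OF 3 run_Seq[OF 4 5[unfolded eq]]]]] show ?thesis
        by (elim run_mono) (simp add: algebra_simps)
    qed
    then show ?thesis unfolding comp_in_def by blast
  qed
  moreover have "rc e (n e) \<le> poly ?W (ctx_size (C e))" for e
    using rcA[of "n e" e] by simp
  ultimately show ?thesis
    unfolding PT_def rc_def[symmetric] by (intro exI[of _ ?W]) blast
qed


section \<open>Writing the output\<close>

text \<open>Machine tapes start blank, whereas a counter needs its marker in cell 0. The prologue
  writes all markers.\<close>

lemma exec_mark_counters:
  assumes "distinct rs"
    and "exec c (\<lambda>r. if r \<in> set rs then act_tape (bit_symbol False, Stay) (s r) else s r) t s'"
  shows "exec (foldr (\<lambda>r c. Wr r False ;; c) rs c) s (length rs + t) s'"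
  using assms
proof (induction rs arbitrary: s)
  case (Cons a rs)
  let ?s = "s(a := act_tape (bit_symbol False, Stay) (s a))"
  have "(\<lambda>r. if r \<in> set rs then act_tape (bit_symbol False, Stay) (?s r) else ?s r) =
      (\<lambda>r. if r \<in> set (a # rs) then act_tape (bit_symbol False, Stay) (s r) else s r)"
    using Cons.prems(1) by (auto simp: fun_eq_iff)
  then have "exec (foldr (\<lambda>r c. Wr r False ;; c) rs c) ?s (length rs + t) s'"
    using Cons.prems by (intro Cons.IH) simp_all
  from exec_Seq[OF exec_Wr this] show ?case by simp
qed simp

lemma max_tape_mark_counters:
  "max_tape (foldr (\<lambda>r c. Wr r False ;; c) rs c) \<le> m \<longleftrightarrow> max_tape c \<le> m \<and> (\<forall>r\<in>set rs. r \<le> m)"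
  by (induction rs) auto

lemma tm_of_program:
  assumes "5 \<le> max_tape c"
  defines "K \<equiv> max_tape c + 1"
  defines "P \<equiv> compile (foldr (\<lambda>r c. Wr r False ;; c) [3..<K] c) 0"
  shows "wf_tm (tm_of P K)"
    and "run x w c (\<lambda>_. 0) [] T h y \<Longrightarrow> computes_within (tm_of P K) [x, w] (K + T) y"
proof -
  let ?c = "foldr (\<lambda>r c. Wr r False ;; c) [3..<K] c"
  have K: "0 < K" "6 \<le> K" using assms by simp_all
  have "max_tape ?c \<le> max_tape c"
    unfolding max_tape_mark_counters K_def by auto
  then have P: "\<forall>(r, f)\<in>set P. r < K \<and> (\<forall>s<3. fst (f s) < 3 \<and> snd (snd (f s)) \<le> length P)"
    using compile_wf[of _ _ ?c 0] unfolding P_def K_def length_compile by fastforce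
  show "wf_tm (tm_of P K)"
    using wf_tm_of[OF K(1) P] .
  assume "run x w c (\<lambda>_. 0) [] T h y"
  then obtain t where t: "t \<le> T" "exec c (conf x w (\<lambda>_. 0) []) t (conf x w h y)"
    unfolding run_def by blast
  \<comment> \<open>Tapes from number \<open>K\<close> on do not exist in the machine; giving them
    the content demanded by \<open>conf\<close> makes the two stores equal as functions.\<close>
  define s0 where
    "s0 r = (if r = 1 then input_tape x else if r = 2 then input_tape w
       else if r < K then input_tape [] else (tape_content x w r, 0))" for r
  have "(\<lambda>r. if r \<in> set [3..<K] then act_tape (bit_symbol False, Stay) (s0 r) else s0 r) =
      conf x w (\<lambda>_. 0) []"
    using K by (auto simp: s0_def conf_def fun_eq_iff tape_content_def input_tape_def)
  then have "exec ?c s0 (length [3..<K] + t) (conf x w h y)"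
    using t by (intro exec_mark_counters) simp_all
  from exec_instr_step[OF this, of P "[]" "[]"]
  have steps: "(instr_step P ^^ (K - 3 + t)) (0, s0) = (length P, conf x w h y)"
    by (simp add: P_def)
  have init: "initial_config (tm_of P K) [x, w] = (0, tape_list K s0)"
  proof -
    have "[input_tape x, input_tape w] @ replicate (K - 2) (input_tape []) = tape_list K s0"
      (is "?l = ?r")
    proof (rule nth_equalityI)
      show "length ?l = length ?r" using K by simp
      fix i assume "i < length ?l"
      then have i: "i < K" using K by simp
      then consider "i = 0" | "i = 1" | "2 \<le> i" by linarith
      then show "?l ! i = ?r ! i"
        using i K by cases (auto simp: nth_tape_list s0_def nth_append)
    qed
    then show ?thesis
      by (simp add: initial_config_def tm_of_def numeral_2_eq_2)
  qed
  have "\<forall>(r, f)\<in>set P. r < K" using P by auto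
  from funpow_step_tm_of[OF K(1) this, of "K - 3 + t" 0 s0]
  have "(step (tm_of P K) ^^ (K - 3 + t)) (initial_config (tm_of P K) [x, w]) =
      (halt_state (tm_of P K), tape_list K (conf x w h y))"
    unfolding init steps by (simp add: tm_of_def)
  moreover have "output_on (last (tape_list K (conf x w h y))) y"
    by (auto simp: tape_list_def conf_def output_on_def input_tape_def)
  moreover have "K - 3 + t \<le> K + T" using t by simp
  ultimately show "computes_within (tm_of P K) [x, w] (K + T) y"
    unfolding computes_within_def by blast
qed

text \<open>A word-valued function is presented by two numeric ones, its length and its bit at a
  given index. Counter 3 holds the number of bits still to be written, counter 4 the index and
  counter 5 the bit.\<close>

lemma PT_output:
  assumes "PT C len" "PT (extend C) (\<lambda>e. bt (fst e) (snd e))" "\<And>e. snd (snd (C e)) = []"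
  shows "\<exists>M T. wf_tm M \<and> 2 \<le> num_tapes M \<and>
    (\<forall>e. computes_within M [fst (C e), fst (snd (C e))] (poly T (ctx_size (C e)))
       (map (\<lambda>i. bt e i \<noteq> 0) [0..<len e]))"
proof -
  obtain P where P: "\<And>e. len e \<le> poly P (ctx_size (C e))"
    "\<And>ls b. 3 \<le> b \<Longrightarrow> \<forall>l\<in>set ls. 3 \<le> l \<and> l < b \<Longrightarrow> \<exists>c. comp_in C len P ls b c"
    using assms(1) unfolding PT_def by blast
  obtain Q where Q: "\<And>e. bt (fst e) (snd e) \<le> poly Q (ctx_size (extend C e))"
    "\<And>ls b. 3 \<le> b \<Longrightarrow> \<forall>l\<in>set ls. 3 \<le> l \<and> l < b \<Longrightarrow>
      \<exists>c. comp_in (extend C) (\<lambda>e. bt (fst e) (snd e)) Q ls b c"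
    using assms(2) unfolding PT_def by blast
  obtain cl where cl: "comp_in C len P [] 3 cl" using P(2)[of 3 "[]"] by auto
  obtain cb where cb: "comp_in (extend C) (\<lambda>e. bt (fst e) (snd e)) Q [4] 5 cb"
    using Q(2)[of 5 "[4]"] by auto
  \<comment> \<open>A blank under the head of counter 5 means a nonzero value, hence the output
    \<open>True\<close>.\<close>
  let ?body = "cb ;; Cond 5 (\<lambda>s. s = 0) (Wr 0 True ;; inc 0) (Wr 0 False ;; inc 0) ;;
    while_pos 5 (dec 5) ;; inc 4 ;; dec 3"
  let ?c = "cl ;; while_pos 3 ?body"
  define S where "S = pcompose Q ([:0, 1:] + P)"
  let ?T = "P + P * (smult 4 S + [:9:]) + [:1:]"
  have run: "run x w ?c (\<lambda>_. 0) [] (poly ?T (ctx_size (C e)))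
      ((\<lambda>_. 0)(3 := 0, 4 := len e)) (map (\<lambda>i. bt e i \<noteq> 0) [0..<len e])"
    if e: "C e = (x, w, [])" for e x w
  proof -
    let ?k = "ctx_size (C e)"
    define H :: "nat \<Rightarrow> nat \<Rightarrow> nat" where "H j = (\<lambda>_. 0)(3 := len e - j, 4 := j)" for j
    define Y where "Y j = map (\<lambda>i. bt e i \<noteq> 0) [0..<j]" for j
    have "run x w cl (\<lambda>_. 0) [] (poly P ?k) ((\<lambda>_. 0)(3 := len e)) []"
      using cl e unfolding comp_in_def frame_def by simp
    moreover have "(\<lambda>_. 0)(3 := len e) = H 0" by (auto simp: H_def)
    ultimately have 1: "run x w cl (\<lambda>_. 0) [] (poly P ?k) (H 0) []" by simp
    let ?t = "poly S ?k + ((2 + 2) + (3 * poly S ?k + 1 + (1 + 1)))"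
    have body: "run x w ?body (H j) (Y j) ?t (H (Suc j)) (Y (Suc j))" if j: "j < len e" for j
    proof -
      have "poly Q (ctx_size (extend C (e, j))) \<le> poly S ?k"
        unfolding S_def poly_pcompose by (rule poly_nat_mono) (use P(1)[of e] j in simp)
      moreover from this have bS: "bt e j \<le> poly S ?k"
        using Q(1)[of "(e, j)"] by simp
      moreover have "extend C (e, j) = (x, w, map (H j) [4])"
        using e by (simp add: extend_def H_def)
      moreover have "frame 5 (H j)" by (auto simp: frame_def H_def)
      ultimately have 1: "run x w cb (H j) (Y j) (poly S ?k) ((H j)(5 := bt e j)) (Y j)"
        using cb run_mono unfolding comp_in_def by fastforce
      let ?h1 = "(H j)(5 := bt e j)"
      have 2: "run x w (Cond 5 (\<lambda>s. s = 0) (Wr 0 True ;; inc 0) (Wr 0 False ;; inc 0)) ?h1 (Y j)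
          (2 + 2) ?h1 (Y (Suc j))"
      proof (rule run_Cond)
        assume "tape_content x w 5 (int (?h1 5)) = 0"
        then have "Y (Suc j) = Y j @ [True]"
          by (auto simp: Y_def tape_content_def bit_symbol_def split: if_splits)
        then show "run x w (Wr 0 True ;; inc 0) ?h1 (Y j) 2 ?h1 (Y (Suc j))"
          using run_output[of x w True ?h1 "Y j"] by simp
      next
        assume "tape_content x w 5 (int (?h1 5)) \<noteq> 0"
        then have "Y (Suc j) = Y j @ [False]"
          by (auto simp: Y_def tape_content_def bit_symbol_def split: if_splits)
        then show "run x w (Wr 0 False ;; inc 0) ?h1 (Y j) 2 ?h1 (Y (Suc j))"
          using run_output[of x w False ?h1 "Y j"] by simp
      qed simp
      let ?h2 = "?h1(5 := 0)"
      let ?h3 = "?h2(4 := ?h2 4 + 1)"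
      let ?h4 = "?h3(3 := ?h3 3 - 1)"
      have 3: "run x w (while_pos 5 (dec 5)) ?h1 (Y (Suc j)) (3 * poly S ?k + 1) ?h2 (Y (Suc j))"
        by (rule run_mono[OF run_clear]) (use bS in auto)
      have 4: "run x w (inc 4) ?h2 (Y (Suc j)) 1 ?h3 (Y (Suc j))"
        by (rule run_inc) simp
      have 5: "run x w (dec 3) ?h3 (Y (Suc j)) 1 ?h4 (Y (Suc j))"
        by (rule run_dec) (use j in \<open>auto simp: H_def\<close>)
      have "?h4 = H (Suc j)"
        by (auto simp: H_def fun_eq_iff)
      with run_Seq[OF 1 run_Seq[OF 2 run_Seq[OF 3 run_Seq[OF 4 5]]]] show ?thesis
        by simp
    qed
    have "run x w (while_pos 3 ?body) (H 0) (Y 0) (len e * (?t + 2) + 1) (H (len e)) (Y (len e))"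
      by (rule run_while_pos[where H = H and Y = Y, OF _ body]) (simp_all add: H_def)
    then have 2: "run x w (while_pos 3 ?body) (H 0) [] (len e * (?t + 2) + 1) (H (len e)) (Y (len e))"
      by (simp add: Y_def)
    have "len e * (?t + 2) \<le> poly P ?k * (?t + 2)"
      by (rule mult_right_mono) (use P(1) in auto)
    with run_Seq[OF 1 2, unfolded H_def Y_def diff_self_eq_0] show ?thesis
      by (elim run_mono) (simp add: algebra_simps)
  qed
  have m: "5 \<le> max_tape ?c" by simp
  define K where "K = max_tape ?c + 1"
  define M where "M = tm_of (compile (foldr (\<lambda>r c. Wr r False ;; c) [3..<K] ?c) 0) K"
  have "wf_tm M"
    using tm_of_program(1)[OF m] unfolding M_def K_def .
  moreover have "2 \<le> num_tapes M"
    by (simp add: M_def K_def tm_of_def)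
  moreover have "computes_within M [fst (C e), fst (snd (C e))] (poly (?T + [:K:]) (ctx_size (C e)))
       (map (\<lambda>i. bt e i \<noteq> 0) [0..<len e])" for e
  proof -
    have "C e = (fst (C e), fst (snd (C e)), [])"
      using assms(3)[of e] by (metis prod.collapse)
    from tm_of_program(2)[OF m run[OF this]] show ?thesis
      unfolding M_def K_def poly_add by (simp add: add.commute add.left_commute)
  qed
  ultimately show ?thesis by blast
qed

lemma poly_time_computable_2:
  fixes len :: "bool list \<times> bool list \<Rightarrow> nat"
  defines "C \<equiv> \<lambda>e. (fst e, snd e, [])"
  assumes "PT C len" "PT (extend C) (\<lambda>e. bt (fst e) (snd e))"
  shows "poly_time_computable 2
    (\<lambda>xs. map (\<lambda>i. bt (xs ! 0, xs ! 1) i \<noteq> 0) [0..<len (xs ! 0, xs ! 1)])"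
proof -
  have "snd (snd (C e)) = []" for e by (simp add: C_def)
  from PT_output[OF assms(2,3) this] obtain M T where M: "wf_tm M" "2 \<le> num_tapes M"
    and c: "\<And>e. computes_within M [fst (C e), fst (snd (C e))] (poly T (ctx_size (C e)))
       (map (\<lambda>i. bt e i \<noteq> 0) [0..<len e])"
    by blast
  have "computes_within M xs (poly T (sum_list (map length xs)))
      (map (\<lambda>i. bt (xs ! 0, xs ! 1) i \<noteq> 0) [0..<len (xs ! 0, xs ! 1)])" if "length xs = 2" for xs
  proof -
    from that obtain x w where "xs = [x, w]"
      by (auto simp: numeral_2_eq_2 length_Suc_conv)
    with c[of "(x, w)"] show ?thesis by (simp add: C_def ctx_size_def)
  qed
  with M show ?thesis unfolding poly_time_computable_def by blast
qed

lemma poly_time_computable_1: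
  fixes len :: "bool list \<Rightarrow> nat"
  defines "C \<equiv> \<lambda>e. (e, [], [])"
  assumes "PT C len" "PT (extend C) (\<lambda>e. bt (fst e) (snd e))"
  shows "poly_time_computable 1 (\<lambda>xs. map (\<lambda>i. bt (xs ! 0) i \<noteq> 0) [0..<len (xs ! 0)])"
proof -
  have "snd (snd (C e)) = []" for e by (simp add: C_def)
  from PT_output[OF assms(2,3) this] obtain M T where M: "wf_tm M" "2 \<le> num_tapes M"
    and c: "\<And>e. computes_within M [fst (C e), fst (snd (C e))] (poly T (ctx_size (C e)))
       (map (\<lambda>i. bt e i \<noteq> 0) [0..<len e])"
    by blast
  have "computes_within M xs (poly T (sum_list (map length xs)))
      (map (\<lambda>i. bt (xs ! 0) i \<noteq> 0) [0..<len (xs ! 0)])" if "length xs = 1" for xs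
  proof -
    from that obtain x where x: "xs = [x]"
      by (auto simp: length_Suc_conv)
    obtain k where "num_tapes M = 2 + k"
      using M(2) le_Suc_ex by blast
    then have "initial_config M [x] = initial_config M [x, []]"
      by (simp add: initial_config_def)
    then have "computes_within M [x] = computes_within M [x, []]"
      by (simp add: computes_within_def fun_eq_iff)
    with c[of x] x show ?thesis by (simp add: C_def ctx_size_def)
  qed
  moreover have "1 \<le> num_tapes M" using M(2) by simp
  ultimately show ?thesis using M(1) unfolding poly_time_computable_def by blast
qed

section \<open>Arithmetic with unary counters\<close>

abbreviation PTb :: "'e ctx \<Rightarrow> ('e \<Rightarrow> bool) \<Rightarrow> bool" where
  "PTb C P \<equiv> PT C (\<lambda>e. of_bool (P e))"

lemma poly_bounded_add:
  assumes "poly_bounded C f" "poly_bounded C g"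
  shows "poly_bounded C (\<lambda>e. f e + g e)"
proof -
  from assms obtain P Q where "\<And>e. f e \<le> poly P (ctx_size (C e))" "\<And>e. g e \<le> poly Q (ctx_size (C e))"
    unfolding poly_bounded_def by blast
  then show ?thesis
    unfolding poly_bounded_def by (intro exI[of _ "P + Q"]) (auto intro: add_mono)
qed

lemma poly_bounded_mult:
  assumes "poly_bounded C f" "poly_bounded C g"
  shows "poly_bounded C (\<lambda>e. f e * g e)"
proof -
  from assms obtain P Q where "\<And>e. f e \<le> poly P (ctx_size (C e))" "\<And>e. g e \<le> poly Q (ctx_size (C e))"
    unfolding poly_bounded_def by blast
  then show ?thesis
    unfolding poly_bounded_def by (intro exI[of _ "P * Q"]) (auto intro: mult_mono)
qed

lemma poly_bounded_const: "poly_bounded C (\<lambda>_. k)"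
  using PT_const PT_poly_bounded by blast

lemma PT_cong: "PT C f \<Longrightarrow> (\<And>e. f e = g e) \<Longrightarrow> PT C g"
  by (metis ext)

lemma PT_weaken2: "PT C f \<Longrightarrow> PT (extend (extend C)) (\<lambda>e. f (fst (fst e)))"
  by (rule PT_weaken[OF PT_weaken])

lemma PT_add: "PT C f \<Longrightarrow> PT C g \<Longrightarrow> PT C (\<lambda>e. f e + g e)"
proof -
  assume f: "PT C f" and g: "PT C g"
  have eq: "rec_nat a (\<lambda>_ r. Suc r) n = a + n" for a n by (induction n) auto
  have "PT C (\<lambda>e. rec_nat (f e) ((\<lambda>_ _ r. Suc r) e) (g e))"
    by (rule PT_rec[where B = "\<lambda>e. f e + g e"])
      (use f g in \<open>auto simp: eq intro: PT_Suc PT_snd poly_bounded_add PT_poly_bounded\<close>)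
  then show ?thesis by (simp add: eq)
qed

lemma PT_mult: "PT C f \<Longrightarrow> PT C g \<Longrightarrow> PT C (\<lambda>e. f e * g e)"
proof -
  assume f: "PT C f" and g: "PT C g"
  have eq: "rec_nat 0 (\<lambda>_ r. r + a) n = a * n" for a n :: nat by (induction n) auto
  have "PT C (\<lambda>e. rec_nat 0 ((\<lambda>e _ r. r + f e) e) (g e))"
    by (rule PT_rec[where B = "\<lambda>e. f e * g e"])
      (use f g in \<open>auto simp: eq intro: PT_add PT_snd PT_weaken2 PT_const poly_bounded_mult PT_poly_bounded\<close>)
  then show ?thesis by (simp add: eq)
qed

lemma PT_pred: "PT C f \<Longrightarrow> PT C (\<lambda>e. f e - 1)"
proof -
  assume f: "PT C f"
  have eq: "rec_nat 0 (\<lambda>i _. i) n = n - 1" for n :: nat by (cases n) auto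
  have "PT C (\<lambda>e. rec_nat 0 ((\<lambda>_ i _. i) e) (f e))"
    by (rule PT_rec[where B = f])
      (use f in \<open>auto simp: eq intro: PT_weaken PT_snd PT_const PT_poly_bounded\<close>)
  then show ?thesis by (simp add: eq)
qed

lemma PT_diff: "PT C f \<Longrightarrow> PT C g \<Longrightarrow> PT C (\<lambda>e. f e - g e)"
proof -
  assume f: "PT C f" and g: "PT C g"
  have eq: "rec_nat a (\<lambda>_ r. r - Suc 0) n = a - n" for a n :: nat by (induction n) auto
  have "PT C (\<lambda>e. rec_nat (f e) ((\<lambda>_ _ r. r - 1) e) (g e))"
    by (rule PT_rec[where B = f])
      (use f g PT_pred[OF PT_snd] in \<open>auto simp: eq intro: PT_poly_bounded\<close>)
  then show ?thesis by (simp add: eq)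
qed

lemma PT_not: "PTb C P \<Longrightarrow> PTb C (\<lambda>e. \<not> P e)"
  by (rule PT_cong[OF PT_diff[OF PT_const[of C 1]]]) auto

lemma PT_conj: "PTb C P \<Longrightarrow> PTb C Q \<Longrightarrow> PTb C (\<lambda>e. P e \<and> Q e)"
  by (rule PT_cong[OF PT_mult[of C "\<lambda>e. of_bool (P e)" "\<lambda>e. of_bool (Q e)"]]) auto

lemma PT_disj: "PTb C P \<Longrightarrow> PTb C Q \<Longrightarrow> PTb C (\<lambda>e. P e \<or> Q e)"
  using PT_not[OF PT_conj[OF PT_not[of C P] PT_not[of C Q]]] by simp

lemma PT_imp: "PTb C P \<Longrightarrow> PTb C Q \<Longrightarrow> PTb C (\<lambda>e. P e \<longrightarrow> Q e)"
  using PT_not[OF PT_conj[OF _ PT_not[of C Q], of P]] by simp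

text \<open>With truncated subtraction, \<open>1 - (1 - d)\<close> is 1 if \<open>d\<close> is
  positive and 0 otherwise.\<close>

lemma PT_less: "PT C f \<Longrightarrow> PT C g \<Longrightarrow> PTb C (\<lambda>e. f e < g e)"
  by (rule PT_cong[OF PT_diff[OF PT_const[of C 1] PT_diff[OF PT_const[of C 1] PT_diff[of C g f]]]]) auto

lemma PT_le: "PT C f \<Longrightarrow> PT C g \<Longrightarrow> PTb C (\<lambda>e. f e \<le> g e)"
  using PT_not[OF PT_less[of C g f]] by (simp add: not_less)

lemma PT_eq: "PT C f \<Longrightarrow> PT C g \<Longrightarrow> PTb C (\<lambda>e. f e = g e)"
  using PT_conj[OF PT_le[of C f g] PT_le[of C g f]] by (simp add: eq_iff)

lemma PT_if: "PTb C P \<Longrightarrow> PT C f \<Longrightarrow> PT C g \<Longrightarrow> PT C (\<lambda>e. if P e then f e else g e)"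
  by (rule PT_cong[OF PT_add[OF PT_mult[of C "\<lambda>e. of_bool (P e)" f]
        PT_mult[OF PT_not[of C P], of g]]]) auto

lemma PT_if_bool: "PTb C P \<Longrightarrow> PTb C Q \<Longrightarrow> PTb C R \<Longrightarrow> PTb C (\<lambda>e. if P e then Q e else R e)"
  by (rule PT_cong[OF PT_if[of C P "\<lambda>e. of_bool (Q e)" "\<lambda>e. of_bool (R e)"]]) auto

section \<open>Bounded quantifiers, counting and division\<close>

lemma PT_bex:
  assumes "PT C n" "PTb (extend C) (\<lambda>e. P (fst e) (snd e))"
  shows "PTb C (\<lambda>e. \<exists>i<n e. P e i)"
proof -
  have eq: "rec_nat 0 (\<lambda>i r. if P e i then 1 else r) n = of_bool (\<exists>i<n. P e i)" for e n
    by (induction n) (auto simp: less_Suc_eq)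
  have "PT C (\<lambda>e. rec_nat 0 ((\<lambda>e i r. if P e i then 1 else r) e) (n e))"
    by (rule PT_rec[where B = "\<lambda>_. 1"])
      (use assms in \<open>auto simp: eq intro!: PT_const poly_bounded_const PT_if PT_snd PT_weaken[where f = "\<lambda>e. of_bool (P (fst e) (snd e))" for P]\<close>)
  then show ?thesis by (simp add: eq)
qed

lemma PT_ball:
  assumes "PT C n" "PTb (extend C) (\<lambda>e. P (fst e) (snd e))"
  shows "PTb C (\<lambda>e. \<forall>i<n e. P e i)"
  using PT_not[OF PT_bex[OF assms(1) PT_not[OF assms(2)]]] by simp

lemma PT_count:
  assumes "PT C n" "PTb (extend C) (\<lambda>e. P (fst e) (snd e))"
  shows "PT C (\<lambda>e. card {i. i < n e \<and> P e i})"
proof -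
  have eq: "rec_nat 0 (\<lambda>i r. if P e i then Suc r else r) n = card {i. i < n \<and> P e i}" for e n
  proof (induction n)
    case (Suc n)
    have "{i. i < Suc n \<and> P e i} = (if P e n then insert n {i. i < n \<and> P e i} else {i. i < n \<and> P e i})"
      by (auto simp: less_Suc_eq)
    with Suc show ?case by simp
  qed simp
  have le: "card {i. i < n \<and> P e i} \<le> n" for e n
    using card_mono[of "{..<n}" "{i. i < n \<and> P e i}"] by auto
  have "PT C (\<lambda>e. rec_nat 0 ((\<lambda>e i r. if P e i then Suc r else r) e) (n e))"
    by (rule PT_rec[where B = n])
      (use assms order_trans[OF le] in \<open>auto simp: eq intro!: PT_const PT_poly_bounded PT_Suc PT_if PT_snd PT_weaken[where f = "\<lambda>e. of_bool (P (fst e) (snd e))" for P]\<close>)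
  then show ?thesis by (simp add: eq)
qed

lemma PT_mod: "PT C f \<Longrightarrow> PT C g \<Longrightarrow> PT C (\<lambda>e. f e mod g e)"
proof -
  assume f: "PT C f" and g: "PT C g"
  have eq: "rec_nat 0 (\<lambda>_ r. if Suc r = d then 0 else Suc r) n = n mod d" for d n :: nat
    by (induction n) (auto simp: mod_Suc)
  have "PT C (\<lambda>e. rec_nat 0 ((\<lambda>e _ r. if Suc r = g e then 0 else Suc r) e) (f e))"
    by (rule PT_rec[where B = f])
      (use f g in \<open>auto simp: eq intro!: PT_poly_bounded PT_const PT_if PT_eq PT_Suc PT_snd PT_weaken2[where f = g]
         intro: order_trans[OF mod_less_eq_dividend]\<close>)
  then show ?thesis by (simp add: eq)
qed

text \<open>The quotient counts the multiples of the divisor met on the way up. Divisor 0 agrees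
  with the convention as well, since \<open>Suc i mod 0\<close> never vanishes.\<close>

lemma PT_div: "PT C f \<Longrightarrow> PT C g \<Longrightarrow> PT C (\<lambda>e. f e div g e)"
proof -
  assume f: "PT C f" and g: "PT C g"
  have eq: "rec_nat 0 (\<lambda>i r. if Suc i mod d = 0 then Suc r else r) n = n div d" for d n :: nat
    by (induction n) (auto simp: div_Suc)
  have "PT C (\<lambda>e. rec_nat 0 ((\<lambda>e i r. if Suc i mod g e = 0 then Suc r else r) e) (f e))"
    by (rule PT_rec[where B = f])
      (use f g in \<open>auto simp: eq intro!: PT_poly_bounded PT_const PT_if PT_eq PT_mod PT_Suc PT_snd PT_weaken[OF PT_snd] PT_weaken2[where f = g]
         intro: order_trans[OF div_le_dividend]\<close>)
  then show ?thesis by (simp add: eq)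
qed

section \<open>Digits, powers and finite tables\<close>

definition digit :: "nat \<Rightarrow> nat \<Rightarrow> nat \<Rightarrow> nat" where
  "digit b c i = (c div b ^ i) mod b"

text \<open>The power may be exponentially large and is never computed: dividing \<open>i e\<close>
  times by \<open>b e\<close> keeps all values at most \<open>f e\<close>.\<close>

lemma PT_div_power: "PT C b \<Longrightarrow> PT C f \<Longrightarrow> PT C i \<Longrightarrow> PT C (\<lambda>e. f e div b e ^ i e)"
proof -
  assume b: "PT C b" and f: "PT C f" and i: "PT C i"
  have eq: "rec_nat c (\<lambda>_ r. r div d) n = c div d ^ n" for c d n :: nat
    by (induction n) (auto simp: div_mult2_eq mult.commute[of d])
  have "PT C (\<lambda>e. rec_nat (f e) ((\<lambda>e _ r. r div b e) e) (i e))"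
    by (rule PT_rec[where B = f])
      (use b f i in \<open>auto simp: eq intro!: PT_poly_bounded PT_div PT_snd PT_weaken2[where f = b]\<close>)
  then show ?thesis unfolding eq .
qed

lemma PT_digit: "PT C b \<Longrightarrow> PT C f \<Longrightarrow> PT C i \<Longrightarrow> PT C (\<lambda>e. digit (b e) (f e) (i e))"
  unfolding digit_def by (intro PT_mod PT_div_power)

text \<open>The exponent is a constant; with a varying one the value would leave the polynomial
  range.\<close>

lemma PT_power: "PT C f \<Longrightarrow> PT C (\<lambda>e. f e ^ k)"
  by (induction k) (auto intro: PT_const[of C 1, simplified] PT_mult)

lemma PT_poly: "PT C f \<Longrightarrow> PT C (\<lambda>e. poly p (f e))"
  by (induction p) (auto intro!: PT_const[of C 0, simplified] PT_mult PT_add PT_const)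

text \<open>The finitely many values of an arbitrary function \<open>g\<close> are hard-wired as a
  chain of case distinctions. Transition functions of machines enter programs in this way.\<close>

lemma PT_table: "PT C f \<Longrightarrow> PT C (\<lambda>e. if f e < N then g (f e) else 0)"
proof (induction N)
  case 0
  then show ?case using PT_const[of C 0] by simp
next
  case (Suc N)
  have "PT C (\<lambda>e. if f e = N then g N else if f e < N then g (f e) else 0)"
    using Suc by (intro PT_if[where f = "\<lambda>_. g N"] PT_eq PT_const) auto
  then show ?case by (rule PT_cong) auto
qed

lemma PT_table2: "PT C f \<Longrightarrow> PT C f' \<Longrightarrow> PT C (\<lambda>e. if f e < N \<and> f' e < N' then g (f e) (f' e) else 0)"
proof (induction N)
  case 0
  then show ?case using PT_const[of C 0] by simp
next
  case (Suc N)
  have "PT C (\<lambda>e. if f e = N then (if f' e < N' then g N (f' e) else 0)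
      else if f e < N \<and> f' e < N' then g (f e) (f' e) else 0)"
    using Suc by (intro PT_if[where f = "\<lambda>e. if f' e < N' then g N (f' e) else 0"] PT_eq PT_const PT_table) auto
  then show ?case by (rule PT_cong) auto
qed

section \<open>Access to the input words\<close>

definition bit_at :: "bool list \<Rightarrow> nat \<Rightarrow> bool" where
  "bit_at x i \<longleftrightarrow> i < length x \<and> x ! i"

text \<open>A predicate rather than a fixed projection, so that resolution still finds the word
  below binders, where it has the form \<open>X (fst e)\<close>.\<close>

definition input1 :: "'e ctx \<Rightarrow> ('e \<Rightarrow> bool list) \<Rightarrow> bool" where
  "input1 C X \<longleftrightarrow> (\<forall>e. X e = fst (C e))"

definition input2 :: "'e ctx \<Rightarrow> ('e \<Rightarrow> bool list) \<Rightarrow> bool" where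
  "input2 C X \<longleftrightarrow> (\<forall>e. X e = fst (snd (C e)))"

lemma input1_extend: "input1 C X \<Longrightarrow> input1 (extend C) (\<lambda>e. X (fst e))"
  by (auto simp: input1_def extend_def split: prod.splits)

lemma input2_extend: "input2 C X \<Longrightarrow> input2 (extend C) (\<lambda>e. X (fst e))"
  by (auto simp: input2_def extend_def split: prod.splits)

lemma PT_bit_at1: "input1 C X \<Longrightarrow> PT C f \<Longrightarrow> PTb C (\<lambda>e. bit_at (X e) (f e))"
  by (rule PT_cong[OF PT_eq[OF PT_symbol[of C f 1] PT_const[of C 2]]])
    (auto simp: input1_def tape_content_def input_tape_def bit_symbol_def bit_at_def)

lemma PT_bit_at2: "input2 C X \<Longrightarrow> PT C f \<Longrightarrow> PTb C (\<lambda>e. bit_at (X e) (f e))"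
  by (rule PT_cong[OF PT_eq[OF PT_symbol[of C f 2] PT_const[of C 2]]])
    (auto simp: input2_def tape_content_def input_tape_def bit_symbol_def bit_at_def)

lemma PT_length1: "input1 C X \<Longrightarrow> PT C (\<lambda>e. length (X e))"
  using PT_length[of 1 C] by (simp add: input1_def)

lemmas PT_rules =
  PT_not PT_conj PT_disj PT_imp PT_less PT_le PT_eq PT_if_bool PT_bex PT_ball PT_bit_at1 PT_bit_at2
  PT_if PT_add PT_mult PT_diff PT_div PT_mod PT_digit PT_Suc PT_const PT_snd PT_weaken
  PT_length1 PT_count input1_extend input2_extend

section \<open>Encodings of instances\<close>

lemma div_power_binary: "0 < k div 2 ^ i \<longleftrightarrow> i < length (binary k)"
proof (induction i arbitrary: k)
  case 0
  then show ?case by (cases "k = 0") (simp_all add: binary_0 binary_pos)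
next
  case (Suc i)
  have "k div 2 ^ Suc i = (k div 2) div 2 ^ i" by (simp add: div_mult2_eq)
  then show ?case
    using Suc[of "k div 2"] by (cases "k = 0") (simp_all add: binary_0 binary_pos)
qed

lemma nth_binary: "i < length (binary k) \<Longrightarrow> binary k ! i \<longleftrightarrow> odd (k div 2 ^ i)"
proof (induction i arbitrary: k)
  case 0
  then show ?case by (cases "k = 0") (simp_all add: binary_0 binary_pos)
next
  case (Suc i)
  have "k div 2 ^ Suc i = (k div 2) div 2 ^ i" by (simp add: div_mult2_eq)
  then show ?case
    using Suc by (cases "k = 0") (simp_all add: binary_0 binary_pos)
qed

text \<open>This form can be evaluated by counting and repeated halving. Restricting the count to
  \<open>i < k\<close> loses nothing because \<open>i < 2 ^ i\<close>.\<close>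

lemma length_binary: "length (binary k) = card {i. i < k \<and> 0 < k div 2 ^ i}"
proof -
  have "i < k" if "0 < k div 2 ^ i" for i
  proof -
    have "2 ^ i \<le> k" using that by (metis div_less not_less less_irrefl)
    with less_exp[of i] show ?thesis by linarith
  qed
  then have "{i. i < k \<and> 0 < k div 2 ^ i} = {..<length (binary k)}"
    using div_power_binary by auto
  then show ?thesis by simp
qed

text \<open>With a single running index, the entry at a position is found by division and
  remainder.\<close>

definition matrix_bits :: "nat \<Rightarrow> (nat \<Rightarrow> nat \<Rightarrow> bool) \<Rightarrow> bool list" where
  "matrix_bits n A = map (\<lambda>r. A (r div n) (r mod n)) [0..<n * n]"

lemma concat_rows: "concat (map (\<lambda>i. map (A i) [0..<n]) [0..<n]) = matrix_bits n A"
proof -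
  have "concat (map (\<lambda>i. map (A i) [0..<n]) [0..<l]) = map (\<lambda>r. A (r div n) (r mod n)) [0..<l * n]" for l
  proof (induction l)
    case (Suc l)
    have "map (A l) [0..<n] = map (\<lambda>r. A (r div n) (r mod n)) [l * n..<l * n + n]"
      by (intro nth_equalityI) auto
    then show ?case
      using Suc upt_add_eq_append[of 0 "l * n" n] by (simp add: add.commute)
  qed simp
  then show ?thesis by (simp add: matrix_bits_def)
qed

lemma encode_eq:
  "verts G = {..<n} \<Longrightarrow>
     encode G k = replicate n True @ False # matrix_bits n (\<lambda>i j. {i, j} \<in> edges G) @ binary k"
  unfolding encode_def Let_def by (simp add: concat_rows)

text \<open>Position \<open>n\<close> belongs to neither alternative: it carries the terminator
  \<open>False\<close>.\<close>

definition encode_bit :: "nat \<Rightarrow> (nat \<Rightarrow> nat \<Rightarrow> bool) \<Rightarrow> nat \<Rightarrow> nat \<Rightarrow> bool" where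
  "encode_bit n A k i \<longleftrightarrow>
     i < n \<or> (n < i \<and> (if i < n + 1 + n * n then A ((i - (n + 1)) div n) ((i - (n + 1)) mod n)
       else digit 2 k (i - (n + 1 + n * n)) = 1))"

lemma encode_eq_map:
  assumes "verts G = {..<n}"
  shows "encode G k = map (encode_bit n (\<lambda>i j. {i, j} \<in> edges G) k)
    [0..<n + 1 + n * n + card {i. i < k \<and> 0 < k div 2 ^ i}]"
    (is "_ = ?r")
proof (rule nth_equalityI)
  let ?A = "\<lambda>i j. {i, j} \<in> edges G"
  show len: "length (encode G k) = length ?r"
    by (simp add: encode_eq[OF assms] matrix_bits_def length_binary)
  fix i assume i: "i < length (encode G k)"
  consider "i < n" | "i = n" | "n < i" "i < n + 1 + n * n" | "n + 1 + n * n \<le> i" by linarith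
  then have "encode G k ! i \<longleftrightarrow> encode_bit n ?A k i"
  proof cases
    case 3
    have less: "i - (n + 1) < n * n" using 3 by linarith
    have "(matrix_bits n ?A @ binary k) ! (i - (n + 1)) = ?A ((i - (n + 1)) div n) ((i - (n + 1)) mod n)"
      using 3 less by (simp add: matrix_bits_def nth_append)
    then show ?thesis
      using 3 by (simp add: encode_eq[OF assms] encode_bit_def nth_append nth_Cons' Suc_diff_Suc)
  next
    case 4
    have "i - (n + 1 + n * n) < length (binary k)"
      using i 4 by (simp add: encode_eq[OF assms] matrix_bits_def)
    moreover have "\<not> i - (n + 1) < n * n" using 4 by linarith
    then have "encode G k ! i = binary k ! (i - (n + 1 + n * n))"
      using 4 by (simp add: encode_eq[OF assms] matrix_bits_def nth_append nth_Cons')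
    ultimately show ?thesis
      using 4 by (simp add: nth_binary encode_bit_def digit_def odd_iff_mod_2_eq_one)
  qed (simp_all add: encode_eq[OF assms] encode_bit_def nth_append)
  then show "encode G k ! i = ?r ! i"
    using i len by (simp del: upt_Suc)
qed

section \<open>Vertex cover in graphs of large girth\<close>

text \<open>
  There is one path per orientation of an edge. The two lengths differ by one, so that both paths
  together form an odd cycle.
\<close>

definition path_length :: "nat \<Rightarrow> nat \<Rightarrow> nat \<Rightarrow> nat" where
  "path_length q a b = 2 * q + (if a < b then 0 else 1)"

text \<open>Every ordered pair owns a slot of \<open>2 * q + 1\<close> numbers behind the
  \<open>m\<close> base vertices, even if it is not an edge or its path is shorter by one; surplus
  vertices are isolated. Position 0 and the last position are the ends of the path
  themselves.\<close>

definition path_vertex :: "nat \<Rightarrow> nat \<Rightarrow> nat \<Rightarrow> nat \<Rightarrow> nat \<Rightarrow> nat" where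
  "path_vertex m q a b j =
     (if j = 0 then a else if j = path_length q a b + 1 then b
      else m + (a * m + b) * (2 * q + 1) + (j - 1))"

definition gadget_size :: "nat \<Rightarrow> nat \<Rightarrow> nat" where
  "gadget_size m q = m + m * m * (2 * q + 1)"

definition gadget_arc :: "nat \<Rightarrow> nat \<Rightarrow> nat \<Rightarrow> (nat \<Rightarrow> nat \<Rightarrow> bool) \<Rightarrow> nat \<Rightarrow> nat \<Rightarrow> bool" where
  "gadget_arc m q h E u v \<longleftrightarrow>
     (u = h \<and> v < m \<and> v \<noteq> h) \<or>
     (\<exists>a<m. \<exists>b<m. E a b \<and>
        (\<exists>j<Suc (path_length q a b). u = path_vertex m q a b j \<and> v = path_vertex m q a b (Suc j)))"

definition gadget_graph :: "nat \<Rightarrow> nat \<Rightarrow> nat \<Rightarrow> (nat \<Rightarrow> nat \<Rightarrow> bool) \<Rightarrow> nat graph" where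
  "gadget_graph m q h E = ({..<gadget_size m q}, {{u, v} | u v. gadget_arc m q h E u v})"

locale gadget =
  fixes m q h :: nat and E :: "nat \<Rightarrow> nat \<Rightarrow> bool"
  assumes hub: "h < m" and q: "1 \<le> q"
    and E_sym: "E a b \<Longrightarrow> E b a" and E_irrefl: "\<not> E a a"
begin

abbreviation "W \<equiv> 2 * q + 1"
abbreviation "len \<equiv> path_length q"
abbreviation "pos \<equiv> path_vertex m q"
abbreviation "arc \<equiv> gadget_arc m q h E"
abbreviation "G \<equiv> gadget_graph m q h E"

text \<open>\<open>pa\<close>, \<open>pb\<close> and \<open>pj\<close> invert the numbering of inner
  vertices by start, end and position.\<close>

definition pa :: "nat \<Rightarrow> nat" where "pa u = (u - m) div W div m"
definition pb :: "nat \<Rightarrow> nat" where "pb u = (u - m) div W mod m"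
definition pj :: "nat \<Rightarrow> nat" where "pj u = (u - m) mod W + 1"

lemma len_bounds: "2 * q \<le> len a b" "len a b \<le> W" "1 \<le> len a b"
  using q by (auto simp: path_length_def)

lemma pos_0 [simp]: "pos a b 0 = a"
  by (simp add: path_vertex_def)

lemma pos_end: "j = Suc (len a b) \<Longrightarrow> pos a b j = b"
  by (simp add: path_vertex_def)

lemma pos_inner: "1 \<le> j \<Longrightarrow> j \<le> len a b \<Longrightarrow> pos a b j = m + ((a * m + b) * W + (j - 1))"
  by (simp add: path_vertex_def)

lemma decode:
  assumes "b < m" "1 \<le> j" "j \<le> len a b"
  shows "pa (pos a b j) = a" "pb (pos a b j) = b" "pj (pos a b j) = j" "m \<le> pos a b j"
proof -
  have j: "j - 1 < W" using assms len_bounds[of a b] by linarith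
  have d: "(pos a b j - m) div W = a * m + b"
    unfolding pos_inner[OF assms(2,3)] using j by (simp del: mult_Suc_right)
  have "(pos a b j - m) mod W = j - 1"
    unfolding pos_inner[OF assms(2,3)] using j by (simp del: mult_Suc_right)
  with assms show "pj (pos a b j) = j" by (simp add: pj_def)
  show "pa (pos a b j) = a" "pb (pos a b j) = b"
    using d assms(1) by (simp_all add: pa_def pb_def)
  show "m \<le> pos a b j" unfolding pos_inner[OF assms(2,3)] by simp
qed

lemma pos_less_size:
  assumes "a < m" "b < m" "j \<le> Suc (len a b)"
  shows "pos a b j < gadget_size m q"
proof -
  consider "j = 0" | "j = Suc (len a b)" | "1 \<le> j" "j \<le> len a b" using assms(3) by linarith
  then show ?thesis
  proof cases
    case 3
    have "j - 1 < W" using 3 len_bounds[of a b] by linarith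
    then have "(a * m + b) * W + (j - 1) < (a * m + b + 1) * W" by (simp add: algebra_simps)
    also have "\<dots> \<le> (m * m) * W"
    proof (rule mult_right_mono)
      have "(a + 1) * m \<le> m * m" using assms by (intro mult_right_mono) auto
      then show "a * m + b + 1 \<le> m * m" using assms by simp
    qed simp
    finally show ?thesis
      unfolding pos_inner[OF 3] gadget_size_def by simp
  qed (use assms pos_end in \<open>auto simp: gadget_size_def\<close>)
qed

lemma pos_neq_Suc:
  assumes "E a b" "a < m" "b < m" "j \<le> len a b"
  shows "pos a b j \<noteq> pos a b (Suc j)"
proof -
  consider "j = 0" | "j = len a b" "j \<noteq> 0" | "1 \<le> j" "Suc j \<le> len a b" using assms(4) by linarith
  then show ?thesis
  proof cases
    case 1
    then show ?thesis using decode(4)[of b 1 a] assms len_bounds[of a b] by simp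
  next
    case 2
    then show ?thesis using decode(4)[of b j a] assms len_bounds[of a b] pos_end[of "Suc j" a b] by simp
  next
    case 3
    then show ?thesis using decode(3)[of b j a] decode(3)[of b "Suc j" a] assms by auto
  qed
qed

lemma arc_cases:
  assumes "arc u v"
  obtains (hub) "u = h" "v < m" "v \<noteq> h"
  | (path) a b j where "a < m" "b < m" "E a b" "j \<le> len a b" "u = pos a b j" "v = pos a b (Suc j)"
  using assms unfolding gadget_arc_def by (auto simp: less_Suc_eq_le)

lemma arc_bounds: "arc u v \<Longrightarrow> u < gadget_size m q \<and> v < gadget_size m q \<and> u \<noteq> v"
  by (erule arc_cases)
    (use hub pos_less_size pos_neq_Suc in \<open>auto simp: gadget_size_def\<close>)

lemma verts_G: "verts G = {..<gadget_size m q}"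
  by (simp add: gadget_graph_def)

lemma edge_iff: "{u, v} \<in> edges G \<longleftrightarrow> arc u v \<or> arc v u"
  by (auto simp: gadget_graph_def doubleton_eq_iff)

lemma simple_G: "simple_graph G"
  unfolding simple_graph_def using arc_bounds by (fastforce simp: gadget_graph_def)

lemma standard_G: "standard_vertices G"
  by (simp add: standard_vertices_def verts_G)

text \<open>
  A short cycle misses an inner vertex of every path, so it lies in the forest that remains when
  these vertices are deleted. This forest is rooted at the hub: every vertex has at most one
  neighbour that is not further away from the hub, which rules out a farthest vertex on the cycle.
\<close>

lemma no_short_cycle:
  assumes "is_cycle G c"
  shows "2 * q \<le> length c"
proof (rule ccontr)
  assume short: "\<not> 2 * q \<le> length c"
  let ?ok = "\<lambda>a b j. 1 \<le> j \<and> j \<le> len a b \<and> pos a b j \<notin> set c"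
  have ex: "\<exists>j. ?ok a b j" if "b < m" for a b
  proof (rule ccontr)
    assume "\<nexists>j. ?ok a b j"
    then have "pos a b ` {1..len a b} \<subseteq> set c" by auto
    then have "card (pos a b ` {1..len a b}) \<le> length c"
      by (meson List.finite_set card_length card_mono order_trans)
    moreover have "inj_on (pos a b) {1..len a b}"
      by (rule inj_on_inverseI[where g = pj]) (use that decode(3) in auto)
    ultimately show False
      using short len_bounds[of a b] by (simp add: card_image)
  qed
  define mis where "mis a b = (SOME j. ?ok a b j)" for a b
  have mis: "1 \<le> mis a b" "mis a b \<le> len a b" "pos a b (mis a b) \<notin> set c" if "b < m" for a b
    using someI_ex[OF ex[OF that, of a]] unfolding mis_def by auto
  \<comment> \<open>Levels in the forest left by deleting every \<open>pos a b (mis a b)\<close>: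
    the part of a path before this gap hangs from \<open>a\<close>, the part behind it from
    \<open>b\<close>. The offset is the level 1 of the base vertices other than the hub.\<close>
  define rank where
    "rank u = (if u = h then 0 else if u < m then 1
       else if pj u < mis (pa u) (pb u) then 1 + pj u else len (pa u) (pb u) + 2 - pj u)" for u
  define par where
    "par u = (if u < m then h
       else if pj u < mis (pa u) (pb u) then pos (pa u) (pb u) (pj u - 1)
       else pos (pa u) (pb u) (pj u + 1))" for u
  have rank_base: "rank u \<le> 1" if "u < m" for u
    using that by (simp add: rank_def)
  have rank_pos: "rank (pos a b j) = (if j < mis a b then 1 + j else len a b + 2 - j)"
    and par_pos: "par (pos a b j) = (if j < mis a b then pos a b (j - 1) else pos a b (j + 1))"
    if "b < m" "1 \<le> j" "j \<le> len a b" for a b j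
    using decode[OF that] hub by (auto simp: rank_def par_def)
  have key: "v = par u"
    if uv: "u \<in> set c" "v \<in> set c" "rank v \<le> rank u" "arc u v \<or> arc v u" for u v
    using uv(4)
  proof
    assume "arc u v"
    then show ?thesis
    proof (cases rule: arc_cases)
      case hub
      then show ?thesis using uv(3) by (simp add: rank_def)
    next
      case (path a b j)
      show ?thesis
      proof (cases "j = 0")
        case True
        then have "rank v \<ge> 2" using path rank_pos[of b 1 a] len_bounds[of a b] by auto
        moreover have "rank u \<le> 1" using True path rank_base by simp
        ultimately show ?thesis using uv(3) by simp
      next
        case False
        have "j \<noteq> mis a b" "Suc j \<noteq> mis a b" using uv path mis[of b a] by auto
        then show ?thesis
          using uv(3) path False mis[of b a] rank_pos[of b j a] rank_pos[of b "Suc j" a] par_pos[of b j a]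
          by (auto split: if_splits)
      qed
    qed
  next
    assume "arc v u"
    then show ?thesis
    proof (cases rule: arc_cases)
      case hub
      then show ?thesis by (simp add: par_def)
    next
      case (path a b j)
      show ?thesis
      proof (cases "j = len a b")
        case True
        then have "rank v \<ge> 2"
          using path rank_pos[of b j a] len_bounds[of a b] by auto
        moreover have "rank u \<le> 1" using True path rank_base pos_end by simp
        ultimately show ?thesis using uv(3) by simp
      next
        case False
        have "j \<noteq> mis a b" "Suc j \<noteq> mis a b" using uv path mis[of b a] by auto
        then show ?thesis
          using uv(3) path False mis[of b a] rank_pos[of b j a] rank_pos[of b "Suc j" a] par_pos[of b "Suc j" a]
          by (cases "j = 0") (auto split: if_splits)
      qed
    qed
  qed
  let ?L = "length c"
  have c: "3 \<le> ?L" "distinct c" "\<And>i. i < ?L \<Longrightarrow> {c ! i, c ! (Suc i mod ?L)} \<in> edges G"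
    using assms by (auto simp: is_cycle_def)
  obtain u where u: "u \<in> set c" "\<And>v. v \<in> set c \<Longrightarrow> rank v \<le> rank u"
  proof -
    have "set c \<noteq> {}" using assms unfolding is_cycle_def by force
    then have "Max (rank ` set c) \<in> rank ` set c" by (intro Max_in) auto
    then obtain u where "u \<in> set c" "rank u = Max (rank ` set c)" by (metis imageE)
    then show ?thesis by (intro that[of u]) auto
  qed
  then obtain i where i: "i < ?L" "c ! i = u" by (metis in_set_conv_nth)
  \<comment> \<open>\<open>k\<close> is the cyclic predecessor of \<open>i\<close>. A cycle has at
    least three vertices, so predecessor and successor of the top vertex differ, although both would
    have to be its parent.\<close>
  define k where "k = (if i = 0 then ?L - 1 else i - 1)"
  have k: "k < ?L" "Suc k mod ?L = i" "k \<noteq> Suc i mod ?L"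
    using i(1) c(1) by (auto simp: k_def mod_Suc)
  have n: "Suc i mod ?L < ?L" by (rule mod_less_divisor) (use c(1) in linarith)
  have "c ! (Suc i mod ?L) = par u"
    using key[of u "c ! (Suc i mod ?L)"] u c(3)[OF i(1)] i(2) n by (simp add: edge_iff)
  moreover have "c ! k = par u"
    using key[of u "c ! k"] u c(3)[OF k(1)] k i(2) by (simp add: edge_iff disj_commute)
  ultimately show False
    using k n c(2) by (metis nth_eq_iff_index_eq)
qed

lemma girth_G: "p \<le> 2 * q \<Longrightarrow> enat p \<le> girth G"
  unfolding girth_def using no_short_cycle
  by (intro INF_greatest) (auto intro: order_trans)

lemma cover_imp_OCT:
  assumes C: "C \<subseteq> {..<m}" "h \<in> C" "\<And>a b. a < m \<Longrightarrow> b < m \<Longrightarrow> E a b \<Longrightarrow> a \<in> C \<or> b \<in> C"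
  shows "connected_odd_cycle_transversal G C"
proof -
  \<comment> \<open>Parity of the distance to \<open>a\<close> if \<open>a\<close> survives, and to
    \<open>b\<close> otherwise. Since \<open>C\<close> covers the edge, at most one end survives,
    and all base vertices can have the same colour.\<close>
  define col where
    "col u \<longleftrightarrow> \<not> u < m \<and> odd (if pa u \<notin> C then pj u else Suc (len (pa u) (pb u)) - pj u)" for u
  have col_pos: "col (pos a b j) \<longleftrightarrow> odd (if a \<notin> C then j else Suc (len a b) - j)"
    if "b < m" "1 \<le> j" "j \<le> len a b" for a b j
    using decode[OF that] by (simp add: col_def)
  have col_base: "\<not> col u" if "u < m" for u using that by (simp add: col_def)
  have neq: "col u \<noteq> col v" if "arc u v" "u \<notin> C" "v \<notin> C" for u v
    using that(1)
  proof (cases rule: arc_cases)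
    case hub
    then show ?thesis using that C(2) by simp
  next
    case (path a b j)
    show ?thesis
    proof (cases "a \<in> C")
      case True
      then have "j \<noteq> 0" using path that by (metis pos_0)
      then show ?thesis
        using path True col_pos[of b j a] col_pos[of b "Suc j" a] col_base[of b] pos_end[of "Suc j" a b]
        by (cases "j = len a b") auto
    next
      case False
      then have "b \<in> C" using C(3) path by blast
      then have "j \<noteq> len a b" using path that pos_end by metis
      then show ?thesis
        using path False col_pos[of b j a] col_pos[of b "Suc j" a] col_base[of a]
        by (cases "j = 0") auto
    qed
  qed
  have "bipartite (induced_subgraph G (verts G - C))"
    unfolding bipartite_def
  proof (intro exI conjI ballI)
    let ?V = "verts G - C"
    show "{u \<in> ?V. col u} \<union> {u \<in> ?V. \<not> col u} = verts (induced_subgraph G ?V)"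
      by (auto simp: induced_subgraph_def)
    show "{u \<in> ?V. col u} \<inter> {u \<in> ?V. \<not> col u} = {}" by auto
    fix e assume "e \<in> edges (induced_subgraph G ?V)"
    then have e: "e \<in> edges G" "e \<subseteq> ?V" by (auto simp: induced_subgraph_def)
    then obtain u v where uv: "e = {u, v}" "arc u v" by (auto simp: gadget_graph_def)
    with e neq[of u v] have "col u \<noteq> col v" by auto
    then show "\<exists>a\<in>{u \<in> ?V. col u}. \<exists>b\<in>{u \<in> ?V. \<not> col u}. e = {a, b}"
      using e uv by (cases "col u") (auto simp: insert_commute)
  qed
  moreover have "connected_graph (induced_subgraph G C)"
  proof -
    let ?R = "{(a, b). {a, b} \<in> edges (induced_subgraph G C)}"
    have "(u, h) \<in> ?R\<^sup>* \<and> (h, u) \<in> ?R\<^sup>*" if "u \<in> C" for u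
    proof (cases "u = h")
      case False
      then have "arc h u" using that C(1) by (auto simp: gadget_arc_def)
      then have "{h, u} \<in> edges (induced_subgraph G C)"
        using that C(2) by (auto simp: induced_subgraph_def edge_iff)
      then show ?thesis by (auto simp: insert_commute)
    qed simp
    then show ?thesis
      unfolding connected_graph_def by (auto simp: induced_subgraph_def intro: rtrancl_trans)
  qed
  moreover have "C \<subseteq> verts G"
    using C(1) by (auto simp: verts_G gadget_size_def)
  ultimately show ?thesis
    by (simp add: connected_odd_cycle_transversal_def odd_cycle_transversal_def)
qed

text \<open>Send a transversal vertex to itself if it is a base vertex and to the start of its path
  otherwise. If an edge remained uncovered, both of its paths would avoid \<open>S\<close>; sides
  alternate along them, and their lengths of different parity give contradictory relations between
  the sides of the ends.\<close>

lemma OCT_imp_cover: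
  assumes S: "odd_cycle_transversal G S"
  shows "\<exists>C\<subseteq>{..<m}. card C \<le> card S \<and> (\<forall>a<m. \<forall>b<m. E a b \<longrightarrow> a \<in> C \<or> b \<in> C)"
proof -
  let ?g = "\<lambda>u. if u < m then u else pa u"
  let ?V = "verts G - S"
  from S obtain A B where AB: "A \<union> B = ?V" "A \<inter> B = {}"
    "\<And>e. e \<in> edges G \<Longrightarrow> e \<subseteq> ?V \<Longrightarrow> \<exists>a\<in>A. \<exists>b\<in>B. e = {a, b}"
    unfolding odd_cycle_transversal_def bipartite_def by (auto simp: induced_subgraph_def)
  have SV: "S \<subseteq> {..<gadget_size m q}"
    using S by (simp add: odd_cycle_transversal_def verts_G)
  have alt: "u \<in> A \<longleftrightarrow> v \<notin> A" if "arc u v" "u \<notin> S" "v \<notin> S" for u v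
  proof -
    have "{u, v} \<in> edges G" "{u, v} \<subseteq> ?V"
      using that arc_bounds[OF that(1)] by (auto simp: edge_iff verts_G)
    with AB(3)[of "{u, v}"] AB(2) show ?thesis by (auto simp: doubleton_eq_iff)
  qed
  have col: "b \<in> A \<longleftrightarrow> (a \<in> A \<longleftrightarrow> odd (len a b))"
    if ab: "a < m" "b < m" "E a b" "a \<notin> ?g ` S" "b \<notin> ?g ` S" for a b
  proof -
    have nS: "pos a b j \<notin> S" if le: "j \<le> Suc (len a b)" for j
    proof
      assume in_S: "pos a b j \<in> S"
      consider "j = 0" | "j = Suc (len a b)" | "1 \<le> j" "j \<le> len a b" using le by linarith
      then show False
      proof cases
        case 3
        then have "?g (pos a b j) = a" using decode(1,4)[OF ab(2) 3] by simp
        then have "a \<in> ?g ` S" using in_S by (rule rev_image_eqI[rotated, OF sym])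
        with ab(4) show False by contradiction
      next
        case 1
        then show False using in_S ab(1,4) image_eqI[of a ?g a S] by simp
      next
        case 2
        then show False using in_S ab(2,5) pos_end[OF 2] image_eqI[of b ?g b S] by simp
      qed
    qed
    have "pos a b j \<in> A \<longleftrightarrow> (a \<in> A \<longleftrightarrow> even j)" if "j \<le> Suc (len a b)" for j
      using that
    proof (induction j)
      case (Suc j)
      then have "arc (pos a b j) (pos a b (Suc j))"
        unfolding gadget_arc_def using ab by (metis less_Suc_eq_le Suc_le_mono)
      from alt[OF this] nS Suc show ?case by auto
    qed simp
    from this[of "Suc (len a b)"] show ?thesis by (simp add: pos_end)
  qed
  have "?g ` S \<subseteq> {..<m}"
  proof -
    have "pa u < m" if "u < gadget_size m q" for u
    proof -
      have "0 < m * m * W" using hub by simp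
      with that have "u - m < m * m * W" unfolding gadget_size_def by linarith
      then show ?thesis
        unfolding pa_def by (metis less_mult_imp_div_less mult.commute mult.left_commute)
    qed
    then show ?thesis using SV by auto
  qed
  moreover have "card (?g ` S) \<le> card S"
    using SV by (intro card_image_le) (auto intro: finite_subset)
  moreover have "a \<in> ?g ` S \<or> b \<in> ?g ` S" if "a < m" "b < m" "E a b" for a b
  proof (rule ccontr)
    assume n: "\<not> (a \<in> ?g ` S \<or> b \<in> ?g ` S)"
    have "a \<noteq> b" using E_irrefl that by auto
    with col[of a b] col[of b a] that n E_sym[OF that(3)] show False
      by (auto simp: path_length_def split: if_splits)
  qed
  ultimately show ?thesis by (intro exI[of _ "?g ` S"]) blast
qed

end

text \<open>
  With a complete graph on each block of \<open>D\<close> vertices, a vertex cover with \<open>D - 1\<close> vertices per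
  block is the complement of an independent transversal of the blocks.
\<close>

lemma small_cover_imp_transversal:
  assumes C: "C \<subseteq> {..<B * D}" "card C \<le> B * (D - 1)" and D: "0 < D"
    and block: "\<And>a b. a < B * D \<Longrightarrow> b < B * D \<Longrightarrow> a \<noteq> b \<Longrightarrow> a div D = b div D \<Longrightarrow> a \<in> C \<or> b \<in> C"
  shows "\<exists>f. \<forall>t<B. f t < D \<and> t * D + f t \<notin> C"
proof -
  \<comment> \<open>The complement has at least \<open>B\<close> vertices but at most one in each of
    the \<open>B\<close> blocks, so it meets every block.\<close>
  let ?I = "{..<B * D} - C"
  have "card ?I = B * D - card C"
    using C(1) by (simp add: card_Diff_subset finite_subset)
  then have "B \<le> card ?I"
    using C(2) D by (cases D) auto
  moreover have inj: "inj_on (\<lambda>v. v div D) ?I"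
    unfolding inj_on_def using block by blast
  ultimately have "B \<le> card ((\<lambda>v. v div D) ` ?I)"
    by (simp add: card_image)
  moreover have "(\<lambda>v. v div D) ` ?I \<subseteq> {..<B}"
    using less_mult_imp_div_less by blast
  ultimately have im: "(\<lambda>v. v div D) ` ?I = {..<B}"
    by (metis card_lessThan card_subset_eq card_mono finite_lessThan le_antisym)
  have "\<exists>f. f < D \<and> t * D + f \<notin> C" if "t < B" for t
  proof -
    have "t \<in> (\<lambda>v. v div D) ` ?I" using im that by simp
    then obtain v where "v \<in> ?I" "v div D = t" by blast
    then show ?thesis using D by (intro exI[of _ "v mod D"]) auto
  qed
  then show ?thesis by metis
qed

lemma card_transversal_complement:
  assumes "\<And>t. t < B \<Longrightarrow> f t < D"
  shows "card ({..<B * D} - (\<lambda>t. t * D + f t) ` {..<B}) = B * (D - 1)"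
proof -
  have "t * D + f t < B * D" if "t < B" for t
  proof -
    have "t * D + f t < (t + 1) * D" using assms[OF that] by simp
    also have "\<dots> \<le> B * D" using that by (intro mult_right_mono) auto
    finally show ?thesis .
  qed
  then have sub: "(\<lambda>t. t * D + f t) ` {..<B} \<subseteq> {..<B * D}" by auto
  have "(t * D + f t) div D = t" if "t < B" for t
    using assms[OF that] by (cases "D = 0") simp_all
  then have "inj_on (\<lambda>t. t * D + f t) {..<B}"
    by (intro inj_on_inverseI[where g = "\<lambda>v. v div D"]) auto
  then have "card ((\<lambda>t. t * D + f t) ` {..<B}) = B" by (simp add: card_image)
  then show ?thesis
    using sub by (simp add: card_Diff_subset right_diff_distrib' finite_subset)
qed

section \<open>Computations as binary constraint satisfaction\<close>

text \<open>Every digit sequence has a code, which is all that is asked of codes, since constraints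
  and cycle tests look at digits only. The least significant digit comes first.\<close>

lemma digit_exists:
  assumes "\<And>i. i < n \<Longrightarrow> f i < b"
  shows "\<exists>c<b ^ n. \<forall>i<n. digit b c i = f i"
  using assms
proof (induction n arbitrary: f)
  case (Suc n)
  obtain c where c: "c < b ^ n" "\<forall>i<n. digit b c i = f (Suc i)"
    using Suc.IH[of "\<lambda>i. f (Suc i)"] Suc.prems by auto
  have f0: "f 0 < b" using Suc.prems by simp
  have "f 0 + b * c < b * (c + 1)" using f0 by simp
  also have "\<dots> \<le> b * b ^ n" using c(1) by (intro mult_left_mono) auto
  finally have "f 0 + b * c < b ^ Suc n" by simp
  moreover have "digit b (f 0 + b * c) i = f i" if "i < Suc n" for i
  proof (cases i)
    case 0
    then show ?thesis using f0 by (simp add: digit_def)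
  next
    case (Suc j)
    have "(f 0 + b * c) div b ^ Suc j = c div b ^ j"
      using f0 by (simp add: div_mult2_eq)
    then show ?thesis using Suc that c(2) by (auto simp: digit_def)
  qed
  ultimately show ?case by blast
qed simp

fun dir_code :: "dir \<Rightarrow> nat" where
  "dir_code Left_Move = 0"
| "dir_code Stay = 1"
| "dir_code Right_Move = 2"

lemma move_head_dir_code: "move_head d h = h + int (dir_code d) - 1"
  by (cases d) auto

text \<open>Resting in the halting state becomes an ordinary action, so every run can be prolonged
  to exactly \<open>T\<close> uniform steps.\<close>

definition idle_delta :: "tm \<Rightarrow> nat \<times> nat list \<Rightarrow> nat \<times> (nat \<times> dir) list" where
  "idle_delta M = (\<lambda>(q, rs). if q = halt_state M then (q, map (\<lambda>r. (r, Stay)) rs) else delta M q rs)"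

lemma step_idle_delta:
  "step M (q, ts) = (let (q', as) = idle_delta M (q, map read_tape ts) in (q', map2 act_tape as ts))"
proof (cases "q = halt_state M")
  case True
  have "map2 act_tape (map (\<lambda>r. (r, Stay)) (map read_tape ts)) ts = ts" (is "?l = ts")
  proof (rule nth_equalityI)
    fix i assume "i < length ?l"
    then show "?l ! i = ts ! i" by (cases "ts ! i") simp
  qed simp
  then show ?thesis using True by (simp add: idle_delta_def)
next
  case False
  then show ?thesis by (simp add: idle_delta_def)
qed

text \<open>All that one step depends on. A fixed machine has constantly many views, so they can be
  numbered and the transition function tabulated.\<close>

definition local_views :: "tm \<Rightarrow> (nat \<times> nat list) set" where
  "local_views M = {(q, rs). q < num_states M \<and> length rs = num_tapes M \<and> set rs \<subseteq> {..<num_symbols M}}"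

lemma idle_delta_wf:
  assumes "wf_tm M" "(q, rs) \<in> local_views M" "idle_delta M (q, rs) = (q', as)"
  shows "q' < num_states M" "length as = num_tapes M" "\<And>k. k < num_tapes M \<Longrightarrow> fst (as ! k) < num_symbols M"
proof -
  have *: "q' < num_states M \<and> length as = num_tapes M \<and> (\<forall>(s, d)\<in>set as. s < num_symbols M)"
  proof (cases "q = halt_state M")
    case True
    then show ?thesis using assms by (auto simp: idle_delta_def local_views_def)
  next
    case False
    then have "delta M q rs = (q', as)" using assms(3) by (simp add: idle_delta_def)
    moreover have "q < num_states M" "length rs = num_tapes M" "\<forall>r\<in>set rs. r < num_symbols M"
      using assms(2) by (auto simp: local_views_def)
    ultimately show ?thesis using assms(1) unfolding wf_tm_def by blast
  qed
  then show "q' < num_states M" "length as = num_tapes M" by simp_all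
  show "fst (as ! k) < num_symbols M" if "k < num_tapes M" for k
  proof -
    have "as ! k \<in> set as" using * that by simp
    with * show ?thesis by (cases "as ! k") fastforce
  qed
qed

lemma finite_local_views: "finite (local_views M)"
proof -
  have "local_views M \<subseteq> {..<num_states M} \<times> {rs. set rs \<subseteq> {..<num_symbols M} \<and> length rs = num_tapes M}"
    by (auto simp: local_views_def)
  then show ?thesis
    by (rule finite_subset) (simp add: finite_lists_length_eq)
qed

text \<open>
  A computation of length \<open>T\<close> is described by one value per time \<open>t \<le> T\<close>. The value consists of
  the number of the local view in a table, the length of the second input and, for every
  tape, the head position (shifted by \<open>T\<close>) and \<open>s + 1\<close>, where \<open>s\<close> is the last time before
  \<open>t\<close> at which the head was at the same cell (or 0 if there is none). This last number makes
  all constraints binary: the symbol read is the symbol written at time \<open>s\<close>. At time \<open>T\<close> the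
  head of the last tape is moved to cell 0 in order to inspect the output.
\<close>

locale machine =
  fixes M :: tm and tab :: "nat \<Rightarrow> nat \<times> nat list" and Z :: nat
  assumes wf: "wf_tm M" and two_tapes: "2 \<le> num_tapes M"
    and tab: "tab ` {..<Z} = local_views M"
begin

abbreviation "K \<equiv> num_tapes M"

definition view_state :: "nat \<Rightarrow> nat" where
  "view_state z = (if z < Z then fst (tab z) else 0)"

definition view_read :: "nat \<Rightarrow> nat \<Rightarrow> nat" where
  "view_read z k = (if z < Z \<and> k < K then snd (tab z) ! k else 0)"

definition next_state :: "nat \<Rightarrow> nat" where
  "next_state z = (if z < Z then fst (idle_delta M (tab z)) else 0)"

definition written :: "nat \<Rightarrow> nat \<Rightarrow> nat" where
  "written z k = (if z < Z \<and> k < K then fst (snd (idle_delta M (tab z)) ! k) else 0)"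

definition moved :: "nat \<Rightarrow> nat \<Rightarrow> nat" where
  "moved z k = (if z < Z \<and> k < K then dir_code (snd (snd (idle_delta M (tab z)) ! k)) else 0)"

text \<open>The cell number \<open>p\<close> is shifted by \<open>T\<close>. The first input is
  dictated by \<open>x\<close>; of the second only the length \<open>l\<close> is, so its bits are
  guessed by the solution.\<close>

definition initial_ok :: "bool list \<Rightarrow> nat \<Rightarrow> nat \<Rightarrow> nat \<Rightarrow> nat \<Rightarrow> nat \<Rightarrow> bool" where
  "initial_ok x T l k p r \<longleftrightarrow>
     (if k = 0 then (if T \<le> p \<and> p - T < length x then (if bit_at x (p - T) then r = 2 else r = 1) else r = 0)
      else if k = 1 then (if T \<le> p \<and> p - T < l then r = 1 \<or> r = 2 else r = 0)
      else r = 0)"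

text \<open>
  Digit 0 of a value is the number of the local view and digit 1 the length of the second input;
  digits \<open>2 + 2 * k\<close> and \<open>3 + 2 * k\<close> are the head position and the last visit for tape \<open>k\<close>.
\<close>

definition unary_ok :: "bool list \<Rightarrow> nat \<Rightarrow> nat \<Rightarrow> nat \<Rightarrow> nat \<Rightarrow> nat \<Rightarrow> bool" where
  "unary_ok x T L b t v \<longleftrightarrow>
     digit b v 0 < Z \<and> digit b v 1 \<le> L \<and>
     (t = 0 \<longrightarrow> view_state (digit b v 0) = start_state M \<and> (\<forall>k<K. digit b v (2 + 2 * k) = T)) \<and>
     (t = T \<longrightarrow> digit b v (2 + 2 * (K - 1)) = T \<and> view_read (digit b v 0) (K - 1) = 2) \<and>
     (\<forall>k<K. digit b v (3 + 2 * k) \<le> t \<and>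
        (digit b v (3 + 2 * k) = 0 \<longrightarrow>
           initial_ok x T (digit b v 1) k (digit b v (2 + 2 * k)) (view_read (digit b v 0) k)))"

text \<open>Taken over all \<open>s < t\<close>, the last two clauses say that digit
  \<open>3 + 2 * k\<close> of \<open>v\<close> is one more than the latest earlier time at the same
  cell. Transitions are imposed only for \<open>t < T\<close>, because the last head is repositioned
  at time \<open>T\<close>.\<close>

definition binary_ok :: "nat \<Rightarrow> nat \<Rightarrow> nat \<Rightarrow> nat \<Rightarrow> nat \<Rightarrow> nat \<Rightarrow> bool" where
  "binary_ok T b s u t v \<longleftrightarrow>
     digit b u 1 = digit b v 1 \<and>
     (t = Suc s \<and> t < T \<longrightarrow>
        view_state (digit b v 0) = next_state (digit b u 0) \<and>
        (\<forall>k<K. digit b v (2 + 2 * k) + 1 = digit b u (2 + 2 * k) + moved (digit b u 0) k)) \<and>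
     (\<forall>k<K.
        (digit b v (3 + 2 * k) = Suc s \<longrightarrow>
           digit b u (2 + 2 * k) = digit b v (2 + 2 * k) \<and>
           view_read (digit b v 0) k = written (digit b u 0) k) \<and>
        (digit b u (2 + 2 * k) = digit b v (2 + 2 * k) \<longrightarrow> Suc s \<le> digit b v (3 + 2 * k)))"

definition solution :: "bool list \<Rightarrow> nat \<Rightarrow> nat \<Rightarrow> nat \<Rightarrow> (nat \<Rightarrow> nat) \<Rightarrow> bool" where
  "solution x T L b f \<longleftrightarrow>
     (\<forall>t\<le>T. unary_ok x T L b t (f t)) \<and> (\<forall>t\<le>T. \<forall>s<t. binary_ok T b s (f s) t (f t))"

section \<open>Actual runs, and solutions as their descriptions\<close>

definition cfg :: "bool list \<Rightarrow> bool list \<Rightarrow> nat \<Rightarrow> config" where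
  "cfg x w t = (step M ^^ t) (initial_config M [x, w])"

definition cell :: "bool list \<Rightarrow> bool list \<Rightarrow> nat \<Rightarrow> nat \<Rightarrow> int \<Rightarrow> nat" where
  "cell x w t k = fst (snd (cfg x w t) ! k)"

definition head :: "bool list \<Rightarrow> bool list \<Rightarrow> nat \<Rightarrow> nat \<Rightarrow> int" where
  "head x w t k = snd (snd (cfg x w t) ! k)"

definition view :: "bool list \<Rightarrow> bool list \<Rightarrow> nat \<Rightarrow> nat \<times> nat list" where
  "view x w t = (fst (cfg x w t), map read_tape (snd (cfg x w t)))"

lemma cfg_Suc:
  "cfg x w (Suc t) = (fst (idle_delta M (view x w t)), map2 act_tape (snd (idle_delta M (view x w t))) (snd (cfg x w t)))"
proof -
  obtain q ts where qts: "cfg x w t = (q, ts)" by fastforce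
  have "cfg x w (Suc t) = step M (cfg x w t)" by (simp add: cfg_def)
  then show ?thesis
    unfolding qts step_idle_delta view_def by (simp add: Let_def split_beta)
qed

lemma cfg_0: "fst (cfg x w 0) = start_state M" "length (snd (cfg x w 0)) = K"
  using two_tapes by (auto simp: cfg_def initial_config_def)

lemma cell_0:
  "k < K \<Longrightarrow> cell x w 0 k = fst (input_tape (if k = 0 then x else if k = 1 then w else []))"
  using two_tapes by (auto simp: cell_def cfg_def initial_config_def nth_append nth_Cons split: nat.splits)

lemma head_0: "k < K \<Longrightarrow> head x w 0 k = 0"
  using two_tapes
  by (auto simp: head_def cfg_def initial_config_def nth_append input_tape_def nth_Cons split: nat.splits)

lemma views_in:
  assumes "fst (cfg x w t) < num_states M" "length (snd (cfg x w t)) = K"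
    and "\<forall>k<K. \<forall>p. cell x w t k p < num_symbols M"
  shows "view x w t \<in> local_views M"
proof -
  have "r < num_symbols M" if r: "r \<in> set (map read_tape (snd (cfg x w t)))" for r
  proof -
    from r obtain u where "u \<in> set (snd (cfg x w t))" "r = read_tape u" by auto
    then obtain k where k: "k < K" "r = read_tape (snd (cfg x w t) ! k)"
      using assms(2) by (auto simp only: in_set_conv_nth)
    then show ?thesis
      using assms(3) by (cases "snd (cfg x w t) ! k") (auto simp: cell_def)
  qed
  then show ?thesis
    using assms by (auto simp: view_def local_views_def simp del: set_map)
qed

lemma cfg_wf:
  "fst (cfg x w t) < num_states M \<and> length (snd (cfg x w t)) = K \<and> (\<forall>k<K. \<forall>p. cell x w t k p < num_symbols M)"
proof (induction t)
  case 0
  have "cell x w 0 k p < num_symbols M" if "k < K" for k p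
    using wf unfolding cell_0[OF that] by (auto simp: input_tape_def bit_symbol_def wf_tm_def)
  then show ?case using wf by (simp add: cfg_0 wf_tm_def)
next
  case (Suc t)
  then have v: "view x w t \<in> local_views M" using views_in by blast
  obtain q' as where d: "idle_delta M (view x w t) = (q', as)" by fastforce
  from idle_delta_wf[OF wf _ this[unfolded view_def]] v
  have wf': "q' < num_states M" "length as = K" "\<And>k. k < K \<Longrightarrow> fst (as ! k) < num_symbols M"
    by (auto simp: view_def)
  have "cell x w (Suc t) k p < num_symbols M" if "k < K" for k p
    using wf' that Suc unfolding cell_def cfg_Suc d
    by (cases "as ! k"; cases "snd (cfg x w t) ! k") (force simp: cell_def)
  then show ?case using wf' Suc by (simp add: cfg_Suc d)
qed

lemma view_in: "view x w t \<in> local_views M"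
  using views_in cfg_wf by blast

lemma length_actions: "length (snd (idle_delta M (view x w t))) = K"
  using idle_delta_wf(2)[OF wf, of "fst (view x w t)" "snd (view x w t)"] view_in[of x w t]
  by (metis prod.collapse)

lemma view_nth: "k < K \<Longrightarrow> snd (view x w t) ! k = cell x w t k (head x w t k)"
  using cfg_wf[of x w t] by (cases "snd (cfg x w t) ! k") (simp add: view_def cell_def head_def)

lemma cell_Suc:
  "k < K \<Longrightarrow> cell x w (Suc t) k = (cell x w t k)(head x w t k := fst (snd (idle_delta M (view x w t)) ! k))"
  using length_actions[of x w t] cfg_wf[of x w t] unfolding cell_def head_def cfg_Suc
  by (cases "snd (idle_delta M (view x w t)) ! k"; cases "snd (cfg x w t) ! k") simp

lemma head_Suc:
  "k < K \<Longrightarrow> head x w (Suc t) k = head x w t k + int (dir_code (snd (snd (idle_delta M (view x w t)) ! k))) - 1"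
  using length_actions[of x w t] cfg_wf[of x w t] unfolding head_def cfg_Suc
  by (cases "snd (idle_delta M (view x w t)) ! k"; cases "snd (cfg x w t) ! k") (simp add: move_head_dir_code)

lemma head_bound: "k < K \<Longrightarrow> \<bar>head x w t k\<bar> \<le> int t"
proof (induction t)
  case (Suc t)
  have "dir_code d \<le> 2" for d by (cases d) auto
  from this[of "snd (snd (idle_delta M (view x w t)) ! k)"] show ?case
    using Suc head_Suc[of k x w t] by linarith
qed (simp add: head_0)

lemma cell_unvisited:
  "k < K \<Longrightarrow> (\<And>s. s < t \<Longrightarrow> head x w s k \<noteq> p) \<Longrightarrow> cell x w t k p = cell x w 0 k p"
  by (induction t) (auto simp: cell_Suc)

lemma cell_last_visit:
  "k < K \<Longrightarrow> s < t \<Longrightarrow> head x w s k = p \<Longrightarrow> (\<And>s'. s < s' \<Longrightarrow> s' < t \<Longrightarrow> head x w s' k \<noteq> p) \<Longrightarrow>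
     cell x w t k p = fst (snd (idle_delta M (view x w s)) ! k)"
proof (induction t)
  case (Suc t)
  show ?case
  proof (cases "s = t")
    case True
    then show ?thesis using Suc.prems by (simp add: cell_Suc)
  next
    case False
    then have "s < t" "head x w t k \<noteq> p" using Suc.prems(2) Suc.prems(4)[of t] by auto
    then show ?thesis using Suc by (simp add: cell_Suc eq_commute[of p])
  qed
qed simp

lemma last_cell: "fst (last (snd (cfg x w t))) = cell x w t (K - 1)"
proof -
  have "snd (cfg x w t) \<noteq> []"
    using cfg_wf[of x w t] two_tapes by auto
  then show ?thesis
    using cfg_wf[of x w t] by (simp add: cell_def last_conv_nth)
qed

lemma initial_ok_iff:
  assumes "k < K" "l = length w" "int p = i + int T"
  shows "initial_ok x T l k p (cell x w 0 k i)"
proof -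
  have i: "0 \<le> i \<longleftrightarrow> T \<le> p" "T \<le> p \<Longrightarrow> i = int (p - T)" using assms(3) by auto
  show ?thesis
    unfolding initial_ok_def cell_0[OF assms(1)] input_tape_def using assms(2) i
    by (auto simp: bit_symbol_def bit_at_def nat_minus_as_int)
qed

text \<open>The base \<open>b\<close> leaves room for every digit: view numbers below
  \<open>Z\<close>, the length up to \<open>L\<close>, shifted head positions up to
  \<open>2 * T\<close> and last visits up to \<open>T\<close>.\<close>

lemma run_imp_solution:
  assumes w: "length w \<le> L" and acc: "cell x w T (K - 1) 0 = 2" and b: "Z + L + 2 * T < b"
  shows "\<exists>f. (\<forall>t. f t < b ^ (2 + 2 * K)) \<and> solution x T L b f"
proof -
  define pos where "pos t k = (if t = T \<and> k = K - 1 then 0 else head x w t k)" for t k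
  have pos_bound: "\<bar>pos t k\<bar> \<le> int T" if "k < K" "t \<le> T" for t k
    using head_bound[OF that(1), of x w t] that by (auto simp: pos_def)
  define hd where "hd t k = nat (pos t k + int T)" for t k
  have hd: "int (hd t k) = pos t k + int T" "hd t k \<le> 2 * T" if "k < K" "t \<le> T" for t k
    using pos_bound[OF that] by (auto simp: hd_def)
  define vw where "vw t = (fst (view x w t), map (\<lambda>k. cell x w t k (pos t k)) [0..<K])" for t
  have vw: "vw t \<in> local_views M" for t
    using view_in[of x w t] cfg_wf[of x w t] by (auto simp: vw_def local_views_def)
  have "\<exists>z<Z. tab z = vw t" for t
    using vw[of t] tab by (metis (no_types, lifting) imageE lessThan_iff)
  then obtain z where z: "\<And>t. z t < Z" "\<And>t. tab (z t) = vw t" by metis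
  have vw_less: "vw t = view x w t" if "t < T" for t
  proof -
    have "map (\<lambda>k. cell x w t k (pos t k)) [0..<K] = snd (view x w t)"
      using view_in[of x w t] that
      by (intro nth_equalityI) (auto simp: local_views_def pos_def view_nth)
    then show ?thesis by (simp add: vw_def)
  qed
  let ?vis = "\<lambda>t k s. s < t \<and> pos s k = pos t k"
  define ta where "ta t k = (if Ex (?vis t k) then Suc (GREATEST s. ?vis t k s) else 0)" for t k
  have ta_Suc: "?vis t k s \<and> (\<forall>s'. ?vis t k s' \<longrightarrow> s' \<le> s)" if "ta t k = Suc s" for t k s
  proof -
    have ex: "Ex (?vis t k)" using that unfolding ta_def by (metis Zero_not_Suc)
    then have s: "s = (GREATEST s. ?vis t k s)" using that unfolding ta_def by simp
    have bound: "\<And>s. ?vis t k s \<Longrightarrow> s \<le> t" by simp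
    show ?thesis
      unfolding s using GreatestI_ex_nat[OF ex bound] Greatest_le_nat[of "?vis t k" _ t, OF _ bound]
      by blast
  qed
  have ta_vis: "Suc s \<le> ta t k" if "?vis t k s" for t k s
  proof -
    have bound: "\<And>s. ?vis t k s \<Longrightarrow> s \<le> t" by simp
    have "Ex (?vis t k)" using that by blast
    then show ?thesis
      using Greatest_le_nat[of "?vis t k" s t, OF that bound] unfolding ta_def by simp
  qed
  have ta_le: "ta t k \<le> t" for t k
    using ta_Suc[of t k] by (cases "ta t k") auto
  have "\<exists>v<b ^ (2 + 2 * K). t \<le> T \<longrightarrow> digit b v 0 = z t \<and> digit b v 1 = length w \<and>
      (\<forall>k<K. digit b v (2 + 2 * k) = hd t k \<and> digit b v (3 + 2 * k) = ta t k)" for t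
  proof (cases "t \<le> T")
    case True
    define g where "g i = (if i = 0 then z t else if i = 1 then length w
      else if even i then hd t ((i - 2) div 2) else ta t ((i - 2) div 2))" for i
    have "g i < b" if "i < 2 + 2 * K" for i
    proof -
      have "(i - 2) div 2 < K" if "2 \<le> i" using that \<open>i < 2 + 2 * K\<close> by (simp add: less_mult_imp_div_less)
      then have "2 \<le> i \<Longrightarrow> hd t ((i - 2) div 2) \<le> 2 * T" using hd True by blast
      moreover have "ta t ((i - 2) div 2) \<le> T" using ta_le True order_trans by blast
      ultimately show ?thesis using z(1)[of t] w b by (auto simp: g_def)
    qed
    then obtain v where "v < b ^ (2 + 2 * K)" "\<forall>i<2 + 2 * K. digit b v i = g i"
      using digit_exists[of "2 + 2 * K" g b] by blast
    then show ?thesis by (intro exI[of _ v]) (auto simp: g_def)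
  next
    case False
    have "0 < b" using b by simp
    then show ?thesis using False by (intro exI[of _ 0]) auto
  qed
  then obtain f where f: "\<And>t. f t < b ^ (2 + 2 * K)"
    and fd: "\<And>t. t \<le> T \<Longrightarrow> digit b (f t) 0 = z t" "\<And>t. t \<le> T \<Longrightarrow> digit b (f t) 1 = length w"
    "\<And>t k. t \<le> T \<Longrightarrow> k < K \<Longrightarrow> digit b (f t) (2 + 2 * k) = hd t k"
    "\<And>t k. t \<le> T \<Longrightarrow> k < K \<Longrightarrow> digit b (f t) (3 + 2 * k) = ta t k"
    by metis
  have state: "view_state (z t) = fst (cfg x w t)" for t
    using z[of t] by (simp add: view_state_def vw_def view_def)
  have reads: "view_read (z t) k = cell x w t k (pos t k)" if "k < K" for t k
    using z[of t] that by (simp add: view_read_def vw_def)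
  have "unary_ok x T L b t (f t)" if t: "t \<le> T" for t
  proof -
    have "initial_ok x T (length w) k (hd t k) (cell x w t k (pos t k))"
      if k: "k < K" and ta0: "ta t k = 0" for k
    proof -
      have "head x w s k \<noteq> pos t k" if "s < t" for s
        using ta0 ta_vis[of s t k] that t by (auto simp: pos_def split: if_splits)
      then have "cell x w t k (pos t k) = cell x w 0 k (pos t k)"
        using cell_unvisited k by blast
      then show ?thesis using initial_ok_iff[OF k refl] hd(1)[OF k t] by simp
    qed
    moreover have "hd 0 k = T" if "k < K" for k
      using that by (simp add: hd_def pos_def head_0)
    moreover have "hd T (K - 1) = T" "cell x w T (K - 1) (pos T (K - 1)) = 2"
      using acc by (simp_all add: hd_def pos_def)
    moreover have "K - 1 < K" using two_tapes by simp
    ultimately show ?thesis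
      unfolding unary_ok_def using t w z(1)[of t] ta_le[of t] fd[of t]
      by (auto simp: state cfg_0 reads simp del: One_nat_def)
  qed
  moreover have "binary_ok T b s (f s) t (f t)" if t: "t \<le> T" and s: "s < t" for s t
  proof -
    have vs: "vw s = view x w s" using vw_less s t by simp
    have pos_s: "pos s k = head x w s k" for k using s t by (simp add: pos_def)
    have 1: "view_state (z t) = next_state (z s)" if "t = Suc s"
      using z(1)[of s] z(2)[of s] that vs by (simp add: state next_state_def cfg_Suc)
    have 2: "hd t k + 1 = hd s k + moved (z s) k" if "t = Suc s" "t < T" "k < K" for k
    proof -
      have "pos t k = head x w t k" using that by (simp add: pos_def)
      then have "int (hd t k) + 1 = int (hd s k) + int (moved (z s) k)"
        using hd(1)[OF that(3) t] hd(1)[of k s] s t that z(1)[of s] z(2)[of s] vs head_Suc[OF that(3), of x w s]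
        by (simp add: pos_s moved_def)
      then show ?thesis by linarith
    qed
    have 3: "hd s k = hd t k \<and> view_read (z t) k = written (z s) k" if "ta t k = Suc s" "k < K" for k
    proof -
      have vis: "pos s k = pos t k" "\<forall>s'. ?vis t k s' \<longrightarrow> s' \<le> s" using ta_Suc[OF that(1)] by auto
      have "cell x w t k (pos t k) = fst (snd (idle_delta M (view x w s)) ! k)"
      proof (rule cell_last_visit[OF that(2) s])
        show "head x w s k = pos t k" using vis pos_s by simp
        fix s' assume "s < s'" "s' < t"
        then show "head x w s' k \<noteq> pos t k" using vis(2) t by (auto simp: pos_def split: if_splits)
      qed
      then show ?thesis
        using vis(1) that(2) z(1)[of s] z(2)[of s] vs by (simp add: hd_def reads written_def)
    qed
    have 4: "Suc s \<le> ta t k" if "hd s k = hd t k" "k < K" for k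
    proof -
      have "pos s k = pos t k" using hd(1)[OF that(2), of s] hd(1)[OF that(2) t] s t that(1) by simp
      then show ?thesis using ta_vis s by blast
    qed
    show ?thesis
      unfolding binary_ok_def using t s fd[of t] fd[of s] 1 2 3 4 by (auto simp del: One_nat_def)
  qed
  ultimately show ?thesis using f unfolding solution_def by blast
qed

text \<open>By strong induction on time the values describe a genuine run: a first visit reads the
  initial content, and every later visit reads what the previous one wrote.\<close>

lemma solution_imp_run:
  assumes sol: "solution x T L b f"
  shows "\<exists>w. length w \<le> L \<and> cell x w T (K - 1) 0 = 2"
proof -
  define z where "z t = digit b (f t) 0" for t
  define l where "l = digit b (f 0) 1"
  define hd where "hd t k = digit b (f t) (2 + 2 * k)" for t k
  define ta where "ta t k = digit b (f t) (3 + 2 * k)" for t k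
  define pos where "pos t k = int (hd t k) - int T" for t k
  have u: "z t < Z" "digit b (f t) 1 \<le> L" "t = 0 \<Longrightarrow> view_state (z t) = start_state M"
    "t = 0 \<Longrightarrow> k < K \<Longrightarrow> hd t k = T"
    "t = T \<Longrightarrow> hd t (K - 1) = T" "t = T \<Longrightarrow> view_read (z t) (K - 1) = 2"
    "k < K \<Longrightarrow> ta t k \<le> t"
    "k < K \<Longrightarrow> ta t k = 0 \<Longrightarrow> initial_ok x T (digit b (f t) 1) k (hd t k) (view_read (z t) k)"
    if "t \<le> T" for t k
    using sol that unfolding solution_def unary_ok_def z_def hd_def ta_def by blast+
  have bn: "digit b (f s) 1 = digit b (f t) 1"
    "t = Suc s \<Longrightarrow> t < T \<Longrightarrow> view_state (z t) = next_state (z s)"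
    "t = Suc s \<Longrightarrow> t < T \<Longrightarrow> k < K \<Longrightarrow> hd t k + 1 = hd s k + moved (z s) k"
    "k < K \<Longrightarrow> ta t k = Suc s \<Longrightarrow> hd s k = hd t k"
    "k < K \<Longrightarrow> ta t k = Suc s \<Longrightarrow> view_read (z t) k = written (z s) k"
    "k < K \<Longrightarrow> hd s k = hd t k \<Longrightarrow> Suc s \<le> ta t k"
    if "t \<le> T" "s < t" for s t k
    using sol that unfolding solution_def binary_ok_def z_def hd_def ta_def by blast+
  have l: "digit b (f t) 1 = l" if "t \<le> T" for t
    using bn(1)[OF that, of 0] unfolding l_def by (cases t) auto
  \<comment> \<open>Each bit is read off at the first visit to its cell. A cell that is never
    visited gets \<open>False\<close>, which no constraint can notice.\<close>
  define w where "w = map (\<lambda>i. \<exists>t\<le>T. hd t 1 = T + i \<and> ta t 1 = 0 \<and> view_read (z t) 1 = 2) [0..<l]"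
  have K1: "1 < K" "K - 1 < K" using two_tapes by auto
  have first: "view_read (z t) k = cell x w 0 k (pos t k)" if t: "t \<le> T" and k: "k < K" and 0: "ta t k = 0" for t k
  proof -
    let ?r = "view_read (z t) k"
    have ok: "initial_ok x T l k (hd t k) ?r" using u(8)[OF t k 0] l[OF t] by simp
    consider "k = 0" | "k = 1" | "2 \<le> k" by linarith
    then show ?thesis
    proof cases
      case 1
      then show ?thesis
        using ok k unfolding initial_ok_def cell_0[OF k] input_tape_def pos_def bit_at_def bit_symbol_def
        by (auto simp: nat_diff_distrib split: if_splits)
    next
      case 2
      then have c0: "cell x w 0 k = fst (input_tape w)" using cell_0[OF k] by simp
      show ?thesis
      proof (cases "T \<le> hd t 1 \<and> hd t 1 - T < l")
        case True
        define i where "i = hd t 1 - T"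
        have i: "hd t 1 = T + i" "i < l" using True by (auto simp: i_def)
        \<comment> \<open>Two first visits to one cell would violate the last-visit constraint of
          the later one, so the bit of \<open>w\<close> is well defined.\<close>
        have uniq: "s = t" if s: "s \<le> T" "hd s 1 = hd t 1" "ta s 1 = 0" for s
        proof (rule ccontr)
          assume "s \<noteq> t"
          then consider "s < t" | "t < s" by linarith
          then show False
          proof cases
            case 1
            from bn(6)[OF t 1 K1(1)] s 0 \<open>k = 1\<close> show False by simp
          next
            case 2
            from bn(6)[OF s(1) 2 K1(1)] s show False by simp
          qed
        qed
        have "w ! i \<longleftrightarrow> (\<exists>s\<le>T. hd s 1 = hd t 1 \<and> ta s 1 = 0 \<and> view_read (z s) 1 = 2)"
          using i by (simp add: w_def)
        also have "\<dots> \<longleftrightarrow> ?r = 2"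
          using uniq t 0 \<open>k = 1\<close> by metis
        finally have "w ! i \<longleftrightarrow> ?r = 2" .
        moreover have "?r = 1 \<or> ?r = 2"
          using ok True \<open>k = 1\<close> by (simp add: initial_ok_def)
        moreover have "length w = l" by (simp add: w_def)
        ultimately show ?thesis
          using i unfolding c0 input_tape_def pos_def using \<open>k = 1\<close> by (auto simp: bit_symbol_def)
      next
        case False
        have "length w = l" by (simp add: w_def)
        then show ?thesis
          using False ok unfolding c0 input_tape_def pos_def initial_ok_def using \<open>k = 1\<close> by auto
      qed
    next
      case 3
      then show ?thesis
        using ok unfolding cell_0[OF k] initial_ok_def input_tape_def by auto
    qed
  qed
  \<comment> \<open>State and heads are tracked before \<open>T\<close> only; the symbols are
    correct at \<open>T\<close> too, for the positions that the solution claims there.\<close>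
  have main: "(t < T \<longrightarrow> view_state (z t) = fst (cfg x w t) \<and> (\<forall>k<K. pos t k = head x w t k)) \<and>
      (\<forall>k<K. view_read (z t) k = cell x w t k (pos t k))" if "t \<le> T" for t
    using that
  proof (induction t rule: less_induct)
    case (less t)
    have tabs: "tab (z s) = view x w s" if s: "s < t" for s
    proof -
      have IH: "view_state (z s) = fst (cfg x w s)" "\<forall>k<K. pos s k = head x w s k"
        "\<forall>k<K. view_read (z s) k = cell x w s k (pos s k)"
        using less.IH[OF s] s less.prems by auto
      have zs: "z s < Z" using u(1) s less.prems by simp
      then have "tab (z s) \<in> local_views M" using tab by blast
      then have len: "length (snd (tab (z s))) = K" by (auto simp: local_views_def)
      have "snd (tab (z s)) = snd (view x w s)"
      proof (rule nth_equalityI)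
        show "length (snd (tab (z s))) = length (snd (view x w s))"
          using len view_in[of x w s] by (auto simp: local_views_def)
        fix k assume "k < length (snd (tab (z s)))"
        then show "snd (tab (z s)) ! k = snd (view x w s) ! k"
          using len IH zs by (simp add: view_nth view_read_def)
      qed
      moreover have "fst (tab (z s)) = fst (view x w s)"
        using IH(1) zs by (simp add: view_state_def view_def)
      ultimately show ?thesis by (metis prod_eqI)
    qed
    have heads: "pos s k = head x w s k" if "s < t" "k < K" for s k
      using less.IH[OF that(1)] that less.prems by auto
    have "view_state (z t) = fst (cfg x w t) \<and> (\<forall>k<K. pos t k = head x w t k)" if "t < T"
    proof (cases t)
      case 0
      then show ?thesis using u(3)[of t] u(4)[of t] by (auto simp: cfg_0 head_0 pos_def)
    next
      case (Suc s)
      then have s: "s < t" "z s < Z" "t = Suc s" using u(1)[of s] less.prems by auto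
      have "pos t k = head x w t k" if k: "k < K" for k
      proof -
        have "int (hd t k) + 1 = int (hd s k) + int (moved (z s) k)"
          using bn(3)[OF less.prems s(1) s(3) \<open>t < T\<close> k] by linarith
        then show ?thesis
          using heads[OF s(1) k] tabs[OF s(1)] s(2) head_Suc[OF k, of x w s] Suc k
          by (simp add: pos_def moved_def)
      qed
      moreover have "view_state (z t) = fst (cfg x w t)"
        using bn(2)[OF less.prems s(1) s(3) \<open>t < T\<close>] tabs[OF s(1)] s Suc by (simp add: next_state_def cfg_Suc)
      ultimately show ?thesis by blast
    qed
    moreover have "view_read (z t) k = cell x w t k (pos t k)" if k: "k < K" for k
    proof (cases "ta t k")
      case 0
      have "head x w s k \<noteq> pos t k" if "s < t" for s
        using bn(6)[OF less.prems that k] heads[OF that k] 0 by (auto simp: pos_def)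
      then have "cell x w t k (pos t k) = cell x w 0 k (pos t k)"
        using cell_unvisited[OF k] by blast
      then show ?thesis using first[OF less.prems k 0] by simp
    next
      case (Suc s)
      have s: "s < t" "z s < Z" using u(7)[OF less.prems k] u(1)[of s] Suc less.prems by auto
      have "cell x w t k (pos t k) = fst (snd (idle_delta M (view x w s)) ! k)"
      proof (rule cell_last_visit[OF k s(1)])
        show "head x w s k = pos t k"
          using bn(4)[OF less.prems s(1) k Suc] heads[OF s(1) k] by (simp add: pos_def)
        fix s' assume s': "s < s'" "s' < t"
        show "head x w s' k \<noteq> pos t k"
          using bn(6)[OF less.prems s'(2) k] heads[OF s'(2) k] Suc s' by (auto simp: pos_def)
      qed
      then show ?thesis
        using bn(5)[OF less.prems s(1) k Suc] tabs[OF s(1)] s(2) k by (simp add: written_def)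
    qed
    ultimately show ?case by blast
  qed
  have "length w \<le> L" using u(2)[of 0] by (simp add: w_def l_def)
  moreover have "cell x w T (K - 1) 0 = 2"
    using main[OF order_refl] K1 u(5)[OF order_refl] u(6)[OF order_refl] by (simp add: pos_def)
  ultimately show ?thesis by blast
qed

lemma solution_iff:
  assumes "Z + L + 2 * T < b"
  shows "(\<exists>f. (\<forall>t. f t < b ^ (2 + 2 * K)) \<and> solution x T L b f) \<longleftrightarrow>
    (\<exists>w. length w \<le> L \<and> fst (last (snd ((step M ^^ T) (initial_config M [x, w])))) 0 = 2)"
  using run_imp_solution[OF _ _ assms] solution_imp_run last_cell unfolding cfg_def by metis

end

section \<open>NP-hardness\<close>

lemma PT_gadget_arc:
  assumes "PT C m" "PT C h" "PT C u" "PT C v"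
    and "PTb (extend (extend C)) (\<lambda>e. E (fst (fst e)) (snd (fst e)) (snd e))"
  shows "PTb C (\<lambda>e. gadget_arc (m e) q (h e) (E e) (u e) (v e))"
  unfolding gadget_arc_def path_vertex_def path_length_def
  by (intro PT_rules assms)

section \<open>The graph of a constraint system\<close>

context machine
begin

lemma PT_views:
  "PT C f \<Longrightarrow> PT C (\<lambda>e. view_state (f e))" "PT C f \<Longrightarrow> PT C (\<lambda>e. next_state (f e))"
  "PT C f \<Longrightarrow> PT C g \<Longrightarrow> PT C (\<lambda>e. view_read (f e) (g e))"
  "PT C f \<Longrightarrow> PT C g \<Longrightarrow> PT C (\<lambda>e. written (f e) (g e))"
  "PT C f \<Longrightarrow> PT C g \<Longrightarrow> PT C (\<lambda>e. moved (f e) (g e))"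
  unfolding view_state_def next_state_def view_read_def written_def moved_def
  by (rule PT_table[where g = "\<lambda>z. fst (tab z)"] PT_table[where g = "\<lambda>z. fst (idle_delta M (tab z))"]
      PT_table2[where g = "\<lambda>z k. snd (tab z) ! k"]
      PT_table2[where g = "\<lambda>z k. fst (snd (idle_delta M (tab z)) ! k)"]
      PT_table2[where g = "\<lambda>z k. dir_code (snd (snd (idle_delta M (tab z)) ! k))"]; assumption)+

lemma PT_initial_ok:
  "input1 C X \<Longrightarrow> PT C T \<Longrightarrow> PT C l \<Longrightarrow> PT C k \<Longrightarrow> PT C p \<Longrightarrow> PT C r \<Longrightarrow>
     PTb C (\<lambda>e. initial_ok (X e) (T e) (l e) (k e) (p e) (r e))"
  unfolding initial_ok_def by (intro PT_rules)

lemma PT_unary_ok: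
  "input1 C X \<Longrightarrow> PT C T \<Longrightarrow> PT C L \<Longrightarrow> PT C b \<Longrightarrow> PT C t \<Longrightarrow> PT C v \<Longrightarrow>
     PTb C (\<lambda>e. unary_ok (X e) (T e) (L e) (b e) (t e) (v e))"
  unfolding unary_ok_def by (intro PT_views PT_initial_ok PT_rules)

lemma PT_binary_ok:
  "PT C T \<Longrightarrow> PT C b \<Longrightarrow> PT C s \<Longrightarrow> PT C u \<Longrightarrow> PT C t \<Longrightarrow> PT C v \<Longrightarrow>
     PTb C (\<lambda>e. binary_ok (T e) (b e) (s e) (u e) (t e) (v e))"
  unfolding binary_ok_def by (intro PT_views PT_rules)

text \<open>
  The last block contains the hub and is compatible with everything that satisfies the unary
  constraints.
\<close>

definition conflict :: "bool list \<Rightarrow> nat \<Rightarrow> nat \<Rightarrow> nat \<Rightarrow> nat \<Rightarrow> nat \<Rightarrow> nat \<Rightarrow> nat \<Rightarrow> bool" where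
  "conflict x T L b s u t v \<longleftrightarrow>
     (if t = Suc T then \<not> unary_ok x T L b s u else \<not> binary_ok T b s u t v)"

text \<open>Vertex \<open>a\<close> stands for the value \<open>a mod D\<close> of the variable
  \<open>a div D\<close>.\<close>

definition csp_edge :: "bool list \<Rightarrow> nat \<Rightarrow> nat \<Rightarrow> nat \<Rightarrow> nat \<Rightarrow> nat \<Rightarrow> nat \<Rightarrow> bool" where
  "csp_edge x T L b D a c \<longleftrightarrow>
     a \<noteq> c \<and>
     (a div D = c div D \<or>
      (a div D < c div D \<and> conflict x T L b (a div D) (a mod D) (c div D) (c mod D)) \<or>
      (c div D < a div D \<and> conflict x T L b (c div D) (c mod D) (a div D) (a mod D)))"

lemma PT_csp_edge:
  "input1 C X \<Longrightarrow> PT C T \<Longrightarrow> PT C L \<Longrightarrow> PT C b \<Longrightarrow> PT C D \<Longrightarrow> PT C a \<Longrightarrow> PT C c \<Longrightarrow>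
     PTb C (\<lambda>e. csp_edge (X e) (T e) (L e) (b e) (D e) (a e) (c e))"
  unfolding csp_edge_def conflict_def by (intro PT_unary_ok PT_binary_ok PT_rules)

definition csp_graph :: "nat \<Rightarrow> bool list \<Rightarrow> nat \<Rightarrow> nat \<Rightarrow> nat \<Rightarrow> nat \<Rightarrow> nat graph" where
  "csp_graph q x T L b D = gadget_graph ((T + 2) * D) q ((T + 1) * D) (csp_edge x T L b D)"

lemma csp_gadget:
  assumes "1 \<le> q" "0 < D"
  shows "gadget ((T + 2) * D) q ((T + 1) * D) (csp_edge x T L b D)"
  by unfold_locales (use assms in \<open>auto simp: csp_edge_def\<close>)

text \<open>The budget leaves one vertex per block uncovered. A value violating its unary constraint
  is joined to the whole last block, hence to whichever vertex is left uncovered there.\<close>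

lemma csp_graph_correct:
  assumes q: "1 \<le> q" and b: "Z + L + 2 * T + 1 < b" and D: "D = b ^ (2 + 2 * K)"
  shows "(\<exists>S. connected_odd_cycle_transversal (csp_graph q x T L b D) S \<and> card S \<le> (T + 2) * (D - 1)) \<longleftrightarrow>
    (\<exists>w. length w \<le> L \<and> fst (last (snd ((step M ^^ T) (initial_config M [x, w])))) 0 = 2)"
proof -
  let ?E = "csp_edge x T L b D"
  let ?B = "T + 2"
  let ?m = "?B * D"
  let ?h = "(T + 1) * D"
  have "b ^ 1 \<le> D" unfolding D using b by (intro power_increasing) auto
  then have D2: "2 \<le> D" using b by simp
  interpret gadget ?m q ?h ?E
    by (rule csp_gadget) (use q D2 in auto)
  have less: "t * D + v < ?m" if "t < ?B" "v < D" for t v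
  proof -
    have "t * D + v < (t + 1) * D" using that by simp
    also have "\<dots> \<le> ?m" using that by (intro mult_right_mono) auto
    finally show ?thesis .
  qed
  have "\<exists>f. (\<forall>t. f t < D) \<and> solution x T L b f"
    if S: "connected_odd_cycle_transversal G S" "card S \<le> ?B * (D - 1)" for S
  proof -
    from OCT_imp_cover[of S] S obtain C where C: "C \<subseteq> {..<?m}" "card C \<le> card S"
      "\<And>a c. a < ?m \<Longrightarrow> c < ?m \<Longrightarrow> ?E a c \<Longrightarrow> a \<in> C \<or> c \<in> C"
      unfolding connected_odd_cycle_transversal_def by blast
    have "\<exists>f. \<forall>t<?B. f t < D \<and> t * D + f t \<notin> C"
      by (rule small_cover_imp_transversal[OF C(1)]) (use C S D2 in \<open>auto simp: csp_edge_def\<close>)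
    then obtain f where f: "\<And>t. t < ?B \<Longrightarrow> f t < D" "\<And>t. t < ?B \<Longrightarrow> t * D + f t \<notin> C" by blast
    have no_conf: "\<not> conflict x T L b s (f s) t (f t)" if "s < t" "t < ?B" for s t
    proof
      assume c: "conflict x T L b s (f s) t (f t)"
      have st: "s < ?B" using that by simp
      have "(s * D + f s) div D = s" "(s * D + f s) mod D = f s"
        "(t * D + f t) div D = t" "(t * D + f t) mod D = f t"
        using f(1)[OF st] f(1)[OF that(2)] by auto
      then have "?E (s * D + f s) (t * D + f t)"
        using c that unfolding csp_edge_def by auto
      then show False
        using C(3)[OF less less] f st that(2) by blast
    qed
    \<comment> \<open>The transversal speaks of blocks below \<open>?B\<close> only; 0 elsewhere
      keeps all values below \<open>D\<close>.\<close>
    have "solution x T L b (\<lambda>t. if t < ?B then f t else 0)"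
      unfolding solution_def
    proof (intro conjI allI impI)
      fix t assume "t \<le> T"
      with no_conf[of t "Suc T"] show "unary_ok x T L b t (if t < ?B then f t else 0)"
        by (simp add: conflict_def)
    next
      fix t s assume "t \<le> T" "s < t"
      with no_conf[of s t] show "binary_ok T b s (if s < ?B then f s else 0) t (if t < ?B then f t else 0)"
        by (simp add: conflict_def)
    qed
    moreover have "\<forall>t. (if t < ?B then f t else 0) < D" using f(1) D2 by simp
    ultimately show ?thesis by (intro exI[of _ "\<lambda>t. if t < ?B then f t else 0"] conjI)
  qed
  moreover have "\<exists>S. connected_odd_cycle_transversal G S \<and> card S \<le> ?B * (D - 1)"
    if f: "\<forall>t. f t < D" "solution x T L b f" for f
  proof -
    \<comment> \<open>The hub is value 0 of the last block. Selecting value 1 there, which exists by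
      \<open>D2\<close>, puts the hub into the cover.\<close>
    define g where "g t = (if t = Suc T then 1 else f t)" for t
    have g: "g t < D" for t using f(1) D2 by (simp add: g_def)
    let ?C = "{..<?m} - (\<lambda>t. t * D + g t) ` {..<?B}"
    have dm: "(t * D + g t) div D = t" "(t * D + g t) mod D = g t" for t
      using g[of t] by auto
    have "?h \<in> ?C"
    proof -
      have "?h \<noteq> t * D + g t" for t
      proof
        assume eq: "?h = t * D + g t"
        have "?h div D = T + 1" "?h mod D = 0" using D2 by (simp_all del: mult_Suc add_Suc_right)
        then show False using dm[of t] unfolding eq by (simp add: g_def)
      qed
      then show ?thesis using hub by auto
    qed
    moreover have "a \<in> ?C \<or> c \<in> ?C" if ac: "a < ?m" "c < ?m" "?E a c" for a c
    proof (rule ccontr)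
      assume "\<not> (a \<in> ?C \<or> c \<in> ?C)"
      then obtain s t where st: "s < ?B" "a = s * D + g s" "t < ?B" "c = t * D + g t"
        using ac by auto
      have no_conf: "\<not> conflict x T L b i (g i) j (g j)" if "i < j" "j < ?B" for i j
        using f(2) that unfolding solution_def conflict_def g_def by auto
      from ac(3) st no_conf[of s t] no_conf[of t s] show False
        unfolding csp_edge_def by (auto simp: dm g simp del: One_nat_def)
    qed
    ultimately have "connected_odd_cycle_transversal G ?C"
      by (intro cover_imp_OCT) auto
    moreover have "card ?C = ?B * (D - 1)"
      by (rule card_transversal_complement) (rule g)
    ultimately show ?thesis by (metis order_refl)
  qed
  ultimately have "(\<exists>S. connected_odd_cycle_transversal G S \<and> card S \<le> ?B * (D - 1)) \<longleftrightarrow>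
      (\<exists>f. (\<forall>t. f t < D) \<and> solution x T L b f)"
    by blast
  also have "\<dots> \<longleftrightarrow> (\<exists>w. length w \<le> L \<and> fst (last (snd ((step M ^^ T) (initial_config M [x, w])))) 0 = 2)"
    unfolding D by (rule solution_iff) (use b in simp)
  finally show ?thesis unfolding csp_graph_def .
qed

end

lemma funpow_step_halted: "(step M ^^ n) (halt_state M, ts) = (halt_state M, ts)"
  by (induction n) auto

lemma girth_language_iff:
  assumes "simple_graph G" "standard_vertices G" "enat p \<le> girth G"
  shows "encode G k \<in> connected_OCT_girth_language p \<longleftrightarrow>
    (\<exists>S. connected_odd_cycle_transversal G S \<and> card S \<le> k)"
  using assms encode_inject[OF assms(1,2)]
  unfolding connected_OCT_girth_language_def connected_OCT_problem_def by blast

theorem NP_hard_connected_OCT_girth: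
  "NP_hard (connected_OCT_girth_language p)"
  unfolding NP_hard_def
proof (intro allI impI)
  fix A assume "in_NP A"
  then obtain R and bp :: "nat poly" where
    R: "poly_time_computable 2 (\<lambda>xs. [R (xs ! 0) (xs ! 1)])"
    "\<And>x. x \<in> A \<longleftrightarrow> (\<exists>w. length w \<le> poly bp (length x) \<and> R x w)"
    unfolding in_NP_def by blast
  then obtain M Tp where M: "wf_tm M" "2 \<le> num_tapes M"
    "\<And>xs. length xs = 2 \<Longrightarrow> computes_within M xs (poly Tp (sum_list (map length xs))) [R (xs ! 0) (xs ! 1)]"
    unfolding poly_time_computable_def by blast
  define Z where "Z = card (local_views M)"
  obtain tab where "bij_betw tab {0..<Z} (local_views M)"
    using ex_bij_betw_nat_finite[OF finite_local_views] unfolding Z_def by blast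
  then have "tab ` {..<Z} = local_views M"
    by (simp add: bij_betw_def atLeast0LessThan)
  then interpret machine M tab Z using M by unfold_locales
  define L where "L x = poly bp (length x)" for x :: "bool list"
  \<comment> \<open>One time bound for all certificates of length at most \<open>L x\<close>; runs
    that halt earlier rest until then.\<close>
  define T where "T x = poly Tp (length x + L x)" for x :: "bool list"
  define b where "b x = Z + L x + 2 * T x + 2" for x :: "bool list"
  \<comment> \<open>The exponent depends on the machine only, so the number of values is polynomial
    in the length of \<open>x\<close>.\<close>
  define D where "D x = b x ^ (2 + 2 * K)" for x :: "bool list"
  define m where "m x = (T x + 2) * D x" for x :: "bool list"
  define h where "h x = (T x + 1) * D x" for x :: "bool list"
  define k where "k x = (T x + 2) * (D x - 1)" for x :: "bool list"
  \<comment> \<open>This makes \<open>q\<close> positive and \<open>2 * q\<close> at least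
    \<open>p\<close>, also for \<open>p = 0\<close>.\<close>
  define q where "q = p + 1"
  define n where "n x = gadget_size (m x) q" for x :: "bool list"
  define G where "G x = csp_graph q x (T x) (L x) (b x) (D x)" for x
  define E where "E x = csp_edge x (T x) (L x) (b x) (D x)" for x
  have G_eq: "G x = gadget_graph (m x) q (h x) (E x)" for x
    by (simp add: G_def csp_graph_def m_def h_def E_def)
  have gadget: "gadget (m x) q (h x) (E x)" for x
    unfolding m_def h_def E_def by (rule csp_gadget) (auto simp: q_def D_def b_def)
  have "R x w \<longleftrightarrow> fst (last (snd ((step M ^^ T x) (initial_config M [x, w])))) 0 = 2"
    if "length w \<le> L x" for x w
  proof -
    from M(3)[of "[x, w]"] obtain t ts where t: "t \<le> poly Tp (length x + length w)"
      "(step M ^^ t) (initial_config M [x, w]) = (halt_state M, ts)" "output_on (last ts) [R x w]"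
      by (auto simp: computes_within_def)
    have "t \<le> T x"
      using t(1) poly_nat_mono[of "length x + length w" "length x + L x" Tp] that unfolding T_def by linarith
    then have "(step M ^^ T x) (initial_config M [x, w]) = (halt_state M, ts)"
      using funpow_trans[OF t(2), of "T x - t"] funpow_step_halted by simp
    then show ?thesis using t(3) by (auto simp: output_on_def bit_symbol_def)
  qed
  then have "x \<in> A \<longleftrightarrow> (\<exists>w. length w \<le> L x \<and> fst (last (snd ((step M ^^ T x) (initial_config M [x, w])))) 0 = 2)" for x
    unfolding R(2) L_def by blast
  also have "\<dots> x \<longleftrightarrow> (\<exists>S. connected_odd_cycle_transversal (G x) S \<and> card S \<le> k x)" for x
    unfolding G_def k_def
    by (rule csp_graph_correct[symmetric]) (simp_all add: q_def b_def D_def)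
  also have "\<dots> x \<longleftrightarrow> encode (G x) (k x) \<in> connected_OCT_girth_language p" for x
  proof (rule girth_language_iff[symmetric])
    interpret gadget "m x" q "h x" "E x" by (rule gadget)
    show "simple_graph (G x)" "standard_vertices (G x)" "enat p \<le> girth (G x)"
      unfolding G_eq using simple_G standard_G girth_G by (simp_all add: q_def)
  qed
  finally have correct: "x \<in> A \<longleftrightarrow> encode (G x) (k x) \<in> connected_OCT_girth_language p" for x .
  define A' where "A' x i j \<longleftrightarrow> gadget_arc (m x) q (h x) (E x) i j \<or> gadget_arc (m x) q (h x) (E x) j i" for x i j
  have enc: "encode (G x) (k x) = map (\<lambda>i. of_bool (encode_bit (n x) (A' x) (k x) i) \<noteq> (0::nat))
      [0..<n x + 1 + n x * n x + card {i. i < k x \<and> 0 < k x div 2 ^ i}]" for x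
  proof -
    interpret gadget "m x" q "h x" "E x" by (rule gadget)
    have "verts (G x) = {..<n x}" unfolding G_eq n_def by (rule verts_G)
    from encode_eq_map[OF this, of "k x"] show ?thesis
      unfolding G_eq edge_iff A'_def by simp
  qed
  let ?C = "\<lambda>e :: bool list. (e, [] :: bool list, [] :: nat list)"
  have X: "input1 ?C (\<lambda>e. e)" by (simp add: input1_def)
  have PL: "PT ?C L" unfolding L_def by (intro PT_poly PT_length1 X)
  have PTt: "PT ?C T" unfolding T_def by (intro PT_poly PT_add PT_length1 X PL)
  have Pb: "PT ?C b" unfolding b_def by (intro PT_add PT_mult PT_const PL PTt)
  have PD: "PT ?C D" unfolding D_def by (intro PT_power Pb)
  have Pm: "PT ?C m" unfolding m_def by (intro PT_add PT_mult PT_const PD PTt)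
  have Ph: "PT ?C h" unfolding h_def by (intro PT_add PT_mult PT_const PD PTt)
  have Pk: "PT ?C k" unfolding k_def by (intro PT_add PT_mult PT_diff PT_const PD PTt)
  have Pn: "PT ?C n" unfolding n_def gadget_size_def by (intro PT_add PT_mult PT_const Pm)
  have PE: "PTb C (\<lambda>e. E (Y e) (a e) (c e))"
    if "input1 C Y" "PT C (\<lambda>e. T (Y e))" "PT C (\<lambda>e. L (Y e))" "PT C (\<lambda>e. b (Y e))" "PT C (\<lambda>e. D (Y e))"
      "PT C a" "PT C c" for C :: "'c ctx" and Y a c
    unfolding E_def using that by (rule PT_csp_edge)
  have PA: "PTb C (\<lambda>e. A' (Y e) (u e) (v e))"
    if "input1 C Y" "PT C (\<lambda>e. T (Y e))" "PT C (\<lambda>e. L (Y e))" "PT C (\<lambda>e. b (Y e))" "PT C (\<lambda>e. D (Y e))"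
      "PT C (\<lambda>e. m (Y e))" "PT C (\<lambda>e. h (Y e))" "PT C u" "PT C v" for C :: "'c ctx" and Y u v
    unfolding A'_def E_def
    by (intro PT_disj PT_gadget_arc PT_csp_edge input1_extend that PT_snd PT_weaken)
  have bit: "PT (extend ?C) (\<lambda>e. of_bool (encode_bit (n (fst e)) (A' (fst e)) (k (fst e)) (snd e)))"
    unfolding encode_bit_def
    by (intro PT_disj PT_conj PT_if_bool PT_less PT_eq PT_digit PA PT_add PT_mult PT_diff PT_div PT_mod
        PT_const PT_snd PT_weaken input1_extend X PL PTt Pb PD Pm Ph Pk Pn)
  have len: "PT ?C (\<lambda>x. n x + 1 + n x * n x + card {i. i < k x \<and> 0 < k x div 2 ^ i})"
    by (intro PT_add PT_mult PT_count PT_less PT_div_power PT_const PT_snd PT_weaken Pk Pn)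
  have "poly_time_computable 1 (\<lambda>xs. encode (G (xs ! 0)) (k (xs ! 0)))"
    unfolding enc by (rule poly_time_computable_1[OF len bit])
  with correct show "poly_time_reducible A (connected_OCT_girth_language p)"
    unfolding poly_time_reducible_def by (intro exI[of _ "\<lambda>x. encode (G x) (k x)"]) blast
qed

section \<open>Membership in NP\<close>

fun binary_value :: "bool list \<Rightarrow> nat" where
  "binary_value [] = 0"
| "binary_value (b # bs) = of_bool b + 2 * binary_value bs"

lemma binary_value_binary [simp]: "binary_value (binary k) = k"
proof (induction k rule: less_induct)
  case (less k)
  show ?case
  proof (cases "k = 0")
    case False
    then have "binary_value (binary k) = of_bool (odd k) + 2 * (k div 2)"
      using less.IH[of "k div 2"] by (simp add: binary_pos)
    then show ?thesis by (cases "even k") simp_all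
  qed (simp add: binary_0)
qed

lemma binary_value_pos: "bs \<noteq> [] \<Longrightarrow> last bs \<Longrightarrow> 0 < binary_value bs"
  by (induction bs) (auto split: if_splits)

text \<open>The most significant bit comes last. A final \<open>False\<close> would be a leading
  zero, which \<open>binary\<close> never produces.\<close>

lemma binary_binary_value: "bs = [] \<or> last bs \<Longrightarrow> binary (binary_value bs) = bs"
proof (induction bs)
  case (Cons b bs)
  then have IH: "binary (binary_value bs) = bs" by (auto split: if_splits)
  have "0 < binary_value (b # bs)" using Cons.prems binary_value_pos by blast
  then show ?case using IH by (simp add: binary_pos)
qed (simp add: binary_0)

lemma last_binary: "binary k \<noteq> [] \<Longrightarrow> last (binary k)"
proof (induction k rule: less_induct)
  case (less k)
  then have "0 < k" using binary_0 by (cases "k = 0") auto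
  show ?case
  proof (cases "k = 1")
    case True
    then show ?thesis by (simp add: binary_pos binary_0)
  next
    case False
    then have "binary (k div 2) \<noteq> []" using \<open>0 < k\<close> by (subst binary_pos) auto
    with less.IH[of "k div 2"] \<open>0 < k\<close> show ?thesis by (simp add: binary_pos)
  qed
qed

section \<open>Recognising encodings of instances\<close>

definition adj_bit :: "bool list \<Rightarrow> nat \<Rightarrow> nat \<Rightarrow> nat \<Rightarrow> bool" where
  "adj_bit x n i j \<longleftrightarrow> bit_at x (n + 1 + (i * n + j))"

text \<open>The last clause excludes leading zeros of the number, so that exactly the words in the
  range of \<open>encode\<close> pass.\<close>

definition valid_encoding :: "bool list \<Rightarrow> nat \<Rightarrow> bool" where
  "valid_encoding x n \<longleftrightarrow>
     (\<forall>i<n. bit_at x i) \<and> \<not> bit_at x n \<and> n + 1 + n * n \<le> length x \<and>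
     (\<forall>i<n. \<not> adj_bit x n i i \<and> (\<forall>j<n. adj_bit x n i j \<longrightarrow> adj_bit x n j i)) \<and>
     (n + 1 + n * n < length x \<longrightarrow> bit_at x (length x - 1))"

definition decoded_graph :: "bool list \<Rightarrow> nat \<Rightarrow> nat graph" where
  "decoded_graph x n = ({..<n}, {{i, j} | i j. i < n \<and> j < n \<and> adj_bit x n i j})"

definition decoded_number :: "bool list \<Rightarrow> nat \<Rightarrow> nat" where
  "decoded_number x n = binary_value (drop (n + 1 + n * n) x)"

lemma valid_encoding_correct:
  assumes "valid_encoding x n"
  shows "simple_graph (decoded_graph x n)" "standard_vertices (decoded_graph x n)"
    "encode (decoded_graph x n) (decoded_number x n) = x"
    "\<And>i j. i < n \<Longrightarrow> j < n \<Longrightarrow> {i, j} \<in> edges (decoded_graph x n) \<longleftrightarrow> adj_bit x n i j"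
proof -
  have v: "\<And>i. i < n \<Longrightarrow> bit_at x i" "\<not> bit_at x n" "n + 1 + n * n \<le> length x"
    "\<And>i. i < n \<Longrightarrow> \<not> adj_bit x n i i" "\<And>i j. i < n \<Longrightarrow> j < n \<Longrightarrow> adj_bit x n i j \<Longrightarrow> adj_bit x n j i"
    "n + 1 + n * n < length x \<Longrightarrow> bit_at x (length x - 1)"
    using assms unfolding valid_encoding_def by blast+
  show adj: "{i, j} \<in> edges (decoded_graph x n) \<longleftrightarrow> adj_bit x n i j" if "i < n" "j < n" for i j
    using that v(5) by (auto simp: decoded_graph_def doubleton_eq_iff)
  show "simple_graph (decoded_graph x n)"
    using v(4) by (fastforce simp: simple_graph_def decoded_graph_def card_2_iff)
  show "standard_vertices (decoded_graph x n)"
    by (simp add: standard_vertices_def decoded_graph_def)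
  let ?ds = "drop (n + 1 + n * n) x"
  have "?ds = [] \<or> last ?ds"
  proof (cases "n + 1 + n * n < length x")
    case True
    then have "last ?ds = last x" "x \<noteq> []" by (auto simp: last_drop)
    then show ?thesis using v(6)[OF True] by (simp add: bit_at_def last_conv_nth)
  qed simp
  then have ds: "binary (decoded_number x n) = ?ds"
    unfolding decoded_number_def by (rule binary_binary_value)
  have "matrix_bits n (\<lambda>i j. {i, j} \<in> edges (decoded_graph x n)) = take (n * n) (drop (n + 1) x)"
    (is "?l = ?r")
  proof (rule nth_equalityI)
    show "length ?l = length ?r" using v(3) by (simp add: matrix_bits_def)
    fix r assume "r < length ?l"
    then have r: "r < n * n" by (simp add: matrix_bits_def)
    then have "0 < n" by (cases "n = 0") auto
    then have "r div n < n" "r mod n < n"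
      using r by (simp_all add: less_mult_imp_div_less)
    then have "?l ! r \<longleftrightarrow> adj_bit x n (r div n) (r mod n)"
      using r adj by (simp add: matrix_bits_def)
    also have "\<dots> \<longleftrightarrow> ?r ! r"
      using r v(3) by (simp add: adj_bit_def bit_at_def)
    finally show "?l ! r = ?r ! r" by simp
  qed
  moreover have "replicate n True = take n x"
    using v(1,3) by (intro nth_equalityI) (auto simp: bit_at_def)
  moreover have "x ! n = False" using v(2,3) by (auto simp: bit_at_def)
  moreover have "x = take n x @ x ! n # take (n * n) (drop (n + 1) x) @ ?ds"
  proof -
    have "x = take n x @ x ! n # drop (Suc n) x"
      using v(3) by (simp add: id_take_nth_drop)
    also have "drop (Suc n) x = take (n * n) (drop (n + 1) x) @ drop (n * n) (drop (n + 1) x)"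
      unfolding Suc_eq_plus1 by (rule append_take_drop_id[symmetric])
    also have "drop (n * n) (drop (n + 1) x) = ?ds" by (simp add: add.commute)
    finally show ?thesis .
  qed
  moreover have "encode (decoded_graph x n) (decoded_number x n) =
      replicate n True @ False # matrix_bits n (\<lambda>i j. {i, j} \<in> edges (decoded_graph x n)) @ ?ds"
    using encode_eq[of "decoded_graph x n" n] ds by (simp add: decoded_graph_def)
  ultimately show "encode (decoded_graph x n) (decoded_number x n) = x" by simp
qed

lemma encode_valid:
  fixes k :: nat
  assumes G: "simple_graph G" "verts G = {..<n}"
  defines "x \<equiv> encode G k"
  shows "valid_encoding x n" "n < length x" "decoded_number x n = k"
    "\<And>i j. i < n \<Longrightarrow> j < n \<Longrightarrow> {i, j} \<in> edges G \<longleftrightarrow> adj_bit x n i j"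
proof -
  let ?A = "\<lambda>i j. {i, j} \<in> edges G"
  have x: "x = replicate n True @ False # matrix_bits n ?A @ binary k"
    unfolding x_def by (rule encode_eq[OF G(2)])
  have len: "length x = n + 1 + n * n + length (binary k)"
    by (simp add: x matrix_bits_def)
  show "n < length x" using len by simp
  show adj: "?A i j \<longleftrightarrow> adj_bit x n i j" if "i < n" "j < n" for i j
  proof -
    have "i * n + j < (i + 1) * n" using that by simp
    also have "\<dots> \<le> n * n" using that by (intro mult_right_mono) auto
    finally have lt: "i * n + j < n * n" .
    then have "x ! (n + 1 + (i * n + j)) = matrix_bits n ?A ! (i * n + j)"
      by (simp add: x nth_append matrix_bits_def)
    also have "\<dots> = ?A i j" using lt that by (simp add: matrix_bits_def)
    finally show ?thesis using lt len by (simp add: adj_bit_def bit_at_def)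
  qed
  show "decoded_number x n = k"
    by (simp add: decoded_number_def x matrix_bits_def)
  have single: "{i} \<notin> edges G" for i
    using G(1) by (fastforce simp: simple_graph_def)
  have last: "bit_at x (length x - 1)" if "n + 1 + n * n < length x"
  proof -
    have "binary k \<noteq> []" using that len by auto
    then have "last x" using last_binary by (simp add: x)
    moreover have "x \<noteq> []" using that by auto
    ultimately show ?thesis by (simp add: bit_at_def last_conv_nth)
  qed
  show "valid_encoding x n"
    unfolding valid_encoding_def
  proof (intro conjI allI impI)
    show "bit_at x i" if "i < n" for i
      using that len by (simp add: x bit_at_def nth_append)
    show "\<not> bit_at x n" by (simp add: x bit_at_def nth_append)
    show "\<not> adj_bit x n i i" if "i < n" for i
      using adj[OF that that] single by simp
    show "adj_bit x n j i" if "i < n" "j < n" "adj_bit x n i j" for i j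
      using adj[OF that(1,2)] adj[OF that(2,1)] that(3) by (simp add: insert_commute)
  qed (use len last in simp_all)
qed

text \<open>Exhaustive search: as \<open>p\<close> is a constant, the vertex sequences of length
  less than \<open>p\<close> are among polynomially many codes in base \<open>n\<close>.\<close>

definition no_cycle_code :: "nat \<Rightarrow> bool list \<Rightarrow> nat \<Rightarrow> bool" where
  "no_cycle_code p x n \<longleftrightarrow>
     (\<forall>l<p. \<forall>c<n ^ p. 3 \<le> l \<longrightarrow>
        \<not> ((\<forall>j<l. \<forall>i<j. digit n c i \<noteq> digit n c j) \<and>
           (\<forall>i<l. adj_bit x n (digit n c i) (digit n c (Suc i mod l)))))"

lemma no_cycle_code_iff:
  assumes V: "verts G = {..<n}"
    and adj: "\<And>i j. i < n \<Longrightarrow> j < n \<Longrightarrow> {i, j} \<in> edges G \<longleftrightarrow> adj_bit x n i j"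
  shows "enat p \<le> girth G \<longleftrightarrow> no_cycle_code p x n"
proof -
  have "enat p \<le> girth G \<longleftrightarrow> (\<forall>c. is_cycle G c \<longrightarrow> p \<le> length c)"
    by (auto simp: girth_def le_INF_iff)
  also have "\<dots> \<longleftrightarrow> no_cycle_code p x n"
  proof
    assume short: "\<forall>c. is_cycle G c \<longrightarrow> p \<le> length c"
    show "no_cycle_code p x n"
      unfolding no_cycle_code_def
    proof (intro allI impI notI)
      fix l c assume l: "l < p" "3 \<le> l" and c: "c < n ^ p"
        and cyc: "(\<forall>j<l. \<forall>i<j. digit n c i \<noteq> digit n c j) \<and>
           (\<forall>i<l. adj_bit x n (digit n c i) (digit n c (Suc i mod l)))"
      have n: "0 < n" using c l by (cases "n = 0") (auto simp: power_0_left)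
      then have dig: "digit n c i < n" for i by (simp add: digit_def)
      let ?c = "map (digit n c) [0..<l]"
      have "is_cycle G ?c"
        unfolding is_cycle_def
      proof (intro conjI allI impI)
        show "distinct ?c"
        proof -
          have "inj_on (digit n c) {0..<l}"
          proof (rule inj_onI)
            fix i j assume "i \<in> {0..<l}" "j \<in> {0..<l}" "digit n c i = digit n c j"
            then show "i = j" using cyc by (metis atLeastLessThan_iff linorder_neqE_nat)
          qed
          then show ?thesis by (simp add: distinct_map)
        qed
        fix i assume i: "i < length ?c"
        then have "Suc i mod l < l" using l by (intro mod_less_divisor) simp
        then show "{?c ! i, ?c ! (Suc i mod length ?c)} \<in> edges G"
          using i cyc dig adj by simp
      qed (use l dig V in auto)
      with short l show False by fastforce
    qed
  next
    assume code: "no_cycle_code p x n"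
    show "\<forall>c. is_cycle G c \<longrightarrow> p \<le> length c"
    proof (intro allI impI, rule ccontr)
      fix c assume cyc: "is_cycle G c" and "\<not> p \<le> length c"
      then have l: "3 \<le> length c" "length c < p" by (auto simp: is_cycle_def)
      have cn: "c ! i < n" if "i < length c" for i
        using cyc nth_mem[OF that] V by (auto simp: is_cycle_def)
      \<comment> \<open>Positions beyond the cycle are padded with one of its vertices, so that all
        \<open>p\<close> digits are below \<open>n\<close>.\<close>
      let ?f = "\<lambda>i. if i < length c then c ! i else c ! 0"
      have "c ! 0 < n" by (rule cn) (use l in linarith)
      then have "?f i < n" for i using cn by simp
      then obtain d where d: "d < n ^ p" "\<forall>i<p. digit n d i = ?f i"
        using digit_exists[of p ?f n] by blast
      have dc: "digit n d i = c ! i" if "i < length c" for i using d(2) that l by auto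
      have "digit n d i \<noteq> digit n d j" if "j < length c" "i < j" for i j
        using dc[of i] dc[of j] that cyc by (simp add: is_cycle_def nth_eq_iff_index_eq)
      moreover have "adj_bit x n (digit n d i) (digit n d (Suc i mod length c))" if "i < length c" for i
      proof -
        have "Suc i mod length c < length c" using that by (intro mod_less_divisor) linarith
        then show ?thesis
          using dc that cyc cn adj[of "c ! i" "c ! (Suc i mod length c)"] by (simp add: is_cycle_def)
      qed
      ultimately show False
        using code l d(1) unfolding no_cycle_code_def by blast
    qed
  qed
  finally show ?thesis .
qed

text \<open>
  A certificate lists the transversal \<open>S\<close>, a colouring of the remaining vertices and, in unary, a
  rank for every vertex. Connectedness of \<open>S\<close> is witnessed by the condition that every vertex of
  \<open>S\<close> except one has a neighbour of smaller rank in \<open>S\<close>.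
\<close>

definition cert_rank :: "bool list \<Rightarrow> nat \<Rightarrow> nat \<Rightarrow> nat" where
  "cert_rank w n v = card {i. i < n * n \<and> bit_at w (2 * n + (v * (n * n) + i))}"

text \<open>Horner's scheme, starting from the last and most significant bit. The number itself may
  be exponential in the length of \<open>x\<close>; as no vertex set exceeds \<open>n\<close>,
  truncating at \<open>n\<close> in every round keeps the comparison correct.\<close>

definition capped_number :: "bool list \<Rightarrow> nat \<Rightarrow> nat \<Rightarrow> nat" where
  "capped_number x n l =
     rec_nat 0 (\<lambda>j r. if n < of_bool (bit_at x (length x - 1 - j)) + 2 * r then n
        else of_bool (bit_at x (length x - 1 - j)) + 2 * r) l"

definition certificate :: "bool list \<Rightarrow> bool list \<Rightarrow> nat \<Rightarrow> bool" where
  "certificate x w n \<longleftrightarrow>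
     (\<forall>u<n. \<forall>v<n. adj_bit x n u v \<and> \<not> bit_at w u \<and> \<not> bit_at w v \<longrightarrow>
        (bit_at w (n + u) \<and> \<not> bit_at w (n + v)) \<or> (\<not> bit_at w (n + u) \<and> bit_at w (n + v))) \<and>
     (n = 0 \<or> (\<exists>r<n. \<forall>v<n. bit_at w v \<and> \<not> v = r \<longrightarrow>
        (\<exists>u<n. bit_at w u \<and> adj_bit x n u v \<and> cert_rank w n u < cert_rank w n v))) \<and>
     card {v. v < n \<and> bit_at w v} \<le> capped_number x n (length x - (n + 1 + n * n))"

lemma capped_number_eq: "l \<le> length x \<Longrightarrow> capped_number x n l = min n (binary_value (drop (length x - l) x))"
proof (induction l)
  case (Suc l)
  let ?i = "length x - Suc l"
  have "drop ?i x = x ! ?i # drop (Suc ?i) x"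
    by (rule Cons_nth_drop_Suc[symmetric]) (use Suc.prems in simp)
  moreover have "Suc ?i = length x - l" using Suc.prems by simp
  ultimately have "drop ?i x = x ! ?i # drop (length x - l) x" by simp
  then have "binary_value (drop ?i x) = of_bool (x ! ?i) + 2 * binary_value (drop (length x - l) x)"
    by simp
  moreover have "bit_at x (length x - 1 - l) \<longleftrightarrow> x ! ?i"
  proof -
    have "?i < length x" using Suc.prems by linarith
    then show ?thesis by (simp add: bit_at_def)
  qed
  moreover have "capped_number x n (Suc l) =
      min n (of_bool (bit_at x (length x - 1 - l)) + 2 * capped_number x n l)"
    by (simp add: capped_number_def min_def)
  ultimately show ?case using Suc by (simp add: min_def)
qed (simp add: capped_number_def)

lemma capped_number_le: "capped_number x n l \<le> n"
  by (induction l) (auto simp: capped_number_def)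

lemma card_le_capped_number:
  assumes len: "n + 1 + n * n \<le> length x" and T: "T \<subseteq> {..<n}"
  shows "card T \<le> capped_number x n (length x - (n + 1 + n * n)) \<longleftrightarrow> card T \<le> decoded_number x n"
proof -
  have "card T \<le> n" using card_mono[OF _ T] by simp
  then show ?thesis using len by (simp add: capped_number_eq decoded_number_def)
qed

lemma transversal_imp_certificate:
  assumes G: "verts G = {..<n}"
    and adj: "\<And>i j. i < n \<Longrightarrow> j < n \<Longrightarrow> {i, j} \<in> edges G \<longleftrightarrow> adj_bit x n i j"
    and len: "n + 1 + n * n \<le> length x"
    and ex: "\<exists>S. connected_odd_cycle_transversal G S \<and> card S \<le> decoded_number x n"
  shows "\<exists>w. length w \<le> 2 * n + n * (n * n) \<and> certificate x w n"
proof -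
  from ex obtain S where S: "S \<subseteq> {..<n}" "bipartite (induced_subgraph G ({..<n} - S))"
    "connected_graph (induced_subgraph G S)" "card S \<le> decoded_number x n"
    by (auto simp: connected_odd_cycle_transversal_def odd_cycle_transversal_def G)
  from S(2) obtain A B where AB: "A \<inter> B = {}"
    "\<And>e. e \<in> edges G \<Longrightarrow> e \<subseteq> {..<n} - S \<Longrightarrow> \<exists>a\<in>A. \<exists>b\<in>B. e = {a, b}"
    by (auto simp: bipartite_def induced_subgraph_def)
  let ?R = "{(a, b). {a, b} \<in> edges (induced_subgraph G S)}"
  have R: "?R \<subseteq> {..<n} \<times> {..<n}" using S(1) by (auto simp: induced_subgraph_def)
  then have finR: "finite ?R" by (rule finite_subset) simp
  have cardR: "card ?R \<le> n * n" using card_mono[OF _ R] by (simp add: card_cartesian_product)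
  \<comment> \<open>An empty transversal needs a root as well, because the certificate asks for some
    \<open>r < n\<close>.\<close>
  obtain r where r: "S \<noteq> {} \<Longrightarrow> r \<in> S" "n \<noteq> 0 \<Longrightarrow> r < n"
  proof (cases "S = {}")
    case True
    then show ?thesis using that[of 0] by simp
  next
    case False
    then show ?thesis using that S(1) by blast
  qed
  define rk where "rk v = (LEAST d. (r, v) \<in> ?R ^^ d)" for v
  \<comment> \<open>Ranks will be distances from \<open>r\<close>. They are bounded by the number of
    pairs in \<open>?R\<close>, which is where \<open>n * n\<close> bits per vertex come
    from.\<close>
  have reach: "\<exists>d\<le>n * n. (r, v) \<in> ?R ^^ d" if "v \<in> S" for v
  proof -
    have "(r, v) \<in> ?R\<^sup>*"
      using S(3) r that unfolding connected_graph_def by (auto simp: induced_subgraph_def)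
    then obtain d where "d \<le> card ?R" "(r, v) \<in> ?R ^^ d"
      unfolding rtrancl_finite_eq_relpow[OF finR] by blast
    then show ?thesis using cardR le_trans by blast
  qed
  have rk: "rk v \<le> n * n" if "v \<in> S" for v
    using reach[OF that] Least_le[of "\<lambda>d. (r, v) \<in> ?R ^^ d"] unfolding rk_def by (meson order_trans)
  have parent: "\<exists>u. (u, v) \<in> ?R \<and> rk u < rk v" if "v \<in> S" "v \<noteq> r" for v
  proof -
    have "(r, v) \<in> ?R ^^ rk v"
      unfolding rk_def using reach[OF that(1)] by (meson LeastI)
    moreover from this have "rk v \<noteq> 0" using that(2) by (metis relpow_0_E)
    ultimately obtain d u where d: "rk v = Suc d" "(r, u) \<in> ?R ^^ d" "(u, v) \<in> ?R"
      by (metis relpow_Suc_E not0_implies_Suc)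
    have "rk u \<le> d" unfolding rk_def using d(2) by (rule Least_le)
    with d show ?thesis by auto
  qed
  \<comment> \<open>Layout: \<open>n\<close> bits for \<open>S\<close>, \<open>n\<close> bits for
    the colours, then one block of \<open>n * n\<close> bits per vertex with its rank in
    unary.\<close>
  define bit where "bit i \<longleftrightarrow> (if i < n then i \<in> S else if i < 2 * n then i - n \<in> A
    else (i - 2 * n) mod (n * n) < rk ((i - 2 * n) div (n * n)))" for i
  define w where "w = map bit [0..<2 * n + n * (n * n)]"
  have lw: "length w = 2 * n + n * (n * n)" by (simp add: w_def)
  have bw: "bit_at w i \<longleftrightarrow> i < length w \<and> bit i" for i
    unfolding bit_at_def lw by (auto simp: w_def simp del: upt_Suc)
  have wS: "bit_at w v \<longleftrightarrow> v \<in> S" and wA: "bit_at w (n + v) \<longleftrightarrow> v \<in> A" if "v < n" for v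
    using that unfolding bw lw by (auto simp: bit_def)
  have wr: "cert_rank w n v = rk v" if "v \<in> S" for v
  proof -
    have v: "v < n" using that S(1) by auto
    have bits: "bit_at w (2 * n + (v * (n * n) + i)) \<longleftrightarrow> i < rk v" if i: "i < n * n" for i
    proof -
      have "v * (n * n) + i < (v + 1) * (n * n)" using i by simp
      also have "\<dots> \<le> n * (n * n)" using v by (intro mult_right_mono) auto
      finally have "v * (n * n) + i < n * (n * n)" .
      moreover have "(v * (n * n) + i) div (n * n) = v" "(v * (n * n) + i) mod (n * n) = i"
        using i by (cases "n = 0"; simp)+
      ultimately show ?thesis unfolding bw lw bit_def by simp
    qed
    have "{i. i < n * n \<and> bit_at w (2 * n + (v * (n * n) + i))} = {..<rk v}"
      unfolding set_eq_iff mem_Collect_eq lessThan_iff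
      using bits rk[OF that] by (meson less_le_trans)
    then show ?thesis by (simp add: cert_rank_def)
  qed
  have "certificate x w n"
    unfolding certificate_def
  proof (intro conjI allI impI)
    fix u v assume uv: "u < n" "v < n" "adj_bit x n u v \<and> \<not> bit_at w u \<and> \<not> bit_at w v"
    then have "{u, v} \<in> edges G" "{u, v} \<subseteq> {..<n} - S"
      using adj[OF uv(1,2)] wS[OF uv(1)] wS[OF uv(2)] by auto
    from AB(2)[OF this] show "(bit_at w (n + u) \<and> \<not> bit_at w (n + v)) \<or> (\<not> bit_at w (n + u) \<and> bit_at w (n + v))"
      using AB(1) wA[OF uv(1)] wA[OF uv(2)] by (auto simp: doubleton_eq_iff)
  next
    show "n = 0 \<or> (\<exists>r<n. \<forall>v<n. bit_at w v \<and> \<not> v = r \<longrightarrow>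
      (\<exists>u<n. bit_at w u \<and> adj_bit x n u v \<and> cert_rank w n u < cert_rank w n v))"
    proof (cases "n = 0")
      case False
      have "\<exists>u<n. bit_at w u \<and> adj_bit x n u v \<and> cert_rank w n u < cert_rank w n v"
        if v: "v < n" "bit_at w v" "v \<noteq> r" for v
      proof -
        have vS: "v \<in> S" using wS v by simp
        then obtain u where u: "(u, v) \<in> ?R" "rk u < rk v" using parent v(3) by blast
        then have "u \<in> S" "{u, v} \<in> edges G" by (auto simp: induced_subgraph_def)
        moreover from this have "u < n" using S(1) by auto
        ultimately show ?thesis using u(2) vS wS[of u] wr[of u] wr[of v] adj[of u v] v(1) by auto
      qed
      then show ?thesis using r(2) False by blast
    qed simp
  next
    have "{v. v < n \<and> bit_at w v} = S" using wS S(1) by auto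
    then show "card {v. v < n \<and> bit_at w v} \<le> capped_number x n (length x - (n + 1 + n * n))"
      using S(1,4) card_le_capped_number[OF len] by simp
  qed
  then show ?thesis using lw by (intro exI[of _ w]) simp
qed

text \<open>Passing to a neighbour of smaller rank again and again must stop, and it can stop only
  at the root, so each vertex of the marked set is joined to the root within the set.\<close>

lemma certificate_imp_transversal:
  assumes G: "simple_graph G" "verts G = {..<n}"
    and adj: "\<And>i j. i < n \<Longrightarrow> j < n \<Longrightarrow> {i, j} \<in> edges G \<longleftrightarrow> adj_bit x n i j"
    and len: "n + 1 + n * n \<le> length x"
    and w: "certificate x w n"
  shows "\<exists>S. connected_odd_cycle_transversal G S \<and> card S \<le> decoded_number x n"
proof -
  define S where "S = {v. v < n \<and> bit_at w v}"
  have col: "bit_at w (n + u) \<noteq> bit_at w (n + v)"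
    if "u < n" "v < n" "{u, v} \<in> edges G" "u \<notin> S" "v \<notin> S" for u v
    using w that adj unfolding certificate_def S_def by blast
  have "bipartite (induced_subgraph G (verts G - S))"
    unfolding bipartite_def
  proof (intro exI conjI ballI)
    let ?A = "{v \<in> {..<n} - S. bit_at w (n + v)}" and ?B = "{v \<in> {..<n} - S. \<not> bit_at w (n + v)}"
    show "?A \<union> ?B = verts (induced_subgraph G (verts G - S))"
      by (auto simp: induced_subgraph_def G(2))
    show "?A \<inter> ?B = {}" by auto
    fix e assume "e \<in> edges (induced_subgraph G (verts G - S))"
    then have e: "e \<in> edges G" "e \<subseteq> {..<n} - S" by (auto simp: induced_subgraph_def G(2))
    moreover have "card e = 2" using G(1) e(1) by (simp add: simple_graph_def)
    then obtain u v where "e = {u, v}" by (meson card_2_iff)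
    ultimately have "u \<in> {..<n} - S" "v \<in> {..<n} - S" "bit_at w (n + u) \<noteq> bit_at w (n + v)"
      using col[of u v] by auto
    then show "\<exists>a\<in>?A. \<exists>b\<in>?B. e = {a, b}"
      using \<open>e = {u, v}\<close> by (cases "bit_at w (n + u)") (auto simp: insert_commute)
  qed
  moreover have "connected_graph (induced_subgraph G S)"
  proof (cases "n = 0")
    case True
    then show ?thesis by (simp add: connected_graph_def induced_subgraph_def S_def)
  next
    case False
    let ?R = "{(a, b). {a, b} \<in> edges (induced_subgraph G S)}"
    from False w obtain r where r: "r < n" "\<And>v. v < n \<Longrightarrow> bit_at w v \<Longrightarrow> v \<noteq> r \<Longrightarrow>
        \<exists>u<n. bit_at w u \<and> adj_bit x n u v \<and> cert_rank w n u < cert_rank w n v"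
      unfolding certificate_def by blast
    have symR: "sym (?R\<^sup>*)"
      by (intro sym_rtrancl) (auto simp: sym_def insert_commute)
    have "v \<in> S \<Longrightarrow> (r, v) \<in> ?R\<^sup>*" for v
    proof (induction "cert_rank w n v" arbitrary: v rule: less_induct)
      case less
      show ?case
      proof (cases "v = r")
        case False
        then obtain u where u: "u < n" "bit_at w u" "adj_bit x n u v" "cert_rank w n u < cert_rank w n v"
          using r(2)[of v] less.prems by (auto simp: S_def)
        then have "u \<in> S" by (simp add: S_def)
        then have "(r, u) \<in> ?R\<^sup>*" using less.hyps u(4) by blast
        moreover have "(u, v) \<in> ?R"
          using u less.prems \<open>u \<in> S\<close> adj by (auto simp: induced_subgraph_def S_def)
        ultimately show ?thesis by (rule rtrancl_into_rtrancl)
      qed simp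
    qed
    then have "(u, v) \<in> ?R\<^sup>*" if "u \<in> S" "v \<in> S" for u v
      using that symR by (meson rtrancl_trans symD)
    then show ?thesis by (simp add: connected_graph_def induced_subgraph_def)
  qed
  moreover have "S \<subseteq> {..<n}" by (auto simp: S_def)
  moreover have "card S \<le> decoded_number x n"
    using w card_le_capped_number[OF len, of S] unfolding certificate_def S_def by auto
  ultimately show "\<exists>S. connected_odd_cycle_transversal G S \<and> card S \<le> decoded_number x n"
    unfolding connected_odd_cycle_transversal_def odd_cycle_transversal_def G(2) by blast
qed

text \<open>The number of vertices is found by trying everything below the length of the word; a
  valid encoding is longer than that number.\<close>

definition verifier :: "nat \<Rightarrow> bool list \<Rightarrow> bool list \<Rightarrow> bool" where
  "verifier p x w \<longleftrightarrow> (\<exists>n<length x. valid_encoding x n \<and> no_cycle_code p x n \<and> certificate x w n)"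

lemma language_imp_verifier:
  assumes "x \<in> connected_OCT_girth_language p"
  shows "\<exists>n w. n < length x \<and> length w \<le> 2 * n + n * (n * n) \<and> verifier p x w"
proof -
  obtain G k where G: "x = encode G k" "simple_graph G" "standard_vertices G" "enat p \<le> girth G"
    "\<exists>S. connected_odd_cycle_transversal G S \<and> card S \<le> k"
    using assms unfolding connected_OCT_girth_language_def connected_OCT_problem_def by blast
  define n where "n = card (verts G)"
  have V: "verts G = {..<n}" using G(3) by (simp add: standard_vertices_def n_def)
  note e = encode_valid[OF G(2) V, where k = k, folded G(1)]
  have "n + 1 + n * n \<le> length x" using e(1) by (simp add: valid_encoding_def)
  from transversal_imp_certificate[OF V e(4) this] no_cycle_code_iff[OF V e(4)] e(1,2,3) G(4,5)
  show ?thesis unfolding verifier_def by blast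
qed

lemma verifier_imp_language:
  assumes "verifier p x w"
  shows "x \<in> connected_OCT_girth_language p"
proof -
  obtain n where n: "valid_encoding x n" "no_cycle_code p x n" "certificate x w n"
    using assms unfolding verifier_def by blast
  note v = valid_encoding_correct[OF n(1)]
  have V: "verts (decoded_graph x n) = {..<n}" by (simp add: decoded_graph_def)
  have "n + 1 + n * n \<le> length x" using n(1) by (simp add: valid_encoding_def)
  from certificate_imp_transversal[OF v(1) V v(4) this n(3)] no_cycle_code_iff[OF V v(4), of p] n(2) v(1-3)
  show ?thesis
    unfolding connected_OCT_girth_language_def connected_OCT_problem_def
    by (intro CollectI exI[of _ "decoded_graph x n"] exI[of _ "decoded_number x n"]) auto
qed

lemma PT_adj_bit: "input1 C X \<Longrightarrow> PT C n \<Longrightarrow> PT C i \<Longrightarrow> PT C j \<Longrightarrow> PTb C (\<lambda>e. adj_bit (X e) (n e) (i e) (j e))"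
  unfolding adj_bit_def by (intro PT_rules)

lemma PT_valid_encoding: "input1 C X \<Longrightarrow> PT C n \<Longrightarrow> PTb C (\<lambda>e. valid_encoding (X e) (n e))"
  unfolding valid_encoding_def by (intro PT_adj_bit PT_rules)

lemma PT_no_cycle_code: "input1 C X \<Longrightarrow> PT C n \<Longrightarrow> PTb C (\<lambda>e. no_cycle_code p (X e) (n e))"
  unfolding no_cycle_code_def by (intro PT_adj_bit PT_rules PT_power)

lemma PT_cert_rank: "input2 C Y \<Longrightarrow> PT C n \<Longrightarrow> PT C v \<Longrightarrow> PT C (\<lambda>e. cert_rank (Y e) (n e) (v e))"
  unfolding cert_rank_def by (intro PT_rules)

lemma PT_capped_number:
  assumes "input1 C X" "PT C n" "PT C l"
  shows "PT C (\<lambda>e. capped_number (X e) (n e) (l e))"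
  unfolding capped_number_def
proof (rule PT_rec[where B = n])
  show "poly_bounded C n" by (rule PT_poly_bounded[OF assms(2)])
  show "rec_nat 0 (\<lambda>j r. if n e < of_bool (bit_at (X e) (length (X e) - 1 - j)) + 2 * r then n e
        else of_bool (bit_at (X e) (length (X e) - 1 - j)) + 2 * r) j \<le> n e" for e j
    using capped_number_le[of "X e" "n e" j] by (simp add: capped_number_def)
qed (intro PT_rules assms)+

lemma PT_certificate:
  "input1 C X \<Longrightarrow> input2 C Y \<Longrightarrow> PT C n \<Longrightarrow> PTb C (\<lambda>e. certificate (X e) (Y e) (n e))"
  unfolding certificate_def by (intro PT_adj_bit PT_cert_rank PT_capped_number PT_rules)

theorem in_NP_connected_OCT_girth: "in_NP (connected_OCT_girth_language p)"
  unfolding in_NP_def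
proof (intro exI conjI allI)
  let ?C = "\<lambda>e :: bool list \<times> bool list. (fst e, snd e, [] :: nat list)"
  have X: "input1 ?C fst" "input2 ?C snd" by (simp_all add: input1_def input2_def)
  have "PTb ?C (\<lambda>e. verifier p (fst e) (snd e))"
    unfolding verifier_def
    by (intro PT_bex PT_conj PT_valid_encoding PT_no_cycle_code PT_certificate PT_snd PT_length1
        input1_extend input2_extend X)
  from PT_weaken[OF this]
  have "PT (extend ?C) (\<lambda>e. of_bool (verifier p (fst (fst e)) (snd (fst e))))" .
  from poly_time_computable_2[OF PT_const[of _ 1] this]
  show "poly_time_computable 2 (\<lambda>xs. [verifier p (xs ! 0) (xs ! 1)])" by simp
  show "x \<in> connected_OCT_girth_language p \<longleftrightarrow>
      (\<exists>w. length w \<le> poly [:0, 2, 0, 1:] (length x) \<and> verifier p x w)" for x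
  proof
    assume "x \<in> connected_OCT_girth_language p"
    then obtain n w where n: "n < length x" "length w \<le> 2 * n + n * (n * n)" "verifier p x w"
      using language_imp_verifier by blast
    have "n * (n * n) \<le> length x * (length x * length x)"
      using n(1) by (intro mult_mono) auto
    with n have "length w \<le> poly [:0, 2, 0, 1:] (length x)" by (simp add: algebra_simps)
    with n(3) show "\<exists>w. length w \<le> poly [:0, 2, 0, 1:] (length x) \<and> verifier p x w" by blast
  qed (use verifier_imp_language in blast)
qed

theorem theorem4:
  fixes p :: nat
  assumes "3 \<le> p"
  shows "NP_complete (connected_OCT_girth_language p)"
  using in_NP_connected_OCT_girth NP_hard_connected_OCT_girth by (simp add: NP_complete_def)

end
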